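(* Let $1\leq p_0,q_0\leq+\infty$ and $1\leq p,q\leq+\infty$. Then the inclusion map $i:RM(p_0,q_0)\to RM(p,q)$ is (well defined and) compact if and only if $\frac1p+\frac1q>\frac1{p_0}+\frac1{q_0}$ and $p<p_0$.
   Context: $\mathbb{D}$ is the open unit disc of $\mathbb{C}$ and $\mathcal{H}(\mathbb{D})$ is the space of holomorphic functions on $\mathbb{D}$. For $1\le p,q\leq+\infty$, $RM(p,q)=\{f\in\mathcal{H}(\mathbb{D}):\rho_{p,q}(f)<+\infty\}$, where $$\rho_{p,q}(f)=\left(\frac{1}{2\pi}\int_0^{2\pi}\left(\int_0^1|f(re^{it})|^p\,dr\right)^{q/p}dt\right)^{1/q}\ (p,q<\infty),$$ $$\rho_{p,\infty}(f)=\operatorname{ess\,sup}_{t\in[0,2\pi)}\left(\int_0^1|f(re^{it})|^p\,dr\right)^{1/p}\ (p<\infty),$$ $$\rho_{\infty,q}(f)=\left(\frac{1}{2\pi}\int_0^{2\pi}\left(\sup_{r\in[0,1)}|f(re^{it})|\right)^{q}dt\right)^{1/q}\ (q<\infty),\qquad \rho_{\infty,\infty}(f)=\sup_{z\in\mathbb{D}}|f(z)|.$$ $RM(p,q)$ is a Banach space with norm $\rho_{p,q}$. Convention: $1/\infty=0$; the condition $p<p_0$ for $p_0=\infty$ means $p$ is finite. The assertion "$i:RM(p_0,q_0)\to RM(p,q)$ is compact" means that $RM(p_0,q_0)\subset RM(p,q)$ and that the inclusion $i(f)=f$ is a compact linear operator. *)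

theory Defs
  imports "HOL-Probability.Essential_Supremum" "HOL-Complex_Analysis.Complex_Analysis"
begin

abbreviation unit_disc :: "complex set" where
  "unit_disc \<equiv> ball 0 1"

(* Powers on [0, \<infinity>], used only with a > 0. *)
definition ennpowr :: "ennreal \<Rightarrow> real \<Rightarrow> ennreal" where
  "ennpowr x a = (if x = \<infinity> then \<infinity> else ennreal (enn2real x powr a))"

(* rcis r t is r * exp (i t). All quantities take values in [0, \<infinity>]; the exponents p and q range
   over [1, \<infinity>] and enn2real is applied to them only when they are finite. *)
definition radial_int :: "real \<Rightarrow> (complex \<Rightarrow> complex) \<Rightarrow> real \<Rightarrow> ennreal" where
  "radial_int p f t = (\<integral>\<^sup>+ r\<in>{0..<1}. ennreal (cmod (f (rcis r t)) powr p) \<partial>lborel)"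

definition radial_sup :: "(complex \<Rightarrow> complex) \<Rightarrow> real \<Rightarrow> ennreal" where
  "radial_sup f t = (SUP r\<in>{0..<1}. ennreal (cmod (f (rcis r t))))"

definition rho :: "ennreal \<Rightarrow> ennreal \<Rightarrow> (complex \<Rightarrow> complex) \<Rightarrow> ennreal" where
  "rho p q f =
    (if p < \<infinity> \<and> q < \<infinity> then
       ennpowr (ennreal (1 / (2 * pi)) *
         (\<integral>\<^sup>+ t\<in>{0..2 * pi}. ennpowr (radial_int (enn2real p) f t) (enn2real q / enn2real p) \<partial>lborel))
         (1 / enn2real q)
     else if p < \<infinity> then
       esssup (restrict_space lborel {0..<2 * pi})
         (\<lambda>t. ennpowr (radial_int (enn2real p) f t) (1 / enn2real p))
     else if q < \<infinity> then
       ennpowr (ennreal (1 / (2 * pi)) *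
         (\<integral>\<^sup>+ t\<in>{0..2 * pi}. ennpowr (radial_sup f t) (enn2real q) \<partial>lborel))
         (1 / enn2real q)
     else (SUP z\<in>unit_disc. ennreal (cmod (f z))))"

(* A function on the disc is represented by its extension by 0 to the whole plane, so that
   equality of elements is equality on the disc and RM p q is closed under the pointwise
   vector space operations. *)
definition RM :: "ennreal \<Rightarrow> ennreal \<Rightarrow> (complex \<Rightarrow> complex) set" where
  "RM p q = {f. f holomorphic_on unit_disc \<and> (\<forall>z. z \<notin> unit_disc \<longrightarrow> f z = 0) \<and> rho p q f < \<infinity>}"

definition RM_norm :: "ennreal \<Rightarrow> ennreal \<Rightarrow> (complex \<Rightarrow> complex) \<Rightarrow> real" where
  "RM_norm p q f = enn2real (rho p q f)"

definition norm_topology :: "('a \<Rightarrow> complex) set \<Rightarrow> (('a \<Rightarrow> complex) \<Rightarrow> real) \<Rightarrow> ('a \<Rightarrow> complex) topology" where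
  "norm_topology X n = Metric_space.mtopology X (\<lambda>f g. n (\<lambda>z. f z - g z))"

definition linear_operator ::
  "('a \<Rightarrow> complex) set \<Rightarrow> ('b \<Rightarrow> complex) set \<Rightarrow> (('a \<Rightarrow> complex) \<Rightarrow> ('b \<Rightarrow> complex)) \<Rightarrow> bool" where
  "linear_operator X Y T \<longleftrightarrow>
     T \<in> X \<rightarrow> Y \<and>
     (\<forall>f\<in>X. \<forall>g\<in>X. T (\<lambda>z. f z + g z) = (\<lambda>z. T f z + T g z)) \<and>
     (\<forall>c. \<forall>f\<in>X. T (\<lambda>z. c * f z) = (\<lambda>z. c * T f z))"

(* Compact operator between the normed function spaces (X, m) and (Y, n): bounded sets are
   mapped to relatively compact sets. *)
definition compact_operator ::
  "('a \<Rightarrow> complex) set \<Rightarrow> (('a \<Rightarrow> complex) \<Rightarrow> real) \<Rightarrow> ('b \<Rightarrow> complex) set \<Rightarrow> (('b \<Rightarrow> complex) \<Rightarrow> real) \<Rightarrow>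
   (('a \<Rightarrow> complex) \<Rightarrow> ('b \<Rightarrow> complex)) \<Rightarrow> bool" where
  "compact_operator X m Y n T \<longleftrightarrow>
     linear_operator X Y T \<and>
     (\<forall>B. B \<subseteq> X \<and> (\<exists>C. \<forall>f\<in>B. m f \<le> C) \<longrightarrow>
        compactin (norm_topology Y n) (norm_topology Y n closure_of (T ` B)))"

end

theory Submission
  imports Defs
begin

text \<open>All exponents are replaced by their reciprocals \<open>a = 1/p\<close>, \<open>b = 1/q\<close>, so that the exponent \<open>\<infinity>\<close>
becomes \<open>0\<close> and Hoelder's inequality adds parameters.

Sufficiency: bounded sequences are normal families, so it suffices that the part of \<open>f\<close> on
\<open>R < |z| < 1\<close> is uniformly small in \<open>RM(p,q)\<close> as \<open>R \<rightarrow> 1\<close>. This follows by interpolating, through Hoelder's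
inequality, between the norm of \<open>RM(p\<^sub>0,q\<^sub>0)\<close> and the pointwise growth bound
\<open>|f(z)| \<le> C (1 - |z|)\<^bsup>-1/p\<^sub>0-1/q\<^sub>0\<^esup>\<close>. The growth bound comes from Cauchy's formula on squares for
\<open>w \<mapsto> f(e\<^sup>w)\<close>, averaged over the side length.

Necessity: bounded sequences in \<open>RM(p\<^sub>0,q\<^sub>0)\<close> tending to \<open>0\<close> pointwise must have a subsequence tending to \<open>0\<close> in
\<open>RM(p,q)\<close>. If \<open>p \<ge> p\<^sub>0\<close>, this fails for \<open>n\<^bsup>1/p\<^sub>0\<^esup> z\<^sup>n\<close>; if \<open>1/p + 1/q \<le> s = 1/p\<^sub>0 + 1/q\<^sub>0\<close>, it fails for
\<open>\<delta>\<^bsup>-s\<^esup> (\<delta> / (1 + \<delta> - z))\<^sup>4\<close> with \<open>\<delta> \<rightarrow> 0\<close>.\<close>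

section \<open>Lebesgue norms of nonnegative functions\<close>

text \<open>The two conditions together are equivalent to
  \<open>a\<^sub>0 + b\<^sub>0 < a + min b b\<^sub>0\<close>, and this is what the tail estimate
  consumes: the growth bound contributes a weight (1-r)^(-k) depending on the radius alone, all
  smallness comes from integrating it near r = 1, and raising \<open>b\<close> beyond
  \<open>b\<^sub>0\<close> cannot help. Line integrals, as in Cauchy's formula for one square, are
  not controlled by a mixed norm. Averaging over the side length turns them into an area integral
  over a polar box with sides comparable to h = (1-|z|)/2; Hoelder against the indicator of the box
  gives h^(2-a-b), to be compared with h^2. The fourth power in the kernel test function is a
  product of two squares, one majorised by a function of r and the other by a function of t, so that
  the mixed norm factors. A square makes each factor integrable at exponent 1, and since both
  majorants are at most 1, at every larger exponent. All norms take values in [0, infinity] and use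
  essential suprema at exponent infinity; continuity identifies these with the suprema in
  \<open>rho\<close>.\<close>

lemma ennpowr_ennreal: "0 \<le> x \<Longrightarrow> ennpowr (ennreal x) a = ennreal (x powr a)"
  by (simp add: ennpowr_def)

lemma ennpowr_top [simp]: "ennpowr top a = top"
  by (simp add: ennpowr_def)

lemma ennpowr_0 [simp]: "ennpowr 0 a = 0"
  by (simp add: ennpowr_def)

lemma ennpowr_1 [simp]: "ennpowr 1 a = 1"
  by (simp add: ennpowr_def)

lemma ennpowr_one [simp]: "ennpowr x 1 = x"
  by (cases x) (simp_all add: ennpowr_ennreal)

lemma ennpowr_ennpowr: "ennpowr (ennpowr x a) b = ennpowr x (a * b)"
  by (cases x) (simp_all add: ennpowr_ennreal powr_powr)

lemma ennpowr_mult: "ennpowr (x * y) a = ennpowr x a * ennpowr y a"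
proof (cases "x = 0 \<or> y = 0")
  case False
  then show ?thesis
    by (cases x; cases y)
       (auto simp: ennpowr_ennreal powr_mult ennreal_mult_top ennreal_top_mult ennpowr_def
          simp flip: ennreal_mult)
qed auto

lemma ennpowr_strict_mono: "x < y \<Longrightarrow> 0 < a \<Longrightarrow> ennpowr x a < ennpowr y a"
  by (cases x; cases y) (auto simp: ennpowr_ennreal powr_less_mono2 ennreal_less_iff)

lemma ennpowr_less_iff: "0 < a \<Longrightarrow> ennpowr x a < ennpowr y a \<longleftrightarrow> x < y"
  using ennpowr_strict_mono by (metis less_asym linorder_neqE)

lemma ennpowr_le_iff: "0 < a \<Longrightarrow> ennpowr x a \<le> ennpowr y a \<longleftrightarrow> x \<le> y"
  using ennpowr_less_iff by (metis not_less)

lemma ennpowr_mono: "x \<le> y \<Longrightarrow> 0 < a \<Longrightarrow> ennpowr x a \<le> ennpowr y a"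
  by (simp add: ennpowr_le_iff)

lemma ennpowr_eq_0_iff: "ennpowr x a = 0 \<longleftrightarrow> x = 0"
  by (cases x) (auto simp: ennpowr_ennreal)

lemma ennpowr_inverse:
  assumes "0 < a" shows "ennpowr (ennpowr x a) (1 / a) = x" "ennpowr (ennpowr x (1 / a)) a = x"
  using assms by (simp_all add: ennpowr_ennpowr)

lemma ennpowr_less_swap: "0 < a \<Longrightarrow> y < ennpowr x a \<longleftrightarrow> ennpowr y (1 / a) < x"
  by (metis ennpowr_inverse(2) ennpowr_less_iff)

lemma ennpowr_le_swap: "0 < a \<Longrightarrow> x \<le> ennpowr y (1 / a) \<longleftrightarrow> ennpowr x a \<le> y"
  by (metis ennpowr_inverse(2) ennpowr_le_iff)

lemma ennpowr_measurable [measurable]: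
  assumes [measurable]: "u \<in> borel_measurable M"
  shows "(\<lambda>x. ennpowr (u x) a) \<in> borel_measurable M"
  unfolding ennpowr_def by measurable

text \<open>For positive \<open>a\<close> the power is an order automorphism of [0, infinity], so it
  preserves the characterisation of the lower limit by strictly smaller constants; the second
  inequality is the first argument applied to the inverse power.\<close>

lemma ennpowr_Liminf:
  assumes "0 < a"
  shows "ennpowr (Liminf F X) a = Liminf F (\<lambda>n. ennpowr (X n) a)"
proof (rule antisym)
  show "ennpowr (Liminf F X) a \<le> Liminf F (\<lambda>n. ennpowr (X n) a)"
    unfolding le_Liminf_iff using assms
    by (auto simp: ennpowr_less_swap dest: less_LiminfD)
  have "ennpowr (Liminf F (\<lambda>n. ennpowr (X n) a)) (1/a) \<le> Liminf F X"
    unfolding le_Liminf_iff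
    using assms ennpowr_less_swap[of "1/a"] by (auto dest!: less_LiminfD simp: ennpowr_less_iff)
  then show "Liminf F (\<lambda>n. ennpowr (X n) a) \<le> ennpowr (Liminf F X) a"
    using assms by (metis ennpowr_inverse(2) ennpowr_mono)
qed

lemma ennreal_convex_powr:
  fixes x y :: ennreal
  assumes p: "1 \<le> p" and l: "0 \<le> l" "l \<le> 1"
  shows "ennpowr (ennreal l * x + ennreal (1 - l) * y) p
    \<le> ennreal l * ennpowr x p + ennreal (1 - l) * ennpowr y p"
proof (cases "l = 0 \<or> l = 1 \<or> x = top \<or> y = top")
  case True
  have "(0::ennreal) < ennreal (1 - l)" if "l \<noteq> 1" "l \<noteq> 0" using that l by simp
  then show ?thesis using True l
    by (cases "l = 0"; cases "l = 1"; cases "x = top"; cases "y = top")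
       (auto simp: ennreal_mult_top ennreal_top_mult)
next
  case False
  then obtain r s where r: "0 \<le> r" "x = ennreal r" and s: "0 \<le> s" "y = ennreal s"
    by (metis ennreal_cases)
  have "(l * r + (1 - l) * s) powr p \<le> l * r powr p + (1 - l) * s powr p"
  \<comment> \<open>Convexity of the power is invoked at positive points only; with a zero argument
    the claim reduces to \<open>l powr p\<close> being at most \<open>l\<close> on [0,1].\<close>
  proof (cases "r = 0 \<or> s = 0")
    case True
    have "l powr p \<le> l" "(1 - l) powr p \<le> 1 - l"
      using powr_le_one_le[of l p] powr_le_one_le[of "1 - l" p] l p
      by (cases "l = 0", auto) (cases "l = 1", auto)
    then show ?thesis using True l r s p
      by (auto simp: powr_mult intro!: mult_right_mono)
  next
    case F: False
    then show ?thesis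
      using convex_onD[OF powr_convex[OF p], of "1 - l" r s] l r s by auto
  qed
  then show ?thesis using l r s
    by (simp add: ennpowr_ennreal flip: ennreal_mult ennreal_plus)
qed

lemma ennreal_Young:
  fixes x y :: ennreal
  assumes l: "0 < l" "l < 1"
  shows "ennpowr x l * ennpowr y (1 - l) \<le> ennreal l * x + ennreal (1 - l) * y"
proof (cases "x = 0 \<or> y = 0 \<or> x = top \<or> y = top")
  case True
  then show ?thesis using l
    by (auto simp: ennreal_mult_top ennreal_top_mult ennreal_mult_eq_top_iff)
next
  case False
  then obtain r s where r: "0 < r" "x = ennreal r" and s: "0 < s" "y = ennreal s"
    by (metis ennreal_cases ennreal_0 order_less_le)
  show ?thesis
    using Youngs_inequality_0[of l "1 - l" r s] l r s
    by (simp add: ennpowr_ennreal less_imp_le flip: ennreal_mult ennreal_plus)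
qed

section \<open>Norms with reciprocal exponents: Minkowski, Hoelder, Fatou\<close>

definition pnorm :: "'a measure \<Rightarrow> real \<Rightarrow> ('a \<Rightarrow> ennreal) \<Rightarrow> ennreal" where
  "pnorm M a u =
    (if a = 0 then esssup M u else ennpowr (\<integral>\<^sup>+x. ennpowr (u x) (1 / a) \<partial>M) a)"

lemma pnorm_0_le_iff:
  assumes "u \<in> borel_measurable M"
  shows "pnorm M 0 u \<le> c \<longleftrightarrow> (AE x in M. u x \<le> c)"
proof
  assume "pnorm M 0 u \<le> c"
  then have "esssup M u \<le> c" by (simp add: pnorm_def)
  then show "AE x in M. u x \<le> c"
    using esssup_AE[of u M] by (auto elim: eventually_mono)
next
  assume "AE x in M. u x \<le> c"
  then show "pnorm M 0 u \<le> c"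
    using esssup_I[OF assms] by (simp add: pnorm_def)
qed

text \<open>This holds for every \<open>u\<close>, because \<open>esssup\<close> is top on functions
  that are not measurable.\<close>

lemma pnorm_0_AE: "AE x in M. u x \<le> pnorm M 0 u"
  using esssup_AE[of u M] by (simp add: pnorm_def)

lemma pnorm_1: "pnorm M 1 u = (\<integral>\<^sup>+x. u x \<partial>M)"
  by (simp add: pnorm_def)

lemma pnorm_eq_1_iff:
  assumes "0 < a"
  shows "pnorm M a u = 1 \<longleftrightarrow> (\<integral>\<^sup>+x. ennpowr (u x) (1 / a) \<partial>M) = 1"
  using assms ennpowr_inverse(1)[of a] ennpowr_1 by (metis less_irrefl pnorm_def)

text \<open>Measurability is asked of the smaller function only: a nonmeasurable \<open>v\<close>
  has essential supremum top, and the integral is monotone anyway. Later majorants therefore come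
  without measurability proofs.\<close>

lemma pnorm_mono_AE:
  assumes [measurable]: "u \<in> borel_measurable M" and "AE x in M. u x \<le> v x" "0 \<le> a"
  shows "pnorm M a u \<le> pnorm M a v"
  using assms
  by (auto simp: pnorm_def ennpowr_mono intro!: esssup_AE_mono ennpowr_mono nn_integral_mono_AE elim: eventually_mono)

lemma pnorm_mono:
  assumes "u \<in> borel_measurable M" and "\<And>x. u x \<le> v x" "0 \<le> a"
  shows "pnorm M a u \<le> pnorm M a v"
  using assms by (intro pnorm_mono_AE) auto

lemma pnorm_cmult:
  assumes [measurable]: "u \<in> borel_measurable M" and a: "0 \<le> a" and c: "c < top"
  shows "pnorm M a (\<lambda>x. c * u x) = c * pnorm M a u"
proof (cases "a = 0")
  case False
  then show ?thesis using a
    by (simp add: pnorm_def ennpowr_mult nn_integral_cmult ennpowr_inverse)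
next
  case True
  have le: "pnorm M 0 (\<lambda>x. c * u x) \<le> c * pnorm M 0 u"
    if [measurable]: "u \<in> borel_measurable M" for u c
    using pnorm_0_AE[of u M] by (subst pnorm_0_le_iff) (auto elim!: eventually_mono intro!: mult_left_mono)
  show ?thesis
  proof (cases "c = 0")
    case True
    then show ?thesis using le[of u 0] \<open>a = 0\<close> by simp
  next
    case False
    obtain r where r: "c = ennreal r" "0 < r"
      using c False by (cases c) (auto simp: less_le)
    have inv: "ennreal (1 / r) * c = 1" "c * ennreal (1 / r) = 1"
      using r by (simp_all flip: ennreal_mult)
    \<comment> \<open>The converse is the inequality \<open>le\<close> again, for the function
      \<open>c * u\<close> and the factor 1/r.\<close>
    have "c * pnorm M 0 u = c * pnorm M 0 (\<lambda>x. ennreal (1 / r) * (c * u x))"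
      using inv by (simp flip: mult.assoc)
    also have "\<dots> \<le> c * (ennreal (1 / r) * pnorm M 0 (\<lambda>x. c * u x))"
      by (intro mult_left_mono le) auto
    finally have "c * pnorm M 0 u \<le> pnorm M 0 (\<lambda>x. c * u x)"
      using inv by (simp flip: mult.assoc)
    then show ?thesis using le[of u c] \<open>a = 0\<close> by simp
  qed
qed

lemma pnorm_eq_0_imp_AE:
  assumes [measurable]: "u \<in> borel_measurable M" and a: "0 \<le> a" and "pnorm M a u = 0"
  shows "AE x in M. u x = 0"
proof (cases "a = 0")
  case True
  then show ?thesis using pnorm_0_AE[of u M] assms by simp
next
  case False
  then show ?thesis using assms
    by (auto simp: pnorm_def ennpowr_eq_0_iff nn_integral_0_iff_AE)
qed

lemma pnorm_zero: "0 \<le> a \<Longrightarrow> pnorm M a (\<lambda>x. 0) = 0"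
  using pnorm_cmult[of "\<lambda>x. 0" M a 0] by simp

lemma pnorm_powr:
  assumes [measurable]: "u \<in> borel_measurable M" and a: "0 \<le> a" and s: "0 < s"
  shows "pnorm M (s * a) (\<lambda>x. ennpowr (u x) s) = ennpowr (pnorm M a u) s"
proof (cases "a = 0")
  case False
  then show ?thesis using a s by (simp add: pnorm_def ennpowr_ennpowr mult.commute)
next
  case True
  have "ennpowr (pnorm M 0 u) s \<le> pnorm M 0 (\<lambda>x. ennpowr (u x) s)"
  proof -
    have "pnorm M 0 u \<le> ennpowr (pnorm M 0 (\<lambda>x. ennpowr (u x) s)) (1 / s)"
      using pnorm_0_AE[of "\<lambda>x. ennpowr (u x) s" M] s
      by (subst pnorm_0_le_iff) (simp_all add: ennpowr_le_swap)
    then show ?thesis using s by (metis ennpowr_inverse(2) ennpowr_mono)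
  qed
  moreover have "pnorm M 0 (\<lambda>x. ennpowr (u x) s) \<le> ennpowr (pnorm M 0 u) s"
    by (subst pnorm_0_le_iff) (use s in \<open>auto intro: eventually_mono[OF pnorm_0_AE] ennpowr_mono\<close>)
  ultimately show ?thesis using True by simp
qed

lemma pnorm_normalize:
  fixes u :: "'a \<Rightarrow> ennreal"
  assumes [measurable]: "u \<in> borel_measurable M" and a: "0 \<le> a"
    and N: "pnorm M a u \<noteq> 0" "pnorm M a u < top"
  obtains v where "v \<in> borel_measurable M" "pnorm M a v = 1" "\<And>x. u x = pnorm M a u * v x"
proof -
  obtain r where r: "pnorm M a u = ennreal r" "0 < r"
    using N by (cases "pnorm M a u") (auto simp: less_le)
  have inv: "ennreal (1 / r) * ennreal r = 1" "ennreal r * ennreal (1 / r) = 1"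
    using r by (simp_all flip: ennreal_mult)
  show ?thesis
  proof (rule that)
    show "pnorm M a (\<lambda>x. ennreal (1 / r) * u x) = 1"
      by (subst pnorm_cmult) (use a r inv in auto)
    show "u x = pnorm M a u * (ennreal (1 / r) * u x)" for x
      using inv r by (simp flip: mult.assoc)
  qed auto
qed

text \<open>Minkowski by normalisation: with finite nonzero norms A and B, the sum is A + B times a
  convex combination of two functions of norm 1, with weights A/(A+B) and B/(A+B), and convexity of
  the power 1/a bounds the norm of that combination by 1.\<close>

lemma pnorm_triangle:
  assumes [measurable]: "u \<in> borel_measurable M" "v \<in> borel_measurable M"
    and a: "0 \<le> a" "a \<le> 1"
  shows "pnorm M a (\<lambda>x. u x + v x) \<le> pnorm M a u + pnorm M a v"
proof -
  consider "a = 0" | "pnorm M a u = 0" | "pnorm M a v = 0" | "pnorm M a u = top \<or> pnorm M a v = top"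
    | "0 < a" "pnorm M a u \<noteq> 0" "pnorm M a v \<noteq> 0" "pnorm M a u < top" "pnorm M a v < top"
    using a by (cases "a = 0") (auto simp: less_top[symmetric])
  then show ?thesis
  proof cases
    case 1
    have "AE x in M. u x + v x \<le> pnorm M 0 u + pnorm M 0 v"
      using pnorm_0_AE[of u M] pnorm_0_AE[of v M] by eventually_elim (rule add_mono)
    then show ?thesis using 1 by (simp add: pnorm_0_le_iff)
  next
    case 2
    have "AE x in M. u x + v x \<le> v x"
      using pnorm_eq_0_imp_AE[OF assms(1) a(1) 2] by eventually_elim simp
    then have "pnorm M a (\<lambda>x. u x + v x) \<le> pnorm M a v" using a by (intro pnorm_mono_AE) auto
    then show ?thesis by (simp add: 2)
  next
    case 3
    have "AE x in M. u x + v x \<le> u x"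
      using pnorm_eq_0_imp_AE[OF assms(2) a(1) 3] by eventually_elim simp
    then have "pnorm M a (\<lambda>x. u x + v x) \<le> pnorm M a u" using a by (intro pnorm_mono_AE) auto
    then show ?thesis by (simp add: 3)
  next
    case 4
    then show ?thesis by auto
  next
    case 5
    obtain u' where u': "u' \<in> borel_measurable M" "pnorm M a u' = 1" "\<And>x. u x = pnorm M a u * u' x"
      using pnorm_normalize[OF assms(1) a(1)] 5 by metis
    obtain v' where v': "v' \<in> borel_measurable M" "pnorm M a v' = 1" "\<And>x. v x = pnorm M a v * v' x"
      using pnorm_normalize[OF assms(2) a(1)] 5 by metis
    note [measurable] = u'(1) v'(1)
    obtain A where A: "pnorm M a u = ennreal A" "0 < A"
      using 5 by (cases "pnorm M a u") (auto simp: less_le)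
    obtain B where B: "pnorm M a v = ennreal B" "0 < B"
      using 5 by (cases "pnorm M a v") (auto simp: less_le)
    define l where "l = A / (A + B)"
    have l: "0 \<le> l" "l \<le> 1" "(A + B) * l = A" "(A + B) * (1 - l) = B"
      using A B by (auto simp: l_def field_simps)
    define w where "w x = ennreal l * u' x + ennreal (1 - l) * v' x" for x
    have [measurable]: "w \<in> borel_measurable M" unfolding w_def by measurable
    have uv: "u x + v x = ennreal (A + B) * w x" for x
    proof -
      have "ennreal (A + B) * ennreal l = ennreal A" "ennreal (A + B) * ennreal (1 - l) = ennreal B"
        using l A B by (simp_all flip: ennreal_mult del: ennreal_plus)
      then show ?thesis
        unfolding w_def distrib_left mult.assoc[symmetric]
        using u'(3)[of x] v'(3)[of x] A B by simp
    qed
    have iu: "(\<integral>\<^sup>+x. ennpowr (u' x) (1 / a) \<partial>M) = 1" "(\<integral>\<^sup>+x. ennpowr (v' x) (1 / a) \<partial>M) = 1"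
      using u'(2) v'(2) \<open>0 < a\<close> by (simp_all add: pnorm_eq_1_iff)
    have "(\<integral>\<^sup>+x. ennpowr (w x) (1 / a) \<partial>M)
        \<le> (\<integral>\<^sup>+x. ennreal l * ennpowr (u' x) (1 / a) + ennreal (1 - l) * ennpowr (v' x) (1 / a) \<partial>M)"
      unfolding w_def using \<open>0 < a\<close> a l by (intro nn_integral_mono ennreal_convex_powr) auto
    also have "\<dots> = ennreal l * 1 + ennreal (1 - l) * 1"
      by (simp add: nn_integral_add nn_integral_cmult iu)
    also have "\<dots> = 1" using l by (simp flip: ennreal_plus)
    finally have "pnorm M a w \<le> 1"
      using ennpowr_mono[of _ 1 a] \<open>0 < a\<close> by (simp add: pnorm_def)
    then have "pnorm M a (\<lambda>x. ennreal (A + B) * w x) \<le> ennreal (A + B) * 1"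
      using a mult_left_mono[of "pnorm M a w" 1 "ennreal (A + B)"] by (subst pnorm_cmult) auto
    then show ?thesis using A B by (simp add: uv)
  qed
qed

text \<open>With reciprocal exponents Hoelder is additive in the parameters. For functions of norm 1
  it is Young's inequality with weights a/(a+b) and b/(a+b), integrated. Young needs both weights
  positive, so an essential supremum (a = 0 or b = 0) is pulled out as a constant instead.\<close>

lemma pnorm_Holder:
  assumes [measurable]: "u \<in> borel_measurable M" "v \<in> borel_measurable M"
    and a: "0 \<le> a" and b: "0 \<le> b"
  shows "pnorm M (a + b) (\<lambda>x. u x * v x) \<le> pnorm M a u * pnorm M b v"
proof -
  \<comment> \<open>If one norm is 0, the right side is 0 even when the other is top, so the product
    has to vanish almost everywhere.\<close>
  have zero_case: "pnorm M (a + b) (\<lambda>x. u x * v x) \<le> pnorm M a u * pnorm M b v"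
    if "pnorm M a u = 0 \<or> pnorm M b v = 0"
  proof -
    have "AE x in M. u x * v x = 0"
      using that pnorm_eq_0_imp_AE[OF assms(1) a] pnorm_eq_0_imp_AE[OF assms(2) b]
      by (auto elim: eventually_mono)
    then have "pnorm M (a + b) (\<lambda>x. u x * v x) \<le> pnorm M (a + b) (\<lambda>x. 0)"
      using a b by (intro pnorm_mono_AE) auto
    then show ?thesis using a b by (simp add: pnorm_zero)
  qed
  consider "pnorm M a u = 0 \<or> pnorm M b v = 0"
    | "pnorm M a u = top \<or> pnorm M b v = top" "pnorm M a u \<noteq> 0" "pnorm M b v \<noteq> 0"
    | "pnorm M a u \<noteq> 0" "pnorm M b v \<noteq> 0" "pnorm M a u < top" "pnorm M b v < top" "a = 0"
    | "pnorm M a u \<noteq> 0" "pnorm M b v \<noteq> 0" "pnorm M a u < top" "pnorm M b v < top" "b = 0"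
    | "0 < a" "0 < b" "pnorm M a u \<noteq> 0" "pnorm M b v \<noteq> 0" "pnorm M a u < top" "pnorm M b v < top"
    using a b by (cases "a = 0"; cases "b = 0") (auto simp: less_top[symmetric])
  then show ?thesis
  proof cases
    case 1
    then show ?thesis by (rule zero_case)
  next
    case 2
    then show ?thesis by (auto simp: ennreal_mult_top ennreal_top_mult)
  next
    case 3
    have "AE x in M. u x * v x \<le> pnorm M 0 u * v x"
      using pnorm_0_AE[of u M] by eventually_elim (rule mult_right_mono, auto)
    then have "pnorm M b (\<lambda>x. u x * v x) \<le> pnorm M b (\<lambda>x. pnorm M 0 u * v x)"
      using b by (intro pnorm_mono_AE) auto
    then show ?thesis using 3 b by (simp add: pnorm_cmult)
  next
    case 4
    have "AE x in M. u x * v x \<le> pnorm M 0 v * u x"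
      using pnorm_0_AE[of v M] by eventually_elim (subst mult.commute, rule mult_right_mono, auto)
    then have "pnorm M a (\<lambda>x. u x * v x) \<le> pnorm M a (\<lambda>x. pnorm M 0 v * u x)"
      using a by (intro pnorm_mono_AE) auto
    also have "\<dots> = pnorm M 0 v * pnorm M a u" using 4 a by (intro pnorm_cmult) auto
    finally show ?thesis using 4 by (simp add: mult.commute)
  next
    case 5
    obtain u' where u': "u' \<in> borel_measurable M" "pnorm M a u' = 1" "\<And>x. u x = pnorm M a u * u' x"
      using pnorm_normalize[OF assms(1) a] 5 by metis
    obtain v' where v': "v' \<in> borel_measurable M" "pnorm M b v' = 1" "\<And>x. v x = pnorm M b v * v' x"
      using pnorm_normalize[OF assms(2) b] 5 by metis
    note [measurable] = u'(1) v'(1)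
    define l where "l = a / (a + b)"
    have l: "0 < l" "l < 1" "l / a = 1 / (a + b)" "(1 - l) / b = 1 / (a + b)"
      using 5 by (auto simp: l_def divide_simps)
    have iu: "(\<integral>\<^sup>+x. ennpowr (u' x) (1 / a) \<partial>M) = 1" "(\<integral>\<^sup>+x. ennpowr (v' x) (1 / b) \<partial>M) = 1"
      using u'(2) v'(2) 5 by (simp_all add: pnorm_eq_1_iff)
    have "ennpowr (u' x * v' x) (1 / (a + b))
       = ennpowr (ennpowr (u' x) (1 / a)) l * ennpowr (ennpowr (v' x) (1 / b)) (1 - l)" for x
      using l by (simp add: ennpowr_mult ennpowr_ennpowr)
    then have "(\<integral>\<^sup>+x. ennpowr (u' x * v' x) (1 / (a + b)) \<partial>M)
        \<le> (\<integral>\<^sup>+x. ennreal l * ennpowr (u' x) (1 / a) + ennreal (1 - l) * ennpowr (v' x) (1 / b) \<partial>M)"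
      using l by (simp add: nn_integral_mono ennreal_Young)
    also have "\<dots> = ennreal l * 1 + ennreal (1 - l) * 1"
      by (simp add: nn_integral_add nn_integral_cmult iu)
    also have "\<dots> = 1" using l by (simp flip: ennreal_plus)
    finally have le: "pnorm M (a + b) (\<lambda>x. u' x * v' x) \<le> 1"
      using ennpowr_mono[of _ 1 "a + b"] 5 by (simp add: pnorm_def)
    have uv: "u x * v x = (pnorm M a u * pnorm M b v) * (u' x * v' x)" for x
      using u'(3)[of x] v'(3)[of x] by (simp add: mult_ac)
    have "pnorm M (a + b) (\<lambda>x. u x * v x) = (pnorm M a u * pnorm M b v) * pnorm M (a + b) (\<lambda>x. u' x * v' x)"
      unfolding uv using 5 by (subst pnorm_cmult) (auto simp: ennreal_mult_less_top)
    also have "\<dots> \<le> (pnorm M a u * pnorm M b v) * 1"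
      by (intro mult_left_mono le) auto
    finally show ?thesis by simp
  qed
qed

lemma pnorm_Fatou:
  assumes [measurable]: "\<And>n. u n \<in> borel_measurable M" "v \<in> borel_measurable M"
    and "AE x in M. v x \<le> liminf (\<lambda>n. u n x)" and a: "0 \<le> a"
  shows "pnorm M a v \<le> liminf (\<lambda>n. pnorm M a (u n))"
proof (cases "a = 0")
  case True
  have "AE x in M. \<forall>n. u n x \<le> pnorm M 0 (u n)"
    by (simp add: AE_all_countable pnorm_0_AE)
  then have "AE x in M. v x \<le> liminf (\<lambda>n. pnorm M 0 (u n))"
    using assms(3)
    by eventually_elim (blast intro: order_trans Liminf_mono always_eventually)
  then show ?thesis using True by (simp add: pnorm_0_le_iff)
next
  case False
  then have a: "0 < a" using a by simp
  have "(\<integral>\<^sup>+x. ennpowr (v x) (1 / a) \<partial>M) \<le> (\<integral>\<^sup>+x. liminf (\<lambda>n. ennpowr (u n x) (1 / a)) \<partial>M)"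
    using assms(3) a
    by (intro nn_integral_mono_AE) (auto elim!: eventually_mono simp: ennpowr_le_iff simp flip: ennpowr_Liminf)
  also have "\<dots> \<le> liminf (\<lambda>n. \<integral>\<^sup>+x. ennpowr (u n x) (1 / a) \<partial>M)"
    by (intro nn_integral_liminf) auto
  finally show ?thesis
    using a by (simp add: pnorm_def ennpowr_le_iff flip: ennpowr_Liminf)
qed

text \<open>Positivity of \<open>m\<close> makes the formula correct at a = 0: the essential
  supremum of the indicator of a set that is not null is 1, which is
  \<open>m powr 0\<close>.\<close>

lemma pnorm_indicator:
  assumes [measurable]: "S \<in> sets M" and a: "0 \<le> a" and m: "emeasure M S = ennreal m" "0 < m"
  shows "pnorm M a (indicator S) = ennreal (m powr a)"
proof (cases "a = 0")
  case True
  have "AE x in M. indicator S x \<le> (1::ennreal)" by (auto split: split_indicator)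
  then have "pnorm M 0 (indicator S) \<le> 1" by (simp add: pnorm_0_le_iff)
  moreover have "1 \<le> pnorm M 0 (indicator S)"
  proof (rule ccontr)
    assume "\<not> ?thesis"
    then have "AE x in M. x \<notin> S"
      using pnorm_0_AE[of "indicator S" M]
      by (auto elim!: eventually_mono simp: indicator_def split: if_splits)
    then have "emeasure M S = 0" by (simp add: AE_iff_null null_sets_def sets.sets_into_space Int_absorb1 flip: Int_def Collect_mem_eq)
    then show False using m by simp
  qed
  ultimately show ?thesis using True m by simp
next
  case False
  have "ennpowr (indicator S x) (1 / a) = indicator S x" for x
    by (simp split: split_indicator)
  then show ?thesis using False m
    by (simp add: pnorm_def ennpowr_ennreal)
qed

text \<open>For values in [0,1] and exponent 1/a at least 1, raising to the power only decreases.
  One integral bound thus serves every exponent, including infinity, where the right side is 1. It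
  is applied to box indicators and to the majorants of the test functions.\<close>

lemma pnorm_le_integral:
  assumes [measurable]: "u \<in> borel_measurable M" and a: "0 \<le> a" "a \<le> 1" and u: "\<And>x. u x \<le> 1"
    and I: "(\<integral>\<^sup>+x. u x \<partial>M) \<le> ennreal c" "0 < c"
  shows "pnorm M a u \<le> ennreal (c powr a)"
proof (cases "a = 0")
  case True
  then show ?thesis using u I by (simp add: pnorm_0_le_iff)
next
  case False
  have "ennpowr (u x) (1 / a) \<le> u x" for x
  proof -
    obtain r where r: "u x = ennreal r" "0 \<le> r" "r \<le> 1"
      using u[of x] by (cases "u x") (auto simp: top_unique)
    have "r powr (1 / a) \<le> r" using r False a by (cases "r = 0") (auto intro!: powr_le_one_le)
    then show ?thesis using r by (simp add: ennpowr_ennreal ennreal_leI)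
  qed
  then have "(\<integral>\<^sup>+x. ennpowr (u x) (1 / a) \<partial>M) \<le> ennreal c"
    using I by (meson nn_integral_mono order_trans)
  then have "ennpowr (\<integral>\<^sup>+x. ennpowr (u x) (1 / a) \<partial>M) a \<le> ennpowr (ennreal c) a"
    using False a by (intro ennpowr_mono) auto
  then show ?thesis using False I by (simp add: pnorm_def ennpowr_ennreal)
qed

section \<open>Mixed norms in polar coordinates\<close>

text \<open>Densities on the whole line keep the underlying measurable space equal to
  \<open>borel\<close>, so joint measurability of \<open>polar f\<close> is proved once. Both this
  measure and \<open>circle_measure\<close> have total mass 1.\<close>

definition radial_measure :: "real measure" where
  "radial_measure = density lborel (indicator {0..<1})"

definition circle_measure :: "real measure" where
  "circle_measure = density lborel (\<lambda>t. ennreal (1 / (2 * pi)) * indicator {0..2 * pi} t)"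

lemma space_radial_measure [simp]: "space radial_measure = UNIV"
  and sets_radial_measure [simp, measurable_cong]: "sets radial_measure = sets borel"
  and space_circle_measure [simp]: "space circle_measure = UNIV"
  and sets_circle_measure [simp, measurable_cong]: "sets circle_measure = sets borel"
  by (simp_all add: radial_measure_def circle_measure_def)

lemma nn_integral_radial_measure:
  "u \<in> borel_measurable borel \<Longrightarrow> (\<integral>\<^sup>+r. u r \<partial>radial_measure) = (\<integral>\<^sup>+r\<in>{0..<1}. u r \<partial>lborel)"
  by (simp add: radial_measure_def nn_integral_density mult.commute)

lemma nn_integral_circle_measure:
  "u \<in> borel_measurable borel \<Longrightarrow>
    (\<integral>\<^sup>+t. u t \<partial>circle_measure) = ennreal (1 / (2 * pi)) * (\<integral>\<^sup>+t\<in>{0..2 * pi}. u t \<partial>lborel)"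
  by (simp add: circle_measure_def nn_integral_density mult_ac flip: nn_integral_cmult)

lemma AE_radial_measure: "(AE r in radial_measure. P r) \<longleftrightarrow> (AE r in lborel. r \<in> {0..<1} \<longrightarrow> P r)"
  unfolding radial_measure_def
  by (subst AE_density, simp, rule AE_cong) (auto split: split_indicator)

text \<open>The half-open interval matches the essential supremum in \<open>rho\<close>, whereas the
  density and the integrals in \<open>rho\<close> use the closed one; the end point is null.\<close>

lemma AE_circle_measure: "(AE t in circle_measure. P t) \<longleftrightarrow> (AE t in lborel. t \<in> {0..<2 * pi} \<longrightarrow> P t)"
proof -
  have "(AE t in circle_measure. P t) \<longleftrightarrow> (AE t in lborel. t \<in> {0..2 * pi} \<longrightarrow> P t)"
    unfolding circle_measure_def
    by (subst AE_density, simp, rule AE_cong) (auto split: split_indicator)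
  also have "\<dots> \<longleftrightarrow> (AE t in lborel. t \<in> {0..<2 * pi} \<longrightarrow> P t)"
    using AE_lborel_singleton[of "2 * pi"]
    by (intro iffI; elim AE_mp) (auto elim: eventually_mono simp: less_le)
  finally show ?thesis .
qed

lemma emeasure_radial_measure: "S \<in> sets borel \<Longrightarrow> emeasure radial_measure S = emeasure lborel ({0..<1} \<inter> S)"
  by (simp add: radial_measure_def emeasure_density flip: indicator_inter_arith)

lemma emeasure_circle_measure:
  "S \<in> sets borel \<Longrightarrow> emeasure circle_measure S = ennreal (1 / (2 * pi)) * emeasure lborel ({0..2 * pi} \<inter> S)"
  by (simp add: circle_measure_def emeasure_density mult.assoc nn_integral_cmult flip: indicator_inter_arith)

definition mixed_norm :: "real \<Rightarrow> real \<Rightarrow> (real \<Rightarrow> real \<Rightarrow> ennreal) \<Rightarrow> ennreal" where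
  "mixed_norm a b U = pnorm circle_measure b (\<lambda>t. pnorm radial_measure a (U t))"

definition polar :: "(complex \<Rightarrow> complex) \<Rightarrow> real \<Rightarrow> real \<Rightarrow> ennreal" where
  "polar f t r = ennreal (cmod (f (rcis r t)))"

text \<open>Away from a = 0 this is measurability of a parametrised integral. At a = 0 the sublevel
  sets are written as zero sets of such an integral: the essential supremum is at most c iff the
  indicator of the set where \<open>U t\<close> exceeds c integrates to 0.\<close>

lemma pnorm_radial_measurable [measurable]:
  assumes [measurable]: "case_prod U \<in> borel_measurable (borel \<Otimes>\<^sub>M borel)"
  shows "(\<lambda>t. pnorm radial_measure a (U t)) \<in> borel_measurable borel"
proof (cases "a = 0")
  case False
  have "(\<lambda>t. \<integral>\<^sup>+r. ennpowr (U t r) (1 / a) * indicator {0..<1} r \<partial>lborel) \<in> borel_measurable borel"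
    by measurable
  then show ?thesis using False
    by (simp add: pnorm_def nn_integral_radial_measure)
next
  case True
  have "{t. pnorm radial_measure 0 (U t) \<le> c} \<in> sets borel" for c
  proof -
    have "pnorm radial_measure 0 (U t) \<le> c \<longleftrightarrow>
        (\<integral>\<^sup>+r. indicator {c<..} (U t r) * indicator {0..<1} r \<partial>lborel) = (0::ennreal)" for t
      by (auto simp: pnorm_0_le_iff AE_radial_measure nn_integral_0_iff_AE indicator_def intro!: AE_cong)
    then have "{t. pnorm radial_measure 0 (U t) \<le> c}
        = {t\<in>space borel. (\<integral>\<^sup>+r. indicator {c<..} (U t r) * indicator {0..<1} r \<partial>lborel) = (0::ennreal)}"
      by simp
    also have "\<dots> \<in> sets borel" by measurable
    finally show ?thesis .
  qed
  then show ?thesis using True by (intro borel_measurableI_le) simp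
qed

lemma mixed_norm_mono:
  assumes [measurable]: "case_prod U \<in> borel_measurable (borel \<Otimes>\<^sub>M borel)"
    and "0 \<le> a" "0 \<le> b" and UV: "\<And>t r. 0 \<le> r \<Longrightarrow> r < 1 \<Longrightarrow> U t r \<le> V t r"
  shows "mixed_norm a b U \<le> mixed_norm a b V"
  unfolding mixed_norm_def
  using assms by (intro pnorm_mono pnorm_mono_AE) (auto simp: AE_radial_measure)

lemma mixed_norm_cmult:
  assumes [measurable]: "case_prod U \<in> borel_measurable (borel \<Otimes>\<^sub>M borel)"
    and "0 \<le> a" "0 \<le> b" "c < top"
  shows "mixed_norm a b (\<lambda>t r. c * U t r) = c * mixed_norm a b U"
  unfolding mixed_norm_def using assms by (subst pnorm_cmult; simp)+

lemma mixed_norm_triangle: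
  assumes [measurable]: "case_prod U \<in> borel_measurable (borel \<Otimes>\<^sub>M borel)"
      "case_prod V \<in> borel_measurable (borel \<Otimes>\<^sub>M borel)"
    and a: "0 \<le> a" "a \<le> 1" and b: "0 \<le> b" "b \<le> 1"
  shows "mixed_norm a b (\<lambda>t r. U t r + V t r) \<le> mixed_norm a b U + mixed_norm a b V"
proof -
  have "mixed_norm a b (\<lambda>t r. U t r + V t r) \<le>
      pnorm circle_measure b (\<lambda>t. pnorm radial_measure a (U t) + pnorm radial_measure a (V t))"
    unfolding mixed_norm_def using assms by (intro pnorm_mono pnorm_triangle) auto
  also have "\<dots> \<le> mixed_norm a b U + mixed_norm a b V"
    unfolding mixed_norm_def using assms by (intro pnorm_triangle) auto
  finally show ?thesis .
qed

lemma mixed_norm_Holder: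
  assumes [measurable]: "case_prod U \<in> borel_measurable (borel \<Otimes>\<^sub>M borel)"
      "case_prod V \<in> borel_measurable (borel \<Otimes>\<^sub>M borel)"
    and "0 \<le> a" "0 \<le> b" "0 \<le> a'" "0 \<le> b'"
  shows "mixed_norm (a + a') (b + b') (\<lambda>t r. U t r * V t r) \<le> mixed_norm a b U * mixed_norm a' b' V"
proof -
  have "mixed_norm (a + a') (b + b') (\<lambda>t r. U t r * V t r) \<le>
      pnorm circle_measure (b + b') (\<lambda>t. pnorm radial_measure a (U t) * pnorm radial_measure a' (V t))"
    unfolding mixed_norm_def using assms by (intro pnorm_mono pnorm_Holder) auto
  also have "\<dots> \<le> mixed_norm a b U * mixed_norm a' b' V"
    unfolding mixed_norm_def using assms by (intro pnorm_Holder) auto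
  finally show ?thesis .
qed

lemma mixed_norm_powr:
  assumes [measurable]: "case_prod U \<in> borel_measurable (borel \<Otimes>\<^sub>M borel)"
    and "0 \<le> a" "0 \<le> b" "0 < s"
  shows "mixed_norm (s * a) (s * b) (\<lambda>t r. ennpowr (U t r) s) = ennpowr (mixed_norm a b U) s"
  unfolding mixed_norm_def using assms by (subst pnorm_powr; simp)+

lemma mixed_norm_product:
  assumes [measurable]: "k \<in> borel_measurable borel" "w \<in> borel_measurable borel"
    and "0 \<le> a" "0 \<le> b" and "\<And>t. w t < top" "pnorm radial_measure a k < top"
  shows "mixed_norm a b (\<lambda>t r. w t * k r) = pnorm circle_measure b w * pnorm radial_measure a k"
proof -
  have "mixed_norm a b (\<lambda>t r. w t * k r) = pnorm circle_measure b (\<lambda>t. pnorm radial_measure a k * w t)"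
    unfolding mixed_norm_def using assms by (subst pnorm_cmult) (auto simp: mult.commute)
  also have "\<dots> = pnorm radial_measure a k * pnorm circle_measure b w"
    using assms by (intro pnorm_cmult) auto
  finally show ?thesis by (simp add: mult.commute)
qed

lemma mixed_norm_Fatou:
  assumes [measurable]: "\<And>n. case_prod (U n) \<in> borel_measurable (borel \<Otimes>\<^sub>M borel)"
      "case_prod V \<in> borel_measurable (borel \<Otimes>\<^sub>M borel)"
    and "0 \<le> a" "0 \<le> b" and UV: "\<And>t r. 0 \<le> r \<Longrightarrow> r < 1 \<Longrightarrow> V t r \<le> liminf (\<lambda>n. U n t r)"
  shows "mixed_norm a b V \<le> liminf (\<lambda>n. mixed_norm a b (U n))"
proof -
  have "pnorm radial_measure a (V t) \<le> liminf (\<lambda>n. pnorm radial_measure a (U n t))" for t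
    using assms by (intro pnorm_Fatou) (auto simp: AE_radial_measure intro!: AE_I2)
  then show ?thesis
    unfolding mixed_norm_def by (intro pnorm_Fatou[OF _ _ AE_I2 assms(4)]) auto
qed

lemma pnorm_circle_const: "0 \<le> b \<Longrightarrow> pnorm circle_measure b (\<lambda>t. 1) = 1"
  using pnorm_indicator[of UNIV circle_measure b 1]
  by (simp add: emeasure_circle_measure flip: ennreal_mult)

lemma pnorm_radial_const: "0 \<le> a \<Longrightarrow> pnorm radial_measure a (\<lambda>t. 1) = 1"
  using pnorm_indicator[of UNIV radial_measure a 1]
  by (simp add: emeasure_radial_measure)

text \<open>Hoelder against the constant 1, which has norm 1 because both measures are probability
  measures.\<close>

lemma mixed_norm_antimono:
  assumes [measurable]: "case_prod U \<in> borel_measurable (borel \<Otimes>\<^sub>M borel)"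
    and "0 \<le> a" "0 \<le> b" "a \<le> a'" "b \<le> b'"
  shows "mixed_norm a' b' U \<le> mixed_norm a b U"
  using mixed_norm_Holder[of U "\<lambda>t r. 1" a b "a' - a" "b' - b"] assms
  by (simp add: mixed_norm_def pnorm_radial_const pnorm_circle_const)

section \<open>Identification of \<open>rho\<close> with the mixed norm\<close>

lemma continuous_AE_le:
  fixes g :: "real \<Rightarrow> real"
  assumes g: "continuous_on {a..<b} g" and AE: "AE x in lborel. x \<in> {a..<b} \<longrightarrow> g x \<le> c"
    and x: "x \<in> {a..<b}"
  shows "g x \<le> c"
proof (rule ccontr)
  assume "\<not> g x \<le> c"
  then obtain d where d: "0 < d" "\<And>y. y \<in> {a..<b} \<Longrightarrow> dist y x < d \<Longrightarrow> dist (g y) (g x) < g x - c"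
    using g x unfolding continuous_on_iff by (metis diff_gt_0_iff_gt not_le)
  \<comment> \<open>The function exceeds \<open>c\<close> on all of [x, e), a set of positive
    measure. Looking only to the right also handles the left end point, that is r = 0 or t =
    0.\<close>
  define e where "e = min (x + d) b"
  have e: "x < e" using d x by (auto simp: e_def)
  have "AE y in lborel. y \<notin> {x..<e}"
    using AE
  proof eventually_elim
    case (elim y)
    show ?case
    proof
      assume y: "y \<in> {x..<e}"
      then have "y \<in> {a..<b}" "dist y x < d" using x by (auto simp: e_def dist_real_def)
      then show False using d(2)[of y] elim by (auto simp: dist_real_def)
    qed
  qed
  then have "emeasure lborel {x..<e} = 0"
    by (intro AE_iff_measurable[THEN iffD1]) auto
  then show False using e by simp
qed

definition vanishing_holomorphic :: "(complex \<Rightarrow> complex) set" where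
  "vanishing_holomorphic = {f. f holomorphic_on unit_disc \<and> (\<forall>z. z \<notin> unit_disc \<longrightarrow> f z = 0)}"

lemma vanishing_holomorphicD:
  assumes "f \<in> vanishing_holomorphic"
  shows "f holomorphic_on unit_disc" "\<And>z. z \<notin> unit_disc \<Longrightarrow> f z = 0"
  using assms by (auto simp: vanishing_holomorphic_def)

text \<open>Extension by 0 makes \<open>f\<close> Borel on the whole plane, and (t, r) is mapped to
  the plane continuously.\<close>

lemma polar_measurable:
  assumes f: "f holomorphic_on unit_disc" and f0: "\<And>z. z \<notin> unit_disc \<Longrightarrow> f z = 0"
  shows "case_prod (polar f) \<in> borel_measurable (borel \<Otimes>\<^sub>M borel)"
proof -
  have "(\<lambda>z. indicator unit_disc z *\<^sub>R f z) \<in> borel_measurable borel"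
    using f by (intro borel_measurable_continuous_on_indicator) (auto intro: holomorphic_on_imp_continuous_on)
  also have "(\<lambda>z. indicator unit_disc z *\<^sub>R f z) = f"
    using f0 by (auto simp: indicator_def fun_eq_iff)
  finally have [measurable]: "f \<in> borel_measurable borel" .
  have "(\<lambda>x. rcis (snd x) (fst x)) \<in> borel_measurable (borel :: (real \<times> real) measure)"
    unfolding rcis_def by (intro borel_measurable_continuous_onI continuous_intros)
  then have [measurable]: "(\<lambda>x. rcis (snd x) (fst x)) \<in> borel_measurable (borel \<Otimes>\<^sub>M borel :: (real \<times> real) measure)"
    by (simp add: borel_prod)
  show ?thesis unfolding polar_def split_beta by measurable
qed

lemma esssup_circle:
  assumes [measurable]: "u \<in> borel_measurable borel"
  shows "esssup (restrict_space lborel {0..<2 * pi}) u = pnorm circle_measure 0 u"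
proof -
  have "u \<in> borel_measurable (restrict_space lborel {0..<2 * pi})"
    by (intro measurable_restrict_space1) simp
  then show ?thesis
    by (simp add: pnorm_def esssup_eq_AE AE_restrict_space_iff AE_circle_measure)
qed

lemma pnorm_polar_eq_radial_int:
  assumes [measurable]: "case_prod (polar f) \<in> borel_measurable (borel \<Otimes>\<^sub>M borel)" and p: "0 < p"
  shows "pnorm radial_measure (1 / p) (polar f t) = ennpowr (radial_int p f t) (1 / p)"
proof -
  have "(\<integral>\<^sup>+r. ennpowr (polar f t r) p \<partial>radial_measure) = (\<integral>\<^sup>+r\<in>{0..<1}. ennpowr (polar f t r) p \<partial>lborel)"
    by (intro nn_integral_radial_measure) measurable
  also have "\<dots> = radial_int p f t"
    unfolding radial_int_def polar_def by (simp only: ennpowr_ennreal norm_ge_zero)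
  finally show ?thesis using p unfolding pnorm_def by simp
qed

text \<open>Both sides have the same upper bounds, since \<open>f\<close> is continuous along the
  radius.\<close>

lemma pnorm_polar_eq_radial_sup:
  assumes f: "f holomorphic_on unit_disc"
    and [measurable]: "case_prod (polar f) \<in> borel_measurable (borel \<Otimes>\<^sub>M borel)"
  shows "pnorm radial_measure 0 (polar f t) = radial_sup f t"
proof -
  have cont: "continuous_on {0..<1} (\<lambda>r. cmod (f (rcis r t)))"
    using holomorphic_on_imp_continuous_on[OF f]
    by (auto intro!: continuous_intros continuous_on_compose2[of unit_disc f] simp: rcis_def norm_mult)
  have "pnorm radial_measure 0 (polar f t) \<le> c \<longleftrightarrow> radial_sup f t \<le> c" for c
  proof (cases c)
    case top
    then show ?thesis by simp
  next
    case (real x)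
    have "pnorm radial_measure 0 (polar f t) \<le> c \<longleftrightarrow>
        (AE r in lborel. r \<in> {0..<1} \<longrightarrow> cmod (f (rcis r t)) \<le> x)"
      by (simp add: pnorm_0_le_iff AE_radial_measure polar_def real)
    also have "\<dots> \<longleftrightarrow> (\<forall>r\<in>{0..<1}. cmod (f (rcis r t)) \<le> x)"
      by (intro iffI ballI continuous_AE_le[OF cont]) (auto intro: AE_I2)
    also have "\<dots> \<longleftrightarrow> radial_sup f t \<le> c"
      using real by (simp add: radial_sup_def SUP_le_iff)
    finally show ?thesis .
  qed
  then show ?thesis by (meson antisym order_refl)
qed

text \<open>The two exceptional null sets are removed one after the other: first the one in r,
  through \<open>radial_sup\<close>, then for each fixed r the one in t, by continuity along the
  circle.\<close>

lemma SUP_disc_eq: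
  assumes f: "f holomorphic_on unit_disc"
    and [measurable]: "case_prod (polar f) \<in> borel_measurable (borel \<Otimes>\<^sub>M borel)"
  shows "(SUP z\<in>unit_disc. ennreal (cmod (f z))) = mixed_norm 0 0 (polar f)"
proof -
  have "mixed_norm 0 0 (polar f) \<le> c \<longleftrightarrow> (SUP z\<in>unit_disc. ennreal (cmod (f z))) \<le> c" for c
  proof (cases c)
    case top
    then show ?thesis by simp
  next
    case (real x)
    have "mixed_norm 0 0 (polar f) \<le> c \<longleftrightarrow>
        (AE t in lborel. t \<in> {0..<2 * pi} \<longrightarrow> (\<forall>r\<in>{0..<1}. cmod (f (rcis r t)) \<le> x))"
    proof -
      have "(\<lambda>t. pnorm radial_measure 0 (polar f t)) \<in> borel_measurable circle_measure" by simp
      from pnorm_0_le_iff[OF this] show ?thesis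
        by (simp add: mixed_norm_def AE_circle_measure pnorm_polar_eq_radial_sup[OF assms]
          radial_sup_def SUP_le_iff real)
    qed
    also have "\<dots> \<longleftrightarrow> (\<forall>t\<in>{0..<2 * pi}. \<forall>r\<in>{0..<1}. cmod (f (rcis r t)) \<le> x)"
    proof safe
      fix t r :: real assume t: "t \<in> {0..<2 * pi}" and r: "r \<in> {0..<1}"
        and AE: "AE t in lborel. t \<in> {0..<2 * pi} \<longrightarrow> (\<forall>r\<in>{0..<1}. cmod (f (rcis r t)) \<le> x)"
      have "continuous_on {0..<2 * pi} (\<lambda>t. cmod (f (rcis r t)))"
        using holomorphic_on_imp_continuous_on[OF f] r
        by (auto intro!: continuous_intros continuous_on_compose2[of unit_disc f] simp: rcis_def norm_mult)
      then show "cmod (f (rcis r t)) \<le> x"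
        by (rule continuous_AE_le[OF _ _ t]) (use AE r in \<open>auto elim!: eventually_mono\<close>)
    qed auto
    also have "\<dots> \<longleftrightarrow> (\<forall>z\<in>unit_disc. cmod (f z) \<le> x)"
    proof safe
      fix z assume *: "\<forall>t\<in>{0..<2 * pi}. \<forall>r\<in>{0..<1}. cmod (f (rcis r t)) \<le> x" and z: "z \<in> unit_disc"
      have "z = rcis (cmod z) (Arg2pi z)" "Arg2pi z \<in> {0..<2 * pi}"
        using Arg2pi[of z] by (auto simp: rcis_def cis_conv_exp mult_ac is_Arg_def)
      then show "cmod (f z) \<le> x" using * z
        by (metis atLeastLessThan_iff dist_0_norm mem_ball norm_ge_zero)
    qed (auto simp: rcis_def norm_mult)
    also have "\<dots> \<longleftrightarrow> (SUP z\<in>unit_disc. ennreal (cmod (f z))) \<le> c"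
      using real by (simp add: SUP_le_iff)
    finally show ?thesis .
  qed
  then show ?thesis by (meson antisym order_refl)
qed

text \<open>This unifies the four cases of \<open>rho\<close>: an infinite exponent has
  \<open>enn2real (1 / top) = 0\<close>, which selects the essential supremum branch of
  \<open>pnorm\<close>.\<close>

lemma rho_eq_mixed_norm:
  assumes f: "f holomorphic_on unit_disc" "\<And>z. z \<notin> unit_disc \<Longrightarrow> f z = 0" and p: "1 \<le> p" "1 \<le> q"
  shows "rho p q f = mixed_norm (enn2real (1 / p)) (enn2real (1 / q)) (polar f)"
proof -
  have inv: "enn2real (1 / x) = (if x < top then 1 / enn2real x else 0) \<and> (x < top \<longrightarrow> 0 < enn2real x)"
    if "1 \<le> x" for x :: ennreal
    using that by (cases x) (auto simp: divide_ennreal_def inverse_ennreal divide_inverse)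
  note [measurable] = polar_measurable[OF f]
  have fin: "pnorm radial_measure (1 / enn2real p) (polar f t) = ennpowr (radial_int (enn2real p) f t) (1 / enn2real p)"
    if "p < top" for t
    using that inv[OF p(1)] by (intro pnorm_polar_eq_radial_int) auto
  have sup: "pnorm radial_measure 0 (polar f t) = radial_sup f t" for t
    using f by (intro pnorm_polar_eq_radial_sup) auto
  have meas: "(\<lambda>t. pnorm radial_measure a (polar f t)) \<in> borel_measurable borel" for a
    by measurable
  have q: "pnorm circle_measure (1 / enn2real q) u = ennpowr (ennreal (1 / (2 * pi)) *
         (\<integral>\<^sup>+ t\<in>{0..2 * pi}. ennpowr (u t) (enn2real q) \<partial>lborel)) (1 / enn2real q)"
    if "q < top" "u \<in> borel_measurable borel" for u
    using that inv[OF p(2)] by (simp add: pnorm_def nn_integral_circle_measure)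
  consider "p < top" "q < top" | "p < top" "q = top" | "p = top" "q < top" | "p = top" "q = top"
    using top.not_eq_extremum by metis
  then show ?thesis
  proof cases
    case 1
    then have "mixed_norm (enn2real (1 / p)) (enn2real (1 / q)) (polar f)
        = ennpowr (ennreal (1 / (2 * pi)) * (\<integral>\<^sup>+ t\<in>{0..2 * pi}.
            ennpowr (pnorm radial_measure (1 / enn2real p) (polar f t)) (enn2real q) \<partial>lborel)) (1 / enn2real q)"
      using inv[OF p(1)] inv[OF p(2)] q[OF _ meas[of "1 / enn2real p"]] by (simp add: mixed_norm_def)
    then show ?thesis
      using 1 fin by (simp add: rho_def ennpowr_ennpowr)
  next
    case 2
    then show ?thesis
      using inv[OF p(1)] esssup_circle[OF meas[of "1 / enn2real p"]] fin by (simp add: mixed_norm_def rho_def)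
  next
    case 3
    then show ?thesis
      using inv[OF p(2)] q[OF _ meas[of 0]] sup by (simp add: mixed_norm_def rho_def)
  next
    case 4
    then show ?thesis using SUP_disc_eq[OF f(1)] by (simp add: rho_def)
  qed
qed

section \<open>Pointwise estimates\<close>

lemma ennreal_norm_integral_le:
  fixes k :: "real \<Rightarrow> complex"
  assumes "continuous_on {a..b} k"
  shows "ennreal (cmod (integral {a..b} k)) \<le> (\<integral>\<^sup>+x\<in>{a..b}. ennreal (cmod (k x)) \<partial>lborel)"
proof -
  have int: "(\<lambda>x. cmod (k x)) integrable_on {a..b}" "k integrable_on {a..b}"
    using assms by (auto intro!: integrable_continuous_interval continuous_intros)
  have "ennreal (cmod (integral {a..b} k)) \<le> ennreal (integral {a..b} (\<lambda>x. cmod (k x)))"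
    using int by (intro ennreal_leI integral_norm_bound_integral) auto
  also have "\<dots> = (\<integral>\<^sup>+x\<in>{a..b}. ennreal (cmod (k x)) \<partial>lborel)"
    using int by (intro nn_integral_has_integral_lebesgue'[symmetric]) (auto simp: integrable_integral)
  finally show ?thesis .
qed

lemma norm_contour_integral_vertical:
  assumes "continuous_on (closed_segment (Complex c a) (Complex c b)) k" "a < b"
  shows "ennreal (cmod (contour_integral (linepath (Complex c a) (Complex c b)) k))
    \<le> (\<integral>\<^sup>+y\<in>{a..b}. ennreal (cmod (k (Complex c y))) \<partial>lborel)"
proof -
  have "continuous_on {a..b} (\<lambda>y. k (Complex c y))"
    using assms by (intro continuous_on_compose2[OF assms(1)])
      (auto simp: Complex_eq closed_segment_same_Re closed_segment_eq_real_ivl intro!: continuous_intros)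
  moreover have "contour_integral (linepath (Complex c a) (Complex c b)) k = \<i> * integral {a..b} (\<lambda>y. k (Complex c y))"
    using assms by (intro contour_integral_linepath_same_Re) auto
  ultimately show ?thesis
    using ennreal_norm_integral_le[of a b "\<lambda>y. k (Complex c y)"] by (simp add: norm_mult)
qed

lemma norm_contour_integral_horizontal:
  assumes "continuous_on (closed_segment (Complex a c) (Complex b c)) k" "a < b"
  shows "ennreal (cmod (contour_integral (linepath (Complex a c) (Complex b c)) k))
    \<le> (\<integral>\<^sup>+x\<in>{a..b}. ennreal (cmod (k (Complex x c))) \<partial>lborel)"
proof -
  have cont: "continuous_on {a..b} (\<lambda>x. k (Complex x c))"
    using assms by (intro continuous_on_compose2[OF assms(1)])
      (auto simp: Complex_eq closed_segment_same_Im closed_segment_eq_real_ivl intro!: continuous_intros)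
  have "((\<lambda>x. k (Complex x c)) has_integral integral {a..b} (\<lambda>x. k (Complex x c))) {a..b}"
    using cont by (intro integrable_integral integrable_continuous_interval)
  \<comment> \<open>A vertical translation moves the segment to the real axis, where the contour
    integral is an ordinary integral.\<close>
  then have "((\<lambda>z. k (z + Complex 0 c)) has_contour_integral integral {a..b} (\<lambda>x. k (Complex x c)))
      (linepath (of_real a) (of_real b))"
    using assms(2) by (subst has_contour_integral_linepath_Reals_iff) (auto simp: Complex_eq)
  then have "(k has_contour_integral integral {a..b} (\<lambda>x. k (Complex x c))) (linepath (Complex a c) (Complex b c))"
    unfolding has_contour_integral_linepath by (simp add: linepath_def Complex_eq algebra_simps scaleR_conv_of_real)
  then have "contour_integral (linepath (Complex a c) (Complex b c)) k = integral {a..b} (\<lambda>x. k (Complex x c))"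
    by (rule contour_integral_unique)
  then show ?thesis
    using ennreal_norm_integral_le[OF cont] by simp
qed

text \<open>Cauchy's formula over the boundary of the square with centre w = u + iv and half-side s,
  on which the kernel 1/(z - w) has modulus at most 1/s.\<close>

lemma Cauchy_square_estimate:
  assumes g: "g holomorphic_on S" and S: "convex S" "open S" and s: "0 < s"
    and sub: "cbox (Complex (u - s) (v - s)) (Complex (u + s) (v + s)) \<subseteq> S"
  shows "ennreal (2 * pi * s * cmod (g (Complex u v))) \<le>
    (\<integral>\<^sup>+y\<in>{v-s..v+s}. ennreal (cmod (g (Complex (u + s) y))) \<partial>lborel) +
    (\<integral>\<^sup>+y\<in>{v-s..v+s}. ennreal (cmod (g (Complex (u - s) y))) \<partial>lborel) +
    (\<integral>\<^sup>+x\<in>{u-s..u+s}. ennreal (cmod (g (Complex x (v + s)))) \<partial>lborel) +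
    (\<integral>\<^sup>+x\<in>{u-s..u+s}. ennreal (cmod (g (Complex x (v - s)))) \<partial>lborel)"
proof -
  define w where "w = Complex u v"
  define a1 a2 a3 a4 where "a1 = Complex (u - s) (v - s)" and "a2 = Complex (u + s) (v - s)"
    and "a3 = Complex (u + s) (v + s)" and "a4 = Complex (u - s) (v + s)"
  note a_def = a1_def a2_def a3_def a4_def
  define k where "k \<zeta> = g \<zeta> / (\<zeta> - w)" for \<zeta>
  have rect: "rectpath a1 a3 = linepath a1 a2 +++ linepath a2 a3 +++ linepath a3 a4 +++ linepath a4 a1"
    by (simp add: rectpath_def a_def Let_def)
  have seg: "closed_segment a1 a2 \<subseteq> S - {w}" "closed_segment a2 a3 \<subseteq> S - {w}"
    "closed_segment a4 a3 \<subseteq> S - {w}" "closed_segment a1 a4 \<subseteq> S - {w}"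
    using s sub
    by (auto simp: a_def w_def closed_segment_same_Im closed_segment_same_Re closed_segment_eq_real_ivl
        in_cbox_complex_iff subset_iff)
  have cont: "continuous_on (S - {w}) k"
    unfolding k_def using holomorphic_on_imp_continuous_on[OF g]
    by (intro continuous_intros) (auto elim: continuous_on_subset)
  have conts: "continuous_on (closed_segment a1 a2) k" "continuous_on (closed_segment a2 a3) k"
    "continuous_on (closed_segment a4 a3) k" "continuous_on (closed_segment a1 a4) k"
    "continuous_on (closed_segment a3 a4) k" "continuous_on (closed_segment a4 a1) k"
    using seg cont by (auto intro: continuous_on_subset simp: closed_segment_commute)
  have "(k has_contour_integral (2*pi * \<i> * winding_number (rectpath a1 a3) w * g w)) (rectpath a1 a3)"
    unfolding k_def
  proof (rule Cauchy_integral_formula_convex_simple[OF S(1) g])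
    show "w \<in> interior S" using sub s S by (auto simp: interior_open w_def in_cbox_complex_iff subset_iff)
    show "path_image (rectpath a1 a3) \<subseteq> S - {w}"
      using seg unfolding rect by (auto simp: path_image_join closed_segment_commute)
  qed auto
  moreover have "winding_number (rectpath a1 a3) w = 1"
    using s by (intro winding_number_rectpath) (auto simp: a_def w_def in_box_complex_iff)
  ultimately have "2 * pi * \<i> * g w = contour_integral (rectpath a1 a3) k"
    by (simp add: contour_integral_unique)
  \<comment> \<open>The top and the left edge are reversed so that every edge is traversed in the
    direction of an increasing coordinate.\<close>
  also have "\<dots> = contour_integral (linepath a1 a2) k + contour_integral (linepath a2 a3) k
      - contour_integral (linepath a4 a3) k - contour_integral (linepath a1 a4) k"
    unfolding rect using conts
    by (simp add: contour_integrable_continuous_linepath contour_integral_reverse_linepath[of a4 a3]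
       contour_integral_reverse_linepath[of a1 a4])
  finally have "cmod (2 * pi * \<i> * g w) \<le> cmod (contour_integral (linepath a1 a2) k) + cmod (contour_integral (linepath a2 a3) k)
      + cmod (contour_integral (linepath a4 a3) k) + cmod (contour_integral (linepath a1 a4) k)"
    by (smt (verit, best) norm_triangle_ineq norm_triangle_ineq4)
  then have "2 * pi * cmod (g w) * s \<le> (cmod (contour_integral (linepath a1 a2) k) + cmod (contour_integral (linepath a2 a3) k)
      + cmod (contour_integral (linepath a4 a3) k) + cmod (contour_integral (linepath a1 a4) k)) * s"
    using s by (intro mult_right_mono) (auto simp: norm_mult)
  then have "2 * pi * s * cmod (g w) \<le> s * cmod (contour_integral (linepath a2 a3) k)
      + s * cmod (contour_integral (linepath a1 a4) k)
      + s * cmod (contour_integral (linepath a4 a3) k) + s * cmod (contour_integral (linepath a1 a2) k)"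
    by (simp only: algebra_simps)
  from ennreal_leI[OF this] have "ennreal (2 * pi * s * cmod (g w)) \<le> s * ennreal (cmod (contour_integral (linepath a2 a3) k))
      + s * ennreal (cmod (contour_integral (linepath a1 a4) k))
      + s * ennreal (cmod (contour_integral (linepath a4 a3) k)) + s * ennreal (cmod (contour_integral (linepath a1 a2) k))"
    using s by (simp add: ennreal_mult)
  also have "\<dots> \<le> (\<integral>\<^sup>+y\<in>{v-s..v+s}. ennreal (cmod (g (Complex (u + s) y))) \<partial>lborel) +
    (\<integral>\<^sup>+y\<in>{v-s..v+s}. ennreal (cmod (g (Complex (u - s) y))) \<partial>lborel) +
    (\<integral>\<^sup>+x\<in>{u-s..u+s}. ennreal (cmod (g (Complex x (v + s)))) \<partial>lborel) +
    (\<integral>\<^sup>+x\<in>{u-s..u+s}. ennreal (cmod (g (Complex x (v - s)))) \<partial>lborel)"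
  proof -
    \<comment> \<open>One estimate for all four edges, with \<open>\<gamma>\<close> the parametrised
      edge.\<close>
    have bd: "s * ennreal I \<le> (\<integral>\<^sup>+x\<in>A. ennreal (cmod (g (\<gamma> x))) \<partial>lborel)"
      if I: "ennreal I \<le> (\<integral>\<^sup>+x\<in>A. ennreal (cmod (k (\<gamma> x))) \<partial>lborel)"
        and \<gamma>: "\<And>x. x \<in> A \<Longrightarrow> s \<le> cmod (\<gamma> x - w)" "\<And>x. x \<in> A \<Longrightarrow> \<gamma> x \<in> S - {w}"
        and A: "A \<in> sets borel" "continuous_on A \<gamma>"
      for I A and \<gamma> :: "real \<Rightarrow> complex"
    proof -
      have "continuous_on A (\<lambda>x. k (\<gamma> x))"
        using \<gamma> by (intro continuous_on_compose2[OF cont A(2)]) auto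
      then have "(\<lambda>x. indicator A x *\<^sub>R k (\<gamma> x)) \<in> borel_measurable borel"
        by (intro borel_measurable_continuous_on_indicator A)
      then have m: "(\<lambda>x. ennreal (cmod (indicator A x *\<^sub>R k (\<gamma> x)))) \<in> borel_measurable lborel"
        by (auto intro: measurable_compose[OF _ measurable_ennreal] borel_measurable_norm simp del: norm_scaleR)
      have eq: "ennreal (cmod (indicator A x *\<^sub>R k (\<gamma> x))) = ennreal (cmod (k (\<gamma> x))) * indicator A x" for x
        by (simp split: split_indicator)
      have "s * ennreal I \<le> s * (\<integral>\<^sup>+x\<in>A. ennreal (cmod (k (\<gamma> x))) \<partial>lborel)"
        by (intro mult_left_mono I) auto
      also have "\<dots> = (\<integral>\<^sup>+x. s * (ennreal (cmod (k (\<gamma> x))) * indicator A x) \<partial>lborel)"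
        using m unfolding eq by (rule nn_integral_cmult[symmetric])
      also have "\<dots> \<le> (\<integral>\<^sup>+x\<in>A. ennreal (cmod (g (\<gamma> x))) \<partial>lborel)"
      proof (rule nn_integral_mono)
        fix x
        show "s * (ennreal (cmod (k (\<gamma> x))) * indicator A x) \<le> ennreal (cmod (g (\<gamma> x))) * indicator A x"
        proof (cases "x \<in> A")
          case True
          have "s * cmod (k (\<gamma> x)) \<le> cmod (g (\<gamma> x))"
            using \<gamma>(1)[OF True] \<gamma>(2)[OF True] s mult_right_mono[of s "cmod (\<gamma> x - w)" "cmod (g (\<gamma> x))"]
            by (simp add: k_def norm_divide field_simps)
          then show ?thesis using True s by (simp flip: ennreal_mult add: ennreal_leI)
        qed simp
      qed
      finally show ?thesis .
    qed
    have d: "s \<le> cmod (Complex x y - w)" if "s \<le> \<bar>x - u\<bar> \<or> s \<le> \<bar>y - v\<bar>" for x y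
      using that abs_Re_le_cmod[of "Complex x y - w"] abs_Im_le_cmod[of "Complex x y - w"] by (auto simp: w_def)
    have inS: "Complex x y \<in> S - {w}" if "s \<le> \<bar>x - u\<bar> \<or> s \<le> \<bar>y - v\<bar>" "x \<in> {u-s..u+s}" "y \<in> {v-s..v+s}" for x y
      using that sub s by (auto simp: in_cbox_complex_iff subset_iff w_def)
    have c: "continuous_on A (\<lambda>y. Complex x y)" "continuous_on A (\<lambda>y. Complex y x)" for x A
      by (auto simp: Complex_eq intro!: continuous_intros)
    show ?thesis
      using s conts unfolding a_def
      by (intro add_mono bd norm_contour_integral_vertical norm_contour_integral_horizontal d inS c) auto
  qed
  finally show ?thesis by (simp add: w_def)
qed

text \<open>Averages the previous estimate over half-sides s in [h/2, h]. As s varies, each of the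
  four edges sweeps out part of the large square, so each contributes at most the area integral. The
  lower bound s >= h/2 gives 2*pi*s >= pi*h on the left.\<close>

lemma square_mean_estimate:
  assumes g: "g holomorphic_on S" and S: "convex S" "open S" and h: "0 < h"
    and sub: "cbox (Complex (u - h) (v - h)) (Complex (u + h) (v + h)) \<subseteq> S"
  shows "ennreal (h\<^sup>2 * cmod (g (Complex u v))) \<le>
    4 * (\<integral>\<^sup>+y\<in>{v-h..v+h}. (\<integral>\<^sup>+x\<in>{u-h..u+h}. ennreal (cmod (g (Complex x y))) \<partial>lborel) \<partial>lborel)"
proof -
  define Q where "Q = cbox (Complex (u - h) (v - h)) (Complex (u + h) (v + h))"
  \<comment> \<open>Cutting off outside the square lets all integrals run over the whole line, where
    translations and reflections are free.\<close>
  define G where "G x y = ennreal (cmod (indicator Q (Complex x y) *\<^sub>R g (Complex x y)))" for x y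
  have "continuous_on Q g"
    using holomorphic_on_imp_continuous_on[OF g] sub continuous_on_subset unfolding Q_def by blast
  then have [measurable]: "(\<lambda>z. indicator Q z *\<^sub>R g z) \<in> borel_measurable borel"
    by (intro borel_measurable_continuous_on_indicator) (simp_all add: Q_def)
  have "(\<lambda>x. Complex (fst x) (snd x)) \<in> borel_measurable (borel :: (real \<times> real) measure)"
    unfolding Complex_eq by (intro borel_measurable_continuous_onI continuous_intros)
  then have [measurable]: "(\<lambda>x. Complex (fst x) (snd x)) \<in> borel_measurable (borel \<Otimes>\<^sub>M borel :: (real \<times> real) measure)"
    by (simp add: borel_prod)
  have G[measurable]: "case_prod G \<in> borel_measurable (borel \<Otimes>\<^sub>M borel)"
    unfolding G_def split_beta by measurable
  have G': "G x y = ennreal (cmod (g (Complex x y))) * indicator {u-h..u+h} x * indicator {v-h..v+h} y" for x y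
    by (auto simp: G_def Q_def indicator_def in_cbox_complex_iff)
  define I where "I = (\<integral>\<^sup>+y. (\<integral>\<^sup>+x. G x y \<partial>lborel) \<partial>lborel)"
  have I': "I = (\<integral>\<^sup>+x. (\<integral>\<^sup>+y. G x y \<partial>lborel) \<partial>lborel)"
    unfolding I_def by (rule lborel_pair.Fubini') simp
  \<comment> \<open>The factors 1 and -1 are kept visible so that the four terms match the
    substitution \<open>shift\<close>.\<close>
  have est: "ennreal (pi * h * cmod (g (Complex u v))) \<le>
      (\<integral>\<^sup>+y. G (u + 1 * s) y \<partial>lborel) + (\<integral>\<^sup>+y. G (u + (-1) * s) y \<partial>lborel)
    + (\<integral>\<^sup>+x. G x (v + 1 * s) \<partial>lborel) + (\<integral>\<^sup>+x. G x (v + (-1) * s) \<partial>lborel)" if s: "s \<in> {h/2..h}" for s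
  proof -
    have "cbox (Complex (u - s) (v - s)) (Complex (u + s) (v + s)) \<subseteq> S"
      using s by (intro order_trans[OF _ sub]) (auto simp: in_cbox_complex_iff)
    moreover have "0 < s" using s h by auto
    moreover have "pi * h * cmod (g (Complex u v)) \<le> 2 * pi * s * cmod (g (Complex u v))"
      using s by (intro mult_right_mono) auto
    ultimately have "ennreal (pi * h * cmod (g (Complex u v))) \<le>
      (\<integral>\<^sup>+y\<in>{v-s..v+s}. ennreal (cmod (g (Complex (u + s) y))) \<partial>lborel) +
      (\<integral>\<^sup>+y\<in>{v-s..v+s}. ennreal (cmod (g (Complex (u - s) y))) \<partial>lborel) +
      (\<integral>\<^sup>+x\<in>{u-s..u+s}. ennreal (cmod (g (Complex x (v + s)))) \<partial>lborel) +
      (\<integral>\<^sup>+x\<in>{u-s..u+s}. ennreal (cmod (g (Complex x (v - s)))) \<partial>lborel)"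
      by (intro order_trans[OF ennreal_leI Cauchy_square_estimate[OF g S]])
    also have "\<dots> \<le> (\<integral>\<^sup>+y. G (u + 1 * s) y \<partial>lborel) + (\<integral>\<^sup>+y. G (u + (-1) * s) y \<partial>lborel)
        + (\<integral>\<^sup>+x. G x (v + 1 * s) \<partial>lborel) + (\<integral>\<^sup>+x. G x (v + (-1) * s) \<partial>lborel)"
      using s h by (intro add_mono nn_integral_mono) (auto simp: G' indicator_def)
    finally show ?thesis .
  qed
  have shift: "(\<integral>\<^sup>+s. H (t + c * s) \<partial>lborel) = (\<integral>\<^sup>+x. H x \<partial>lborel)"
    if "\<bar>c\<bar> = 1" "H \<in> borel_measurable borel" for H :: "real \<Rightarrow> ennreal" and c t
    using nn_integral_real_affine[of H c t] that by auto
  have add4: "(\<integral>\<^sup>+s. A s + B s + C s + D s \<partial>lborel) =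
      (\<integral>\<^sup>+s. A s \<partial>lborel) + (\<integral>\<^sup>+s. B s \<partial>lborel) + (\<integral>\<^sup>+s. C s \<partial>lborel) + (\<integral>\<^sup>+s. D s \<partial>lborel)"
    if "A \<in> borel_measurable borel" "B \<in> borel_measurable borel" "C \<in> borel_measurable borel"
      "D \<in> borel_measurable borel" for A B C D :: "real \<Rightarrow> ennreal"
    using that by (simp add: nn_integral_add)
  have "ennreal (h / 2) * ennreal (pi * h * cmod (g (Complex u v)))
      = (\<integral>\<^sup>+s\<in>{h/2..h}. ennreal (pi * h * cmod (g (Complex u v))) \<partial>lborel)"
    using h by (subst nn_integral_cmult_indicator) (auto simp: mult.commute)
  also have "\<dots> \<le> (\<integral>\<^sup>+s. ((\<integral>\<^sup>+y. G (u + 1 * s) y \<partial>lborel) + (\<integral>\<^sup>+y. G (u + (-1) * s) y \<partial>lborel)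
      + (\<integral>\<^sup>+x. G x (v + 1 * s) \<partial>lborel) + (\<integral>\<^sup>+x. G x (v + (-1) * s) \<partial>lborel)) \<partial>lborel)"
    using est by (intro nn_integral_mono) (auto split: split_indicator)
  also have "\<dots> = (\<integral>\<^sup>+s. (\<integral>\<^sup>+y. G (u + 1 * s) y \<partial>lborel) \<partial>lborel) + (\<integral>\<^sup>+s. (\<integral>\<^sup>+y. G (u + (-1) * s) y \<partial>lborel) \<partial>lborel)
      + (\<integral>\<^sup>+s. (\<integral>\<^sup>+x. G x (v + 1 * s) \<partial>lborel) \<partial>lborel) + (\<integral>\<^sup>+s. (\<integral>\<^sup>+x. G x (v + (-1) * s) \<partial>lborel) \<partial>lborel)"
    by (rule add4) measurable
  also have "\<dots> = I + I + I + I"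
  proof -
    have 1: "(\<integral>\<^sup>+s. (\<integral>\<^sup>+y. G (u + c * s) y \<partial>lborel) \<partial>lborel) = I" if "\<bar>c\<bar> = 1" for c
      unfolding I' by (rule shift[OF that, of "\<lambda>x. \<integral>\<^sup>+y. G x y \<partial>lborel"]) measurable
    have 2: "(\<integral>\<^sup>+s. (\<integral>\<^sup>+x. G x (v + c * s) \<partial>lborel) \<partial>lborel) = I" if "\<bar>c\<bar> = 1" for c
      unfolding I_def by (rule shift[OF that, of "\<lambda>y. \<integral>\<^sup>+x. G x y \<partial>lborel"]) measurable
    show ?thesis by (simp only: 1 2 abs_one abs_minus)
  qed
  also have "\<dots> = 4 * I"
  proof -
    have "(4::ennreal) = 1 + 1 + 1 + 1" by simp
    then show ?thesis by (simp only: distrib_right mult_1_left)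
  qed
  finally have "ennreal (h / 2 * (pi * h * cmod (g (Complex u v)))) \<le> 4 * I"
    using h by (simp flip: ennreal_mult)
  \<comment> \<open>The surplus factor pi/2 is at least 1 and is dropped.\<close>
  moreover have "h\<^sup>2 * cmod (g (Complex u v)) \<le> h / 2 * (pi * h * cmod (g (Complex u v)))"
    using h pi_ge_two mult_right_mono[of 1 "pi / 2" "h * (h * cmod (g (Complex u v)))"]
    by (simp add: power2_eq_square mult_ac)
  moreover have "I = (\<integral>\<^sup>+y\<in>{v-h..v+h}. (\<integral>\<^sup>+x\<in>{u-h..u+h}. ennreal (cmod (g (Complex x y))) \<partial>lborel) \<partial>lborel)"
    unfolding I_def G' by (intro nn_integral_cong) (auto split: split_indicator)
  ultimately show ?thesis
    by (metis ennreal_leI order_trans)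
qed

section \<open>From squares to polar boxes: the growth estimate\<close>

lemma polar_periodic: "polar f (t + 2 * pi) = polar f t"
proof -
  have "cis (t + 2 * pi) = cis t" by (simp add: complex_eq_iff)
  then show ?thesis by (simp add: polar_def fun_eq_iff rcis_def)
qed

text \<open>The substitution r = exp x; on the range considered the Jacobian exp x is at least 1/4,
  which costs the factor 4.\<close>

lemma nn_integral_exp_substitution:
  fixes \<phi> :: "real \<Rightarrow> real"
  assumes [measurable]: "\<phi> \<in> borel_measurable borel" and "a \<le> b" and nn: "\<And>r. 0 \<le> \<phi> r" and q: "1 / 4 \<le> exp a"
  shows "(\<integral>\<^sup>+x\<in>{a..b}. ennreal (\<phi> (exp x)) \<partial>lborel) \<le> 4 * (\<integral>\<^sup>+r\<in>{exp a..exp b}. ennreal (\<phi> r) \<partial>lborel)"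
proof -
  have "(\<integral>\<^sup>+x\<in>{a..b}. ennreal (\<phi> (exp x)) \<partial>lborel)
      \<le> (\<integral>\<^sup>+x. 4 * ennreal (\<phi> (exp x) * exp x * indicator {a..b} x) \<partial>lborel)"
  proof (rule nn_integral_mono)
    fix x
    show "ennreal (\<phi> (exp x)) * indicator {a..b} x \<le> 4 * ennreal (\<phi> (exp x) * exp x * indicator {a..b} x)"
    proof (cases "x \<in> {a..b}")
      case True
      then have "1 / 4 \<le> exp x" using q order_trans[OF q, of "exp x"] by simp
      then have "\<phi> (exp x) * 1 \<le> \<phi> (exp x) * (4 * exp x)" using nn by (intro mult_left_mono) auto
      then show ?thesis using True
        by (simp add: mult_ac ennreal_leI flip: ennreal_numeral ennreal_mult')
    qed simp
  qed
  also have "\<dots> = 4 * (\<integral>\<^sup>+x. ennreal (\<phi> (exp x) * exp x * indicator {a..b} x) \<partial>lborel)"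
    by (simp add: nn_integral_cmult)
  also have "(\<integral>\<^sup>+x. ennreal (\<phi> (exp x) * exp x * indicator {a..b} x) \<partial>lborel)
      = (\<integral>\<^sup>+r. ennreal (\<phi> r * indicator {exp a..exp b} r) \<partial>lborel)"
    using assms
    by (intro nn_integral_substitution[symmetric])
       (auto intro!: derivative_eq_intros continuous_intros simp: set_borel_measurable_def)
  also have "\<dots> = (\<integral>\<^sup>+r\<in>{exp a..exp b}. ennreal (\<phi> r) \<partial>lborel)"
    by (intro nn_integral_cong) (simp split: split_indicator)
  finally show ?thesis .
qed

text \<open>The exponential maps squares in the left half plane to polar boxes in the disc, so the
  square estimate is applied to \<open>f\<close> composed with \<open>exp\<close>. The constant 16
  is 4 from the square times 4 from the substitution.\<close>

lemma polar_mean_estimate: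
  assumes f: "f holomorphic_on unit_disc" and f0: "\<And>z. z \<notin> unit_disc \<Longrightarrow> f z = 0"
    and r0: "1 / 2 \<le> r0" "r0 < 1" and h: "h = (1 - r0) / 2"
  shows "ennreal (h\<^sup>2 * cmod (f (rcis r0 t0))) \<le>
    16 * (\<integral>\<^sup>+t\<in>{t0-h..t0+h}. (\<integral>\<^sup>+r\<in>{r0 * exp (- h)..r0 * exp h}. polar f t r \<partial>lborel) \<partial>lborel)"
proof -
  have hpos: "0 < h" "h \<le> 1 / 4" using r0 h by auto
  define u where "u = ln r0"
  \<comment> \<open>From ln r0 <= r0 - 1 = -2h, the right edge satisfies u + h <= -h < 0, so the
    square stays in the left half plane.\<close>
  have u: "exp u = r0" "u \<le> - 2 * h" using r0 ln_le_minus_one[of r0] by (auto simp: u_def h)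
  define S where "S = {w. Re w < 0}"
  have S: "convex S" "open S"
    by (auto simp: S_def convex_halfspace_Re_lt open_halfspace_Re_lt)
  have expS: "exp ` S \<subseteq> unit_disc" by (auto simp: S_def)
  have "(\<lambda>w. f (exp w)) holomorphic_on S"
    using holomorphic_on_compose_gen[OF _ f expS] by (auto simp: o_def intro: holomorphic_intros)
  moreover have "cbox (Complex (u - h) (t0 - h)) (Complex (u + h) (t0 + h)) \<subseteq> S"
    using u hpos by (auto simp: S_def in_cbox_complex_iff)
  ultimately have "ennreal (h\<^sup>2 * cmod (f (exp (Complex u t0)))) \<le>
    4 * (\<integral>\<^sup>+t\<in>{t0-h..t0+h}. (\<integral>\<^sup>+x\<in>{u-h..u+h}. ennreal (cmod (f (exp (Complex x t)))) \<partial>lborel) \<partial>lborel)"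
    using square_mean_estimate[of "\<lambda>w. f (exp w)" S h u t0] S hpos by simp
  also have "\<dots> \<le> 4 * (\<integral>\<^sup>+t\<in>{t0-h..t0+h}. 4 * (\<integral>\<^sup>+r\<in>{r0 * exp (- h)..r0 * exp h}. polar f t r \<partial>lborel) \<partial>lborel)"
  proof (intro mult_left_mono nn_integral_mono mult_right_mono)
    fix t
    note [measurable] = polar_measurable[OF f f0]
    have [measurable]: "(\<lambda>r. cmod (f (rcis r t))) \<in> borel_measurable borel"
    proof -
      have "(\<lambda>r. enn2real (polar f t r)) \<in> borel_measurable borel" by measurable
      then show ?thesis by (simp add: polar_def)
    qed
    \<comment> \<open>The inner radius of the box is at least 1/4, as the substitution demands; this
      is where 1/2 <= r0 enters.\<close>
    have "1 / 4 \<le> (1 / 2) * (1 - h)" using hpos by simp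
    also have "\<dots> \<le> r0 * exp (- h)"
      using r0 hpos exp_ge_add_one_self[of "- h"] by (intro mult_mono) auto
    also have "\<dots> = exp (u - h)" by (simp add: u exp_diff exp_minus divide_inverse)
    finally have "(\<integral>\<^sup>+x\<in>{u-h..u+h}. ennreal (cmod (f (rcis (exp x) t))) \<partial>lborel)
        \<le> 4 * (\<integral>\<^sup>+r\<in>{exp (u-h)..exp (u+h)}. ennreal (cmod (f (rcis r t))) \<partial>lborel)"
      using hpos by (intro nn_integral_exp_substitution) auto
    also have "{exp (u-h)..exp (u+h)} = {r0 * exp (- h)..r0 * exp h}"
      by (simp add: u exp_diff exp_add exp_minus divide_inverse)
    finally show "(\<integral>\<^sup>+x\<in>{u-h..u+h}. ennreal (cmod (f (exp (Complex x t)))) \<partial>lborel)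
        \<le> 4 * (\<integral>\<^sup>+r\<in>{r0 * exp (- h)..r0 * exp h}. polar f t r \<partial>lborel)"
      by (simp add: polar_def exp_eq_polar rcis_def exp_of_real)
  qed auto
  also have "\<dots> = 16 * (\<integral>\<^sup>+t\<in>{t0-h..t0+h}. (\<integral>\<^sup>+r\<in>{r0 * exp (- h)..r0 * exp h}. polar f t r \<partial>lborel) \<partial>lborel)"
  proof -
    note [measurable] = polar_measurable[OF f f0]
    have "(\<integral>\<^sup>+t\<in>{t0-h..t0+h}. 4 * (\<integral>\<^sup>+r\<in>{r0 * exp (- h)..r0 * exp h}. polar f t r \<partial>lborel) \<partial>lborel)
      = (\<integral>\<^sup>+t. 4 * ((\<integral>\<^sup>+r\<in>{r0 * exp (- h)..r0 * exp h}. polar f t r \<partial>lborel) * indicator {t0-h..t0+h} t) \<partial>lborel)"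
      by (simp add: mult.assoc)
    also have "\<dots> = 4 * (\<integral>\<^sup>+t\<in>{t0-h..t0+h}. (\<integral>\<^sup>+r\<in>{r0 * exp (- h)..r0 * exp h}. polar f t r \<partial>lborel) \<partial>lborel)"
      by (rule nn_integral_cmult) measurable
    finally show ?thesis by (simp flip: mult.assoc)
  qed
  finally show ?thesis
    by (simp add: exp_eq_polar rcis_def exp_of_real u flip: cis_conv_exp)
qed

text \<open>A window around an angle in [0, 2*pi) may stick out on either side, while
  \<open>circle_measure\<close> lives on [0, 2*pi]. The protruding pieces are brought back by
  periodicity; overlaps at end points are harmless for an upper bound.\<close>

lemma nn_integral_periodic_window:
  fixes V :: "real \<Rightarrow> ennreal"
  assumes [measurable]: "V \<in> borel_measurable borel" and per: "\<And>t. V (t + 2 * pi) = V t"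
    and J: "{c..d} \<subseteq> {- (2 * pi)..4 * pi}"
  shows "(\<integral>\<^sup>+t\<in>{c..d}. V t \<partial>lborel) \<le>
    (\<integral>\<^sup>+t\<in>{0..2*pi}. V t * indicator {c..d} (t - 2 * pi) \<partial>lborel) +
    (\<integral>\<^sup>+t\<in>{0..2*pi}. V t * indicator {c..d} t \<partial>lborel) +
    (\<integral>\<^sup>+t\<in>{0..2*pi}. V t * indicator {c..d} (t + 2 * pi) \<partial>lborel)"
proof -
  have per': "V (t - 2 * pi) = V t" for t using per[of "t - 2 * pi"] by simp
  have shift: "(\<integral>\<^sup>+t. H (s + t) \<partial>lborel) = (\<integral>\<^sup>+t. H t \<partial>lborel)"
    if "H \<in> borel_measurable borel" for H :: "real \<Rightarrow> ennreal" and s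
    using nn_integral_real_affine[of H 1 s] that by auto
  have 1: "(\<integral>\<^sup>+t. V t * indicator {c..d} t * indicator {- (2 * pi)..0} t \<partial>lborel)
      = (\<integral>\<^sup>+t\<in>{0..2*pi}. V t * indicator {c..d} (t - 2 * pi) \<partial>lborel)"
    by (subst shift[of _ "- (2 * pi)", symmetric], measurable)
       (auto intro!: nn_integral_cong simp: per' indicator_def)
  have 2: "(\<integral>\<^sup>+t. V t * indicator {c..d} t * indicator {2 * pi..4 * pi} t \<partial>lborel)
      = (\<integral>\<^sup>+t\<in>{0..2*pi}. V t * indicator {c..d} (t + 2 * pi) \<partial>lborel)"
    by (subst shift[of _ "2 * pi", symmetric], measurable)
       (auto intro!: nn_integral_cong simp: per indicator_def add.commute)
  have "(\<integral>\<^sup>+t\<in>{c..d}. V t \<partial>lborel) \<le> (\<integral>\<^sup>+t. V t * indicator {c..d} t * indicator {- (2 * pi)..0} t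
      + V t * indicator {c..d} t * indicator {0..2 * pi} t
      + V t * indicator {c..d} t * indicator {2 * pi..4 * pi} t \<partial>lborel)"
  proof (rule nn_integral_mono)
    fix t
    show "V t * indicator {c..d} t \<le> V t * indicator {c..d} t * indicator {- (2 * pi)..0} t
      + V t * indicator {c..d} t * indicator {0..2 * pi} t
      + V t * indicator {c..d} t * indicator {2 * pi..4 * pi} t"
    proof (cases "t \<in> {c..d}")
      case True
      then have "t \<in> {- (2 * pi)..0} \<or> t \<in> {0..2 * pi} \<or> t \<in> {2 * pi..4 * pi}" using J by auto
      then show ?thesis by (auto simp: indicator_def)
    qed simp
  qed
  also have "\<dots> = (\<integral>\<^sup>+t. V t * indicator {c..d} t * indicator {- (2 * pi)..0} t \<partial>lborel)
      + (\<integral>\<^sup>+t\<in>{0..2*pi}. V t * indicator {c..d} t \<partial>lborel)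
      + (\<integral>\<^sup>+t. V t * indicator {c..d} t * indicator {2 * pi..4 * pi} t \<partial>lborel)"
    by (simp add: nn_integral_add)
  finally show ?thesis by (simp add: 1 2)
qed

text \<open>Hoelder pairs |f| with the indicator of a polar box whose sides are comparable to h; the
  indicator has norm of order h^((1-a)+(1-b)). Dividing by h^2 leaves h^(-a-b). The constant is 1152
  = 16 * 3 * 6 * 4: mean estimate, three periodic copies, Hoelder bound, and the passage from h to 1
  - |z| = 2h.\<close>

theorem polar_point_estimate:
  assumes f: "f holomorphic_on unit_disc" and f0: "\<And>z. z \<notin> unit_disc \<Longrightarrow> f z = 0"
    and z: "1 / 2 \<le> cmod z" "cmod z < 1" and a: "0 \<le> a" "a \<le> 1" and b: "0 \<le> b" "b \<le> 1"
  shows "ennreal (cmod (f z) * (1 - cmod z) powr (a + b)) \<le> ennreal (1152 * pi) * mixed_norm a b (polar f)"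
proof -
  note [measurable] = polar_measurable[OF f f0]
  define r0 t0 h where "r0 = cmod z" and "t0 = Arg2pi z" and "h = (1 - r0) / 2"
  have z_eq: "z = rcis r0 t0" and t0: "0 \<le> t0" "t0 < 2 * pi"
    using Arg2pi[of z] by (auto simp: r0_def t0_def rcis_def cis_conv_exp mult_ac is_Arg_def)
  have h: "0 < h" "h \<le> 1 / 4" "r0 = 1 - 2 * h" using z by (auto simp: h_def r0_def field_simps)
  define I J where "I = {r0 * exp (- h)..r0 * exp h}" and "J = {t0 - h..t0 + h}"
  have I_sub: "I \<subseteq> {0..<1}"
  proof -
    \<comment> \<open>Here r0 = 1 - 2h < 1 - h <= exp(-h), so the outer radius of the box is below
      1.\<close>
    have "r0 * exp h < exp (- h) * exp h"
      using exp_ge_add_one_self[of "- h"] h by (intro mult_strict_right_mono) auto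
    also have "\<dots> = 1" by (simp flip: exp_add)
    finally have "r0 * exp h < 1" .
    moreover have "0 \<le> r0 * exp (- h)" using h by simp
    ultimately show ?thesis unfolding I_def by auto
  qed
  have I_len: "r0 * exp h - r0 * exp (- h) \<le> 3 * h"
  proof -
    have "h\<^sup>2 \<le> h" using h by (simp add: power2_eq_square mult_left_le)
    \<comment> \<open>From exp h <= 1 + h + h^2 and exp(-h) >= 1 - h.\<close>
    then have d: "exp h - exp (- h) \<le> 3 * h"
      using exp_bound[of h] exp_ge_add_one_self[of "- h"] h by auto
    have "r0 * (exp h - exp (- h)) \<le> 1 * (3 * h)"
      using h d by (intro mult_mono) auto
    then show ?thesis by (simp add: right_diff_distrib)
  qed
  define M where "M = mixed_norm a b (polar f)"
  define V where "V t = (\<integral>\<^sup>+r\<in>I. polar f t r \<partial>lborel)" for t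
  have [measurable]: "I \<in> sets borel" "J \<in> sets borel" by (auto simp: I_def J_def)
  have Vm[measurable]: "V \<in> borel_measurable borel" unfolding V_def by measurable
  \<comment> \<open>The bound does not depend on the shift \<open>s\<close>, so it covers all three
    periodic copies of the window.\<close>
  have translate: "(\<integral>\<^sup>+t\<in>{0..2*pi}. V t * indicator J (t + s) \<partial>lborel)
      \<le> ennreal (6 * pi * h powr (2 - a - b)) * M" for s
  proof -
    define w :: "real \<Rightarrow> ennreal" where "w t = indicator J (t + s)" for t
    define k :: "real \<Rightarrow> ennreal" where "k = indicator I"
    have [measurable]: "w \<in> borel_measurable borel" "k \<in> borel_measurable borel"
      unfolding w_def k_def by measurable
    have k: "pnorm radial_measure (1 - a) k \<le> ennreal ((3 * h) powr (1 - a))"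
    proof (rule pnorm_le_integral)
      have "(\<integral>\<^sup>+r. k r \<partial>radial_measure) = emeasure lborel ({0..<1} \<inter> I)"
        unfolding k_def by (simp add: emeasure_radial_measure)
      also have "\<dots> \<le> emeasure lborel I" by (intro emeasure_mono) auto
      also have "\<dots> \<le> ennreal (3 * h)"
        using I_len h by (auto simp: I_def emeasure_lborel_Icc_eq intro!: ennreal_leI)
      finally show "(\<integral>\<^sup>+r. k r \<partial>radial_measure) \<le> ennreal (3 * h)" .
    qed (use a h in \<open>auto simp: k_def split: split_indicator\<close>)
    have w: "pnorm circle_measure (1 - b) w \<le> ennreal (h powr (1 - b))"
    proof (rule pnorm_le_integral)
      have "(\<integral>\<^sup>+t. w t \<partial>circle_measure) = ennreal (1 / (2 * pi)) * (\<integral>\<^sup>+t\<in>{0..2 * pi}. w t \<partial>lborel)"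
        by (intro nn_integral_circle_measure) measurable
      also have "\<dots> \<le> ennreal (1 / (2 * pi)) * (\<integral>\<^sup>+t. indicator {t0 - h - s..t0 + h - s} t \<partial>lborel)"
        by (intro mult_left_mono nn_integral_mono) (auto simp: w_def J_def split: split_indicator)
      also have "\<dots> = ennreal (1 / (2 * pi) * (2 * h))"
        using h by (simp add: emeasure_lborel_Icc_eq flip: ennreal_mult)
      also have "\<dots> \<le> ennreal h"
        using h pi_gt3 by (intro ennreal_leI) (simp add: field_simps)
      finally show "(\<integral>\<^sup>+t. w t \<partial>circle_measure) \<le> ennreal h" .
    qed (use b h in \<open>auto simp: w_def split: split_indicator\<close>)
    have "mixed_norm 1 1 (\<lambda>t r. polar f t r * (w t * k r))
        = (\<integral>\<^sup>+t. (\<integral>\<^sup>+r. polar f t r * (w t * k r) \<partial>radial_measure) \<partial>circle_measure)"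
      by (simp add: mixed_norm_def pnorm_1)
    also have "\<dots> = (\<integral>\<^sup>+t. V t * w t \<partial>circle_measure)"
    proof (rule nn_integral_cong)
      fix t
      have "(\<integral>\<^sup>+r. polar f t r * (w t * k r) \<partial>radial_measure)
        = (\<integral>\<^sup>+r. (polar f t r * (w t * k r)) * indicator {0..<1} r \<partial>lborel)"
        by (intro nn_integral_radial_measure) measurable
      also have "\<dots> = (\<integral>\<^sup>+r. (polar f t r * indicator I r) * w t \<partial>lborel)"
        using I_sub by (intro nn_integral_cong) (auto simp: k_def split: split_indicator)
      also have "\<dots> = V t * w t"
        unfolding V_def by (rule nn_integral_multc) measurable
      finally show "(\<integral>\<^sup>+r. polar f t r * (w t * k r) \<partial>radial_measure) = V t * w t" .
    qed
    also have "\<dots> = ennreal (1 / (2 * pi)) * (\<integral>\<^sup>+t\<in>{0..2*pi}. V t * w t \<partial>lborel)"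
      by (intro nn_integral_circle_measure) measurable
    finally have "(\<integral>\<^sup>+t\<in>{0..2*pi}. V t * w t \<partial>lborel)
        = ennreal (2 * pi) * mixed_norm 1 1 (\<lambda>t r. polar f t r * (w t * k r))"
      by (simp flip: mult.assoc ennreal_mult)
    also have "\<dots> \<le> ennreal (2 * pi) * (M * mixed_norm (1 - a) (1 - b) (\<lambda>t r. w t * k r))"
      using mixed_norm_Holder[of "polar f" "\<lambda>t r. w t * k r" a b "1 - a" "1 - b"] a b
      by (intro mult_left_mono) (auto simp: M_def)
    also have "mixed_norm (1 - a) (1 - b) (\<lambda>t r. w t * k r) = pnorm circle_measure (1 - b) w * pnorm radial_measure (1 - a) k"
      using a b le_less_trans[OF k] by (intro mixed_norm_product) (auto simp: w_def split: split_indicator)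
    also have "ennreal (2 * pi) * (M * \<dots>) \<le> ennreal (2 * pi) * (M * (ennreal (h powr (1 - b)) * ennreal ((3 * h) powr (1 - a))))"
      by (intro mult_left_mono mult_mono w k) auto
    also have "\<dots> = ennreal (2 * pi * (h powr (1 - b) * (3 * h) powr (1 - a))) * M"
      by (simp add: ennreal_mult mult_ac)
    also have "\<dots> \<le> ennreal (6 * pi * h powr (2 - a - b)) * M"
    \<comment> \<open>The factor 3^(1-a) is at most 3, which turns 2*pi into 6*pi.\<close>
    proof (intro mult_right_mono ennreal_leI)
      have "h powr (1 - b) * (3 * h) powr (1 - a) = 3 powr (1 - a) * h powr (2 - a - b)"
        using h by (simp add: powr_mult flip: powr_add) (simp add: algebra_simps)
      also have "\<dots> \<le> 3 powr 1 * h powr (2 - a - b)"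
        using a by (intro mult_right_mono powr_mono) auto
      finally show "2 * pi * (h powr (1 - b) * (3 * h) powr (1 - a)) \<le> 6 * pi * h powr (2 - a - b)"
        by simp
    qed auto
    finally show ?thesis by (simp add: w_def)
  qed
  have "ennreal (h\<^sup>2 * cmod (f z)) \<le> 16 * (\<integral>\<^sup>+t\<in>J. V t \<partial>lborel)"
    using polar_mean_estimate[OF f f0 _ _ h_def, of t0] z by (simp add: z_eq[symmetric] V_def I_def J_def r0_def[symmetric])
  also have "\<dots> \<le> 16 * ((\<integral>\<^sup>+t\<in>{0..2*pi}. V t * indicator J (t - 2 * pi) \<partial>lborel) +
    (\<integral>\<^sup>+t\<in>{0..2*pi}. V t * indicator J t \<partial>lborel) +
    (\<integral>\<^sup>+t\<in>{0..2*pi}. V t * indicator J (t + 2 * pi) \<partial>lborel))"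
    unfolding J_def using t0 h pi_gt3
    by (intro mult_left_mono nn_integral_periodic_window) (auto simp: V_def polar_periodic)
  also have "\<dots> \<le> 16 * (ennreal (6 * pi * h powr (2 - a - b)) * M + ennreal (6 * pi * h powr (2 - a - b)) * M
      + ennreal (6 * pi * h powr (2 - a - b)) * M)"
    using translate[of "- (2 * pi)"] translate[of 0] translate[of "2 * pi"]
    by (intro mult_left_mono add_mono) auto
  also have "\<dots> = ennreal (288 * pi * h powr (2 - a - b)) * M"
    by (simp add: ennreal_mult' mult.assoc flip: distrib_right ennreal_plus ennreal_numeral)
       (simp flip: mult.assoc ennreal_mult')
  finally have main: "ennreal (h\<^sup>2 * cmod (f z)) \<le> ennreal (288 * pi * h powr (2 - a - b)) * M" .
  have "(1 - cmod z) powr (a + b) = 2 powr (a + b) * h powr (a + b)"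
    using h by (simp add: powr_mult[symmetric] r0_def[symmetric])
  also have "\<dots> \<le> 2 powr 2 * h powr (a + b)"
    using a b by (intro mult_right_mono powr_mono) auto
  also have "\<dots> = 4 * h powr (a + b - 2) * h\<^sup>2"
    using h by (simp add: powr_diff)
  finally have "cmod (f z) * (1 - cmod z) powr (a + b) \<le> cmod (f z) * (4 * h powr (a + b - 2) * h\<^sup>2)"
    by (intro mult_left_mono) auto
  then have "ennreal (cmod (f z) * (1 - cmod z) powr (a + b)) \<le> ennreal ((4 * h powr (a + b - 2)) * (h\<^sup>2 * cmod (f z)))"
    by (intro ennreal_leI) (simp add: mult_ac)
  also have "\<dots> = ennreal (4 * h powr (a + b - 2)) * ennreal (h\<^sup>2 * cmod (f z))"
    by (simp add: ennreal_mult)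
  also have "\<dots> \<le> ennreal (4 * h powr (a + b - 2)) * (ennreal (288 * pi * h powr (2 - a - b)) * M)"
    by (intro mult_left_mono main) auto
  also have "\<dots> = ennreal (4 * h powr (a + b - 2) * (288 * pi * h powr (2 - a - b))) * M"
  proof -
    have "ennreal x * (ennreal y * M) = ennreal (x * y) * M" if "0 \<le> x" "0 \<le> y" for x y
      using that by (simp add: ennreal_mult mult.assoc)
    then show ?thesis by simp
  qed
  also have "4 * h powr (a + b - 2) * (288 * pi * h powr (2 - a - b)) = 1152 * pi * (h powr (a + b - 2) * h powr (2 - a - b))"
    by simp
  also have "\<dots> = 1152 * pi"
    using h by (simp flip: powr_add)
  finally show ?thesis by (simp add: M_def)
qed

text \<open>Point evaluations are bounded, uniformly on compact subsets of the disc. The growth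
  estimate covers only |z| >= 1/2; the maximum principle on a circle of radius at least 1/2 extends
  it inwards.\<close>

lemma polar_ball_estimate:
  assumes a: "0 \<le> a" "a \<le> 1" and b: "0 \<le> b" "b \<le> 1" and R: "R < 1"
  obtains K where "0 < K" "\<And>f z. f \<in> vanishing_holomorphic \<Longrightarrow> cmod z \<le> R \<Longrightarrow> ennreal (cmod (f z)) \<le> ennreal K * mixed_norm a b (polar f)"
proof -
  define R' where "R' = max R (1 / 2)"
  have R': "1 / 2 \<le> R'" "R' < 1" "R \<le> R'" using R by (auto simp: R'_def)
  define c where "c = (1 - R') powr (a + b)"
  have c: "0 < c" using R' by (simp add: c_def)
  show ?thesis
  proof (rule that)
    show "0 < 1152 * pi / c" using c by simp
    fix f z assume V: "f \<in> vanishing_holomorphic" and z: "cmod z \<le> R"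
    note f = vanishing_holomorphicD(1)[OF V] and f0 = vanishing_holomorphicD(2)[OF V]
    show "ennreal (cmod (f z)) \<le> ennreal (1152 * pi / c) * mixed_norm a b (polar f)"
    proof (cases "mixed_norm a b (polar f)")
      case top
      then show ?thesis using c by (simp add: ennreal_mult_top)
    next
      case (real m)
      have bd: "cmod (f w) \<le> 1152 * pi / c * m" if "cmod w = R'" for w
      proof -
        have "ennreal (cmod (f w) * c) \<le> ennreal (1152 * pi * m)"
          using polar_point_estimate[OF f f0, of w a b] a b R' that real
          by (simp add: c_def ennreal_mult)
        then have "cmod (f w) * c \<le> 1152 * pi * m" using real by (subst (asm) ennreal_le_iff) auto
        then show ?thesis using c by (simp add: field_simps)
      qed
      have sub: "cball 0 R' \<subseteq> unit_disc" using R' by auto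
      have "cmod (f z) \<le> 1152 * pi / c * m"
      proof (rule maximum_modulus_frontier[of f "cball 0 R'"])
        show "f holomorphic_on interior (cball 0 R')"
          using f sub interior_subset by (blast intro: holomorphic_on_subset)
        show "continuous_on (closure (cball 0 R')) f"
          using holomorphic_on_imp_continuous_on[OF f] sub by (auto intro: continuous_on_subset)
        show "z \<in> cball 0 R'" using z R' by simp
        show "cmod (f w) \<le> 1152 * pi / c * m" if "w \<in> frontier (cball 0 R')" for w
          using that bd by (simp add: dist_norm)
      qed simp
      then show ?thesis using real c by (simp add: ennreal_leI flip: ennreal_mult)
    qed
  qed
qed

section \<open>Tail estimates and compactness\<close>

lemma tendsto_0_if_eventually_le:
  fixes X :: "'b \<Rightarrow> ennreal"
  assumes "\<And>\<epsilon>::real. 0 < \<epsilon> \<Longrightarrow> \<forall>\<^sub>F n in F. X n \<le> ennreal \<epsilon>"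
  shows "(X \<longlongrightarrow> 0) F"
  unfolding order_tendsto_iff
proof safe
  fix y :: ennreal assume "0 < y"
  then obtain e where e: "0 < e" "e < y" using dense by blast
  then obtain r where r: "e = ennreal r" "0 < r" by (cases e) auto
  show "\<forall>\<^sub>F n in F. X n < y"
    using assms[OF r(2)] by eventually_elim (use e r in auto)
qed auto

text \<open>Since k < c, the power 1/c of the weight is (1-r)^(e-1) with e = 1 - k/c > 0, whose
  integral over the last stretch of length d is d^e / e. Raising it to the power c gives d^(c-k),
  which tends to 0 with d.\<close>

lemma pnorm_radial_power_tail:
  assumes k: "0 \<le> k" "k < c" and d: "0 < d" "d \<le> 1"
  shows "pnorm radial_measure c (\<lambda>r. ennreal ((1 - r) powr (- k)) * indicator {1 - d<..} r)
    \<le> ennreal (d powr (c - k) * (1 / (1 - k / c)) powr c)"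
proof -
  define e where "e = 1 - k / c"
  have c: "0 < c" "0 < e" "e * c = c - k" "- (k / c) = e - 1" using k by (auto simp: e_def field_simps)
  have "(\<integral>\<^sup>+r. ennpowr (ennreal ((1 - r) powr (- k)) * indicator {1 - d<..} r) (1 / c) \<partial>radial_measure)
      = (\<integral>\<^sup>+r. ennpowr (ennreal ((1 - r) powr (- k)) * indicator {1 - d<..} r) (1 / c) * indicator {0..<1} r \<partial>lborel)"
    by (intro nn_integral_radial_measure) measurable
  also have "\<dots> \<le> (\<integral>\<^sup>+r. ennreal ((1 - r) powr (e - 1)) * indicator {0..d} (1 - r) \<partial>lborel)"
    using c by (intro nn_integral_mono)
      (auto simp: ennpowr_ennreal powr_powr split: split_indicator)
  also have "\<dots> = (\<integral>\<^sup>+x. ennreal (x powr (e - 1)) * indicator {0..d} x \<partial>lborel)"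
    by (subst nn_integral_real_affine[where c = "-1" and t = 1]) auto
  also have "\<dots> = ennreal (d powr e / e)"
    using has_integral_powr_from_0[of "e - 1" d] c d
    by (intro nn_integral_has_integral_lebesgue') auto
  finally have le: "(\<integral>\<^sup>+r. ennpowr (ennreal ((1 - r) powr (- k)) * indicator {1 - d<..} r) (1 / c) \<partial>radial_measure)
      \<le> ennreal (d powr e / e)" .
  have "pnorm radial_measure c (\<lambda>r. ennreal ((1 - r) powr (- k)) * indicator {1 - d<..} r)
      \<le> ennpowr (ennreal (d powr e / e)) c"
    using ennpowr_mono[OF le, of c] c by (simp add: pnorm_def)
  also have "\<dots> = ennreal (d powr (c - k) * (1 / e) powr c)"
    using c d by (simp add: ennpowr_ennreal powr_divide powr_powr)
  finally show ?thesis by (simp add: e_def)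
qed

lemma small_powr:
  fixes B e \<epsilon> :: real
  assumes "0 < B" "0 < e" "0 < \<epsilon>"
  obtains d where "0 < d" "d \<le> 1 / 2" "B * d powr e \<le> \<epsilon>"
proof
  let ?d = "min (1 / 2) ((\<epsilon> / B) powr (1 / e))"
  show "0 < ?d" "?d \<le> 1 / 2" using assms by auto
  have "?d powr e \<le> ((\<epsilon> / B) powr (1 / e)) powr e" using assms by (intro powr_mono2) auto
  also have "\<dots> = \<epsilon> / B" using assms by (simp add: powr_powr)
  finally show "B * ?d powr e \<le> \<epsilon>" using assms by (simp add: field_simps)
qed

lemma mixed_norm_const: "0 \<le> a \<Longrightarrow> 0 \<le> b \<Longrightarrow> mixed_norm a b (\<lambda>t r. 1) = 1"
  by (simp add: mixed_norm_def pnorm_radial_const pnorm_circle_const)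

lemma mixed_norm_zero: "0 \<le> a \<Longrightarrow> 0 \<le> b \<Longrightarrow> mixed_norm a b (\<lambda>t r. 0) = 0"
  by (simp add: mixed_norm_def pnorm_zero)

lemma cmod_rcis_in: "0 \<le> r \<Longrightarrow> r < 1 \<Longrightarrow> rcis r t \<in> unit_disc" "0 \<le> r \<Longrightarrow> cmod (rcis r t) = r"
  by (auto simp: rcis_def norm_mult)

text \<open>For \<open>b < b\<^sub>0\<close> one writes \<open>|f| = |f|\<^sup>\<theta> |f|\<^sup>1\<^sup>-\<^sup>\<theta>\<close> with \<open>\<theta> = b / b\<^sub>0\<close>, bounds the second factor by the
  pointwise estimate and applies Hoelder's inequality: \<open>|f|\<^sup>\<theta>\<close> has exponents \<open>\<theta> a\<^sub>0\<close> and \<open>b\<close>.\<close>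

lemma polar_tail_estimate:
  assumes a0: "0 \<le> a\<^sub>0" "a\<^sub>0 < a" "a \<le> 1" and b: "0 \<le> b" "b \<le> 1" "0 \<le> b\<^sub>0" "b\<^sub>0 \<le> 1"
    and ab: "a\<^sub>0 + b\<^sub>0 < a + b" and \<epsilon>: "0 < \<epsilon>"
  obtains R where "1 / 2 \<le> R" "R < 1"
    "\<And>f. f \<in> vanishing_holomorphic \<Longrightarrow>
      mixed_norm a b (\<lambda>t r. polar f t r * indicator {R<..} r) \<le> ennreal \<epsilon> * mixed_norm a\<^sub>0 b\<^sub>0 (polar f)"
proof -
  \<comment> \<open>Any excess of \<open>b\<close> over \<open>b\<^sub>0\<close> is given up. Both
    hypotheses are used for the strict inequality \<open>a\<^sub>0 + b\<^sub>0 < a + b'\<close>: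
    \<open>a\<^sub>0 < a\<close> when b' = \<open>b\<^sub>0\<close>, and \<open>ab\<close> when b' =
    \<open>b\<close>.\<close>
  define b' where "b' = min b b\<^sub>0"
  \<comment> \<open>For \<open>b\<^sub>0\<close> = 0 the quotient has no meaning; the value 1 means
    that no growth bound is spent.\<close>
  define \<theta> where "\<theta> = (if b\<^sub>0 = 0 then 1 else b' / b\<^sub>0)"
  have b': "0 \<le> b'" "b' \<le> b" "b' \<le> b\<^sub>0" "a\<^sub>0 + b\<^sub>0 < a + b'" using a0 b ab by (auto simp: b'_def)
  have \<theta>: "0 \<le> \<theta>" "\<theta> \<le> 1" "\<theta> * b\<^sub>0 = b'" using b b' by (auto simp: \<theta>_def)
  \<comment> \<open>\<open>k\<close> is the growth exponent of the factor |f|^(1-\<theta>), and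
    \<open>c\<close> is the radial exponent left for it. The decisive identity is c - k = a + b' -
    \<open>a\<^sub>0\<close> - \<open>b\<^sub>0\<close>, which is positive.\<close>
  define k c where "k = (a\<^sub>0 + b\<^sub>0) * (1 - \<theta>)" and "c = a - \<theta> * a\<^sub>0"
  have "\<theta> * a\<^sub>0 \<le> 1 * a\<^sub>0" using \<theta> a0 by (intro mult_right_mono) auto
  then have kc: "0 \<le> k" "k < c" "0 < c"
    using a0 b \<theta> b' by (auto simp: k_def c_def algebra_simps intro!: mult_nonneg_nonneg[of "a\<^sub>0 + b\<^sub>0" "1 - \<theta>", simplified algebra_simps])
  define C where "C = 1152 * pi"
  have C: "0 < C" by (simp add: C_def)
  define B where "B = C powr (1 - \<theta>) * (1 / (1 - k / c)) powr c"
  have B: "0 < B" using C kc by (auto simp: B_def field_simps)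
  obtain d where d: "0 < d" "d \<le> 1 / 2" "B * d powr (c - k) \<le> \<epsilon>"
    using small_powr[OF B, of "c - k" \<epsilon>] kc \<epsilon> by auto
  show ?thesis
  proof (rule that)
    show "1 / 2 \<le> 1 - d" "1 - d < 1" using d by auto
    fix f assume V: "f \<in> vanishing_holomorphic"
    note f = vanishing_holomorphicD(1)[OF V] and f0 = vanishing_holomorphicD(2)[OF V]
    note [measurable] = polar_measurable[OF f f0]
    show "mixed_norm a b (\<lambda>t r. polar f t r * indicator {1 - d<..} r) \<le> ennreal \<epsilon> * mixed_norm a\<^sub>0 b\<^sub>0 (polar f)"
    proof (cases "mixed_norm a\<^sub>0 b\<^sub>0 (polar f)")
      case top
      then show ?thesis using \<epsilon> by (simp add: ennreal_mult_top)
    next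
      case (real m)
      have pt: "cmod (f (rcis r t)) * (1 - r) powr (a\<^sub>0 + b\<^sub>0) \<le> C * m" if r: "1 - d < r" "r < 1" for t r
      proof -
        have "ennreal (cmod (f (rcis r t)) * (1 - r) powr (a\<^sub>0 + b\<^sub>0)) \<le> ennreal (C * m)"
          using polar_point_estimate[OF f f0, of "rcis r t" a\<^sub>0 b\<^sub>0] r d a0 b real
          by (simp add: cmod_rcis_in C_def ennreal_mult)
        then show ?thesis using real C by (subst (asm) ennreal_le_iff) auto
      qed
      show ?thesis
      proof (cases "m = 0")
        \<comment> \<open>A zero norm forces \<open>f\<close> to vanish on the tail by the pointwise
          bound; afterwards all powers of \<open>m\<close> have a positive base.\<close>
        case True
        have "polar f t r * indicator {1 - d<..} r \<le> 0" if "0 \<le> r" "r < 1" for t r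
        proof (cases "1 - d < r")
          case r: True
          have "0 < (1 - r) powr (a\<^sub>0 + b\<^sub>0)" using that by simp
          then have "cmod (f (rcis r t)) \<le> 0"
            using pt[OF r that(2), of t] True by (simp add: mult_le_0_iff)
          then show ?thesis by (simp add: polar_def)
        qed simp
        then have "mixed_norm a b (\<lambda>t r. polar f t r * indicator {1 - d<..} r) \<le> mixed_norm a b (\<lambda>t r. 0)"
          using a0 b by (intro mixed_norm_mono) auto
        then show ?thesis using a0 b by (simp add: mixed_norm_zero)
      next
        case False
        then have m: "0 < m" using real by auto
        define V where "V t r = ennreal (cmod (f (rcis r t)) powr \<theta>)" for t r
        have V_eq: "V t r = ennreal (enn2real (polar f t r) powr \<theta>)" for t r
          by (simp add: V_def polar_def)
        have [measurable]: "case_prod V \<in> borel_measurable (borel \<Otimes>\<^sub>M borel)"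
          unfolding V_eq split_beta by measurable
        have V: "mixed_norm (\<theta> * a\<^sub>0) (\<theta> * b\<^sub>0) V \<le> ennreal (m powr \<theta>)"
        \<comment> \<open>At \<theta> = 0 the function \<open>V\<close> is an indicator, because
          \<open>x powr 0\<close> is 0 at x = 0 and 1 elsewhere, and its norm is bounded by that of
          the constant 1.\<close>
        proof (cases "\<theta> = 0")
          case True
          have "mixed_norm 0 0 V \<le> mixed_norm 0 0 (\<lambda>t r. 1)"
            using True by (intro mixed_norm_mono) (auto simp: V_def)
          then show ?thesis using True m by (simp add: mixed_norm_const)
        next
          case False
          have "V = (\<lambda>t r. ennpowr (polar f t r) \<theta>)"
            by (simp add: V_def polar_def ennpowr_ennreal fun_eq_iff)
          then show ?thesis
            using mixed_norm_powr[of "polar f" a\<^sub>0 b\<^sub>0 \<theta>] a0 b \<theta> False real by (simp add: ennpowr_ennreal)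
        qed
        define W where "W r = ennreal ((1 - r) powr (- k)) * indicator {1 - d<..} r" for r
        have [measurable]: "W \<in> borel_measurable borel" unfolding W_def by measurable
        define D where "D = (C * m) powr (1 - \<theta>)"
        have le: "polar f t r * indicator {1 - d<..} r \<le> V t r * (ennreal D * W r)" if r: "0 \<le> r" "r < 1" for t r
        proof (cases "1 - d < r")
          case True
          define x where "x = cmod (f (rcis r t))"
          have x: "0 \<le> x" "x \<le> C * m * (1 - r) powr (- (a\<^sub>0 + b\<^sub>0))"
          proof -
            have "x * (1 - r) powr (a\<^sub>0 + b\<^sub>0) * (1 - r) powr (- (a\<^sub>0 + b\<^sub>0)) \<le> C * m * (1 - r) powr (- (a\<^sub>0 + b\<^sub>0))"
              using pt[OF True r(2), of t] by (intro mult_right_mono) (auto simp: x_def)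
            moreover have "(1 - r) powr (a\<^sub>0 + b\<^sub>0) * (1 - r) powr (- (a\<^sub>0 + b\<^sub>0)) = 1"
              using r by (simp flip: powr_add)
            ultimately show "x \<le> C * m * (1 - r) powr (- (a\<^sub>0 + b\<^sub>0))" by (simp only: mult.assoc mult_1_right)
          qed (simp add: x_def)
          have "x = x powr \<theta> * x powr (1 - \<theta>)" using x by (simp flip: powr_add)
          also have "\<dots> \<le> x powr \<theta> * (C * m * (1 - r) powr (- (a\<^sub>0 + b\<^sub>0))) powr (1 - \<theta>)"
            using x \<theta> by (intro mult_left_mono powr_mono2) auto
          also have "\<dots> = x powr \<theta> * (D * (1 - r) powr (- k))"
          proof -
            have "((1 - r) powr (- (a\<^sub>0 + b\<^sub>0))) powr (1 - \<theta>) = (1 - r) powr (- k)"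
              unfolding powr_powr k_def by (simp only: mult_minus_left)
            then show ?thesis using C m r by (simp add: D_def powr_mult)
          qed
          finally have "ennreal x \<le> ennreal (x powr \<theta> * (D * (1 - r) powr (- k)))" by (rule ennreal_leI)
          then show ?thesis
            using True by (simp add: polar_def V_def W_def x_def[symmetric] ennreal_mult D_def)
        qed simp
        have "mixed_norm a b (\<lambda>t r. polar f t r * indicator {1 - d<..} r)
            \<le> mixed_norm a b' (\<lambda>t r. polar f t r * indicator {1 - d<..} r)"
          using a0 b' by (intro mixed_norm_antimono) auto
        \<comment> \<open>\<open>V\<close> uses up the whole angular exponent b' =
          \<open>\<theta> * b\<^sub>0\<close>; the purely radial factor \<open>W\<close> is left
          with angular exponent 0, which costs nothing.\<close>
        also have "\<dots> \<le> mixed_norm (\<theta> * a\<^sub>0 + c) (\<theta> * b\<^sub>0 + 0) (\<lambda>t r. V t r * (ennreal D * W r))"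
          using a0 b' \<theta> unfolding c_def by (simp del: distrib_left, intro mixed_norm_mono le) auto
        also have "\<dots> \<le> mixed_norm (\<theta> * a\<^sub>0) (\<theta> * b\<^sub>0) V * mixed_norm c 0 (\<lambda>t r. ennreal D * W r)"
          using a0 b \<theta> kc by (intro mixed_norm_Holder) auto
        also have "mixed_norm c 0 (\<lambda>t r. ennreal D * W r) = ennreal D * mixed_norm c 0 (\<lambda>t r. W r)"
          using kc by (intro mixed_norm_cmult) auto
        also have "mixed_norm c 0 (\<lambda>t r. W r) = pnorm radial_measure c W"
        proof -
          have fin: "pnorm radial_measure c W < top"
            unfolding W_def using pnorm_radial_power_tail[OF kc(1,2), of d] d by (auto intro: le_less_trans)
          show ?thesis
            using mixed_norm_product[of W "\<lambda>t. 1" c 0] kc fin by (simp add: pnorm_circle_const)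
        qed
        also have "mixed_norm (\<theta> * a\<^sub>0) (\<theta> * b\<^sub>0) V * (ennreal D * pnorm radial_measure c W)
            \<le> ennreal (m powr \<theta>) * (ennreal D * ennreal (d powr (c - k) * (1 / (1 - k / c)) powr c))"
          unfolding W_def using d kc by (intro mult_mono V mult_left_mono pnorm_radial_power_tail) auto
        also have "\<dots> = ennreal (B * d powr (c - k) * m)"
        proof -
          have "m powr \<theta> * D = C powr (1 - \<theta>) * m"
            using C m by (simp add: D_def powr_mult) (simp flip: powr_add)
          then have "(m powr \<theta> * D) * (d powr (c - k) * (1 / (1 - k / c)) powr c) = B * d powr (c - k) * m"
            by (simp only: B_def mult_ac)
          then have eq: "m powr \<theta> * (D * (d powr (c - k) * (1 / (1 - k / c)) powr c)) = B * d powr (c - k) * m"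
            by (simp only: mult.assoc)
          have "ennreal x * (ennreal y * ennreal z) = ennreal (x * (y * z))"
            if "0 \<le> x" "0 \<le> y" "0 \<le> z" for x y z using that by (simp add: ennreal_mult)
          then have "ennreal (m powr \<theta>) * (ennreal D * ennreal (d powr (c - k) * (1 / (1 - k / c)) powr c))
              = ennreal (m powr \<theta> * (D * (d powr (c - k) * (1 / (1 - k / c)) powr c)))"
            by (simp add: D_def)
          then show ?thesis by (simp only: eq)
        qed
        also have "\<dots> \<le> ennreal (\<epsilon> * m)" using d m by (intro ennreal_leI mult_right_mono) auto
        finally show ?thesis using real \<epsilon> by (simp add: ennreal_mult)
      qed
    qed
  qed
qed

lemma mixed_norm_split:
  assumes f: "f holomorphic_on unit_disc" "\<And>z. z \<notin> unit_disc \<Longrightarrow> f z = 0"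
    and a: "0 \<le> a" "a \<le> 1" and b: "0 \<le> b" "b \<le> 1"
    and B: "\<And>z. cmod z \<le> R \<Longrightarrow> cmod (f z) \<le> B"
  shows "mixed_norm a b (polar f) \<le> ennreal B + mixed_norm a b (\<lambda>t r. polar f t r * indicator {R<..} r)"
proof -
  note [measurable] = polar_measurable[OF f]
  have "polar f = (\<lambda>t r. polar f t r * indicator {..R} r + polar f t r * indicator {R<..} r)"
    by (auto simp: fun_eq_iff split: split_indicator)
  then have "mixed_norm a b (polar f) \<le> mixed_norm a b (\<lambda>t r. polar f t r * indicator {..R} r)
      + mixed_norm a b (\<lambda>t r. polar f t r * indicator {R<..} r)"
    using mixed_norm_triangle[of "\<lambda>t r. polar f t r * indicator {..R} r" "\<lambda>t r. polar f t r * indicator {R<..} r" a b] a b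
    by simp
  also have "mixed_norm a b (\<lambda>t r. polar f t r * indicator {..R} r) \<le> mixed_norm a b (\<lambda>t r. ennreal B * 1)"
  proof (rule mixed_norm_mono)
    show "(\<lambda>(t, r). polar f t r * indicator {..R} r) \<in> borel_measurable (borel \<Otimes>\<^sub>M borel)"
      by measurable
  qed (use a b B in \<open>auto simp: polar_def cmod_rcis_in intro!: ennreal_leI split: split_indicator\<close>)
  also have "\<dots> = ennreal B"
    using a b by (subst mixed_norm_cmult) (auto simp: mixed_norm_const)
  finally show ?thesis by (simp add: add_right_mono)
qed

text \<open>The common bound in the source norm makes all tails uniformly small; on the remaining
  closed disc uniform convergence does the rest.\<close>

lemma polar_uniform_limit_imp_mixed_norm:
  assumes a0: "0 \<le> a\<^sub>0" "a\<^sub>0 < a" "a \<le> 1" and b: "0 \<le> b" "b \<le> 1" "0 \<le> b\<^sub>0" "b\<^sub>0 \<le> 1"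
    and ab: "a\<^sub>0 + b\<^sub>0 < a + b"
    and g: "\<And>n. g n \<in> vanishing_holomorphic"
    and bdd: "\<And>n. mixed_norm a\<^sub>0 b\<^sub>0 (polar (g n)) \<le> ennreal m"
    and lim: "\<And>R. R < 1 \<Longrightarrow> uniform_limit (cball 0 R) g (\<lambda>z. 0) sequentially"
  shows "(\<lambda>n. mixed_norm a b (polar (g n))) \<longlonglongrightarrow> 0"
proof (rule tendsto_0_if_eventually_le)
  fix \<epsilon> :: real assume \<epsilon>: "0 < \<epsilon>"
  \<comment> \<open>\<open>m\<close> may be nonpositive, while a positive number is needed as
    divisor of epsilon.\<close>
  define m' where "m' = max m 1"
  have m': "0 < m'" "m \<le> m'" by (auto simp: m'_def)
  obtain R where R: "1 / 2 \<le> R" "R < 1" and tail: "\<And>f. f \<in> vanishing_holomorphic \<Longrightarrow>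
      mixed_norm a b (\<lambda>t r. polar f t r * indicator {R<..} r) \<le> ennreal (\<epsilon> / 2 / m') * mixed_norm a\<^sub>0 b\<^sub>0 (polar f)"
    using polar_tail_estimate[OF a0 b ab, of "\<epsilon> / 2 / m'"] \<epsilon> m' by auto
  have "\<forall>\<^sub>F n in sequentially. \<forall>z\<in>cball 0 R. dist (g n z) 0 < \<epsilon> / 2"
    using lim[OF R(2)] \<epsilon> unfolding uniform_limit_iff by (meson half_gt_zero)
  then show "\<forall>\<^sub>F n in sequentially. mixed_norm a b (polar (g n)) \<le> ennreal \<epsilon>"
  proof eventually_elim
    case (elim n)
    have "mixed_norm a b (polar (g n)) \<le> ennreal (\<epsilon> / 2) + mixed_norm a b (\<lambda>t r. polar (g n) t r * indicator {R<..} r)"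
      using elim a0 b by (intro mixed_norm_split vanishing_holomorphicD[OF g]) (auto simp: less_imp_le)
    also have "\<dots> \<le> ennreal (\<epsilon> / 2) + ennreal (\<epsilon> / 2 / m') * ennreal m'"
      using g bdd m' by (intro add_left_mono order_trans[OF tail] mult_left_mono order_trans[OF bdd] ennreal_leI) auto
    also have "\<dots> = ennreal \<epsilon>"
      using \<epsilon> m' by (simp flip: ennreal_mult ennreal_plus)
    finally show ?case .
  qed
qed

text \<open>It suffices to extract subsequences from sequences in \<open>S\<close> itself: a
  sequence in the closure is shadowed by one in \<open>S\<close> at distance below 1/(n+1), and the
  limit of a subsequence is shared.\<close>

lemma (in Metric_space) compactin_closure_ofI:
  assumes S: "S \<subseteq> M"
    and sub: "\<And>\<sigma> :: nat \<Rightarrow> 'a. range \<sigma> \<subseteq> S \<Longrightarrow>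
      \<exists>l r. l \<in> M \<and> strict_mono r \<and> (\<lambda>n. d (\<sigma> (r n)) l) \<longlonglongrightarrow> 0"
  shows "compactin mtopology (mtopology closure_of S)"
  unfolding compactin_sequentially
proof (intro conjI allI impI)
  show "mtopology closure_of S \<subseteq> M"
    using closure_of_subset_topspace[of mtopology S] by simp
  fix \<sigma> :: "nat \<Rightarrow> 'a" assume \<sigma>: "range \<sigma> \<subseteq> mtopology closure_of S"
  have "\<exists>y\<in>S. \<sigma> n \<in> M \<and> d (\<sigma> n) y < inverse (Suc n)" for n
  proof -
    have "\<sigma> n \<in> mtopology closure_of S" using \<sigma> by auto
    then show ?thesis unfolding metric_closure_of by (auto dest!: spec[of _ "inverse (Suc n)"])
  qed
  then obtain \<tau> where \<tau>: "\<And>n. \<tau> n \<in> S" "\<And>n. \<sigma> n \<in> M" "\<And>n. d (\<sigma> n) (\<tau> n) < inverse (Suc n)" by metis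
  then obtain l r where l: "l \<in> M" "strict_mono r" and lim: "(\<lambda>n. d (\<tau> (r n)) l) \<longlonglongrightarrow> 0"
    using sub[of \<tau>] by blast
  have \<tau>M: "\<tau> n \<in> M" for n using \<tau>(1) S by auto
  have "l \<in> mtopology closure_of S"
    unfolding metric_closure_of
  proof (safe intro!: l)
    fix e :: real assume "0 < e"
    then have "\<forall>\<^sub>F n in sequentially. d (\<tau> (r n)) l < e" using lim by (simp add: order_tendsto_iff)
    then obtain n where "d (\<tau> (r n)) l < e" by (auto dest: eventually_happens)
    then show "\<exists>y\<in>S. y \<in> mball l e"
      using \<tau>(1) \<tau>M l by (intro bexI[of _ "\<tau> (r n)"]) (auto simp: commute)
  qed
  moreover have "(\<lambda>n. d (\<sigma> (r n)) l) \<longlonglongrightarrow> 0"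
  proof (rule tendsto_sandwich[OF _ _ tendsto_const])
    have "(\<lambda>n. inverse (real (Suc (r n)))) \<longlonglongrightarrow> 0"
      using LIMSEQ_subseq_LIMSEQ[OF LIMSEQ_inverse_real_of_nat l(2)] by (simp add: o_def)
    then show "(\<lambda>n. inverse (real (Suc (r n))) + d (\<tau> (r n)) l) \<longlonglongrightarrow> 0"
      using tendsto_add[OF _ lim] by fastforce
    show "\<forall>\<^sub>F n in sequentially. d (\<sigma> (r n)) l \<le> inverse (real (Suc (r n))) + d (\<tau> (r n)) l"
    proof (intro always_eventually allI)
      fix n
      have "d (\<sigma> (r n)) l \<le> d (\<sigma> (r n)) (\<tau> (r n)) + d (\<tau> (r n)) l"
        using \<tau> \<tau>M l by (intro triangle) auto
      then show "d (\<sigma> (r n)) l \<le> inverse (real (Suc (r n))) + d (\<tau> (r n)) l"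
        using \<tau>(3)[of "r n"] by simp
    qed
  qed auto
  ultimately show "\<exists>l r. l \<in> mtopology closure_of S \<and> strict_mono r \<and> limitin mtopology (\<sigma> \<circ> r) l sequentially"
    using l \<tau>(2) by (intro exI[of _ l] exI[of _ r]) (auto simp: limitin_metric_dist_null o_def)
qed

section \<open>\<open>RM p q\<close> as a metric space\<close>

lemma vanishing_holomorphic_diff:
  "f \<in> vanishing_holomorphic \<Longrightarrow> g \<in> vanishing_holomorphic \<Longrightarrow> (\<lambda>z. f z - g z) \<in> vanishing_holomorphic"
  by (auto simp: vanishing_holomorphic_def intro: holomorphic_intros)

text \<open>A pointwise majorant as hypothesis covers differences f - g as well as the splitting of
  f - h into f - g and g - h.\<close>

lemma mixed_norm_polar_add_le:
  assumes "f \<in> vanishing_holomorphic" "g \<in> vanishing_holomorphic" "u \<in> vanishing_holomorphic"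
    and le: "\<And>z. cmod (u z) \<le> cmod (f z) + cmod (g z)"
    and a: "0 \<le> a" "a \<le> 1" and b: "0 \<le> b" "b \<le> 1"
  shows "mixed_norm a b (polar u) \<le> mixed_norm a b (polar f) + mixed_norm a b (polar g)"
proof -
  have "mixed_norm a b (polar u) \<le> mixed_norm a b (\<lambda>t r. polar f t r + polar g t r)"
    using a b le polar_measurable[OF vanishing_holomorphicD[OF assms(3)]]
    by (intro mixed_norm_mono) (auto simp: polar_def simp flip: ennreal_plus intro!: ennreal_leI)
  also have "\<dots> \<le> mixed_norm a b (polar f) + mixed_norm a b (polar g)"
    using assms(1,2) a b by (intro mixed_norm_triangle polar_measurable vanishing_holomorphicD)
  finally show ?thesis .
qed

lemma enn2real_inverse_bounds:
  assumes "1 \<le> (p::ennreal)"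
  shows "0 \<le> enn2real (1 / p)" "enn2real (1 / p) \<le> 1" "ennreal (enn2real (1 / p)) = 1 / p"
proof -
  have le: "1 / p \<le> 1"
  proof (cases p)
    case (real r)
    then have "1 \<le> r" using assms by simp
    then show ?thesis using divide_ennreal[of 1 r] real by (simp flip: ennreal_1)
  qed simp
  then show "enn2real (1 / p) \<le> 1" using enn2real_mono[OF le] by simp
  show "ennreal (enn2real (1 / p)) = 1 / p" using le by (auto intro!: ennreal_enn2real le_less_trans[OF le])
qed simp

lemma in_RM_iff:
  assumes "1 \<le> p" "1 \<le> q"
  shows "f \<in> RM p q \<longleftrightarrow> f \<in> vanishing_holomorphic \<and>
    mixed_norm (enn2real (1 / p)) (enn2real (1 / q)) (polar f) < top"
  using assms rho_eq_mixed_norm[of f p q] by (auto simp: RM_def vanishing_holomorphic_def)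

lemma RM_norm_eq:
  assumes "1 \<le> p" "1 \<le> q" "f \<in> vanishing_holomorphic"
  shows "RM_norm p q f = enn2real (mixed_norm (enn2real (1 / p)) (enn2real (1 / q)) (polar f))"
  using assms rho_eq_mixed_norm[of f p q] by (auto simp: RM_norm_def vanishing_holomorphic_def)

text \<open>Definiteness of the norm, read off from the boundedness of point evaluations.\<close>

lemma mixed_norm_polar_eq_0:
  assumes f: "f \<in> vanishing_holomorphic" and a: "0 \<le> a" "a \<le> 1" and b: "0 \<le> b" "b \<le> 1"
    and "mixed_norm a b (polar f) = 0"
  shows "f z = 0"
proof (cases "z \<in> unit_disc")
  case True
  then have z: "cmod z < 1" by simp
  obtain K where K: "0 < K" "\<And>f w. f \<in> vanishing_holomorphic \<Longrightarrow> cmod w \<le> cmod z \<Longrightarrow> ennreal (cmod (f w)) \<le> ennreal K * mixed_norm a b (polar f)"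
    by (rule polar_ball_estimate[OF a b z]) (rule that)
  from K(2)[OF f order_refl] show ?thesis
    using assms(6) by simp
qed (use vanishing_holomorphicD[OF f] in auto)

lemma RM_diff:
  assumes p: "1 \<le> p" "1 \<le> q" and f: "f \<in> RM p q" "g \<in> RM p q"
  shows "(\<lambda>z. f z - g z) \<in> RM p q"
proof -
  have *: "f \<in> vanishing_holomorphic" "g \<in> vanishing_holomorphic" using f p by (auto simp: in_RM_iff)
  have "mixed_norm (enn2real (1 / p)) (enn2real (1 / q)) (polar (\<lambda>z. f z - g z))
    \<le> mixed_norm (enn2real (1 / p)) (enn2real (1 / q)) (polar f) + mixed_norm (enn2real (1 / p)) (enn2real (1 / q)) (polar g)"
    by (intro mixed_norm_polar_add_le * vanishing_holomorphic_diff norm_triangle_ineq4 enn2real_inverse_bounds p)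
  also have "\<dots> < top" using f p by (auto simp: in_RM_iff)
  finally show ?thesis using p * by (simp add: in_RM_iff vanishing_holomorphic_diff)
qed

lemma Metric_space_RM:
  assumes p: "1 \<le> p" "1 \<le> q"
  shows "Metric_space (RM p q) (\<lambda>f g. RM_norm p q (\<lambda>z. f z - g z))"
proof
  let ?N = "\<lambda>f. mixed_norm (enn2real (1 / p)) (enn2real (1 / q)) (polar f)"
  have V: "f \<in> vanishing_holomorphic" if "f \<in> RM p q" for f using that p by (simp add: in_RM_iff)
  fix f g h
  show "0 \<le> RM_norm p q (\<lambda>z. f z - g z)" by (simp add: RM_norm_def)
  \<comment> \<open>\<open>Metric_space\<close> demands symmetry for arbitrary functions, so it is
    taken from \<open>rho\<close> directly; the mixed norm form is available only for holomorphic
    ones.\<close>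
  have "rho p q (\<lambda>z. f z - g z) = rho p q (\<lambda>z. g z - f z)"
    unfolding rho_def radial_int_def radial_sup_def by (simp only: norm_minus_commute)
  then show "RM_norm p q (\<lambda>z. f z - g z) = RM_norm p q (\<lambda>z. g z - f z)"
    by (simp add: RM_norm_def)
  assume f: "f \<in> RM p q" and g: "g \<in> RM p q"
  have fg: "(\<lambda>z. f z - g z) \<in> RM p q" by (rule RM_diff[OF p f g])
  show "RM_norm p q (\<lambda>z. f z - g z) = 0 \<longleftrightarrow> f = g"
  proof
    assume "RM_norm p q (\<lambda>z. f z - g z) = 0"
    then have "?N (\<lambda>z. f z - g z) = 0"
      using RM_norm_eq[OF p V[OF fg]] fg p by (auto simp: enn2real_eq_0_iff in_RM_iff)
    then have "f z - g z = 0" for z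
      using mixed_norm_polar_eq_0[OF V[OF fg]] enn2real_inverse_bounds p by blast
    then show "f = g" by auto
  next
    assume "f = g"
    have "mixed_norm (enn2real (1 / p)) (enn2real (1 / q)) (polar (\<lambda>z. 0)) = 0"
      using mixed_norm_zero[of "enn2real (1 / p)" "enn2real (1 / q)"] by (simp add: polar_def[abs_def])
    moreover have "(\<lambda>z. f z - g z) = (\<lambda>z. 0)" unfolding \<open>f = g\<close> by simp
    ultimately show "RM_norm p q (\<lambda>z. f z - g z) = 0"
      by (metis RM_norm_eq[OF p V[OF fg]] enn2real_0)
  qed
  assume h: "h \<in> RM p q"
  have gh: "(\<lambda>z. g z - h z) \<in> RM p q" and fh: "(\<lambda>z. f z - h z) \<in> RM p q"
    by (rule RM_diff[OF p g h], rule RM_diff[OF p f h])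
  have "?N (\<lambda>z. f z - h z) \<le> ?N (\<lambda>z. f z - g z) + ?N (\<lambda>z. g z - h z)"
    by (intro mixed_norm_polar_add_le V fg gh fh enn2real_inverse_bounds p)
      (metis diff_add_cancel diff_add_eq_diff_diff_swap add_diff_eq norm_triangle_ineq)
  moreover have "?N (\<lambda>z. f z - g z) < top" "?N (\<lambda>z. g z - h z) < top"
    using fg gh p by (auto simp: in_RM_iff)
  ultimately have "enn2real (?N (\<lambda>z. f z - h z)) \<le> enn2real (?N (\<lambda>z. f z - g z)) + enn2real (?N (\<lambda>z. g z - h z))"
    by (subst enn2real_plus[symmetric]) (auto intro!: enn2real_mono)
  then show "RM_norm p q (\<lambda>z. f z - h z) \<le> RM_norm p q (\<lambda>z. f z - g z) + RM_norm p q (\<lambda>z. g z - h z)"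
    by (simp only: RM_norm_eq[OF p V[OF fg]] RM_norm_eq[OF p V[OF gh]] RM_norm_eq[OF p V[OF fh]])
qed

section \<open>Normal families and sufficiency of the conditions\<close>

lemma mixed_norm_polar_Fatou:
  assumes f: "\<And>n. f n \<in> vanishing_holomorphic" "g \<in> vanishing_holomorphic"
    and lim: "\<And>z. z \<in> unit_disc \<Longrightarrow> (\<lambda>n. f n z) \<longlonglongrightarrow> g z"
    and bdd: "\<And>n. mixed_norm a b (polar (f n)) \<le> C" and a: "0 \<le> a" "0 \<le> b"
  shows "mixed_norm a b (polar g) \<le> C"
proof -
  have "mixed_norm a b (polar g) \<le> liminf (\<lambda>n. mixed_norm a b (polar (f n)))"
  proof (rule mixed_norm_Fatou[OF _ _ a])
    show "case_prod (polar (f n)) \<in> borel_measurable (borel \<Otimes>\<^sub>M borel)" for n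
      by (rule polar_measurable[OF vanishing_holomorphicD[OF f(1)]])
    show "case_prod (polar g) \<in> borel_measurable (borel \<Otimes>\<^sub>M borel)"
      by (rule polar_measurable[OF vanishing_holomorphicD[OF f(2)]])
    fix t r :: real assume "0 \<le> r" "r < 1"
    then have "(\<lambda>n. polar (f n) t r) \<longlonglongrightarrow> polar g t r"
      unfolding polar_def by (intro tendsto_ennrealI tendsto_norm lim cmod_rcis_in)
    then show "polar g t r \<le> liminf (\<lambda>n. polar (f n) t r)"
      by (simp add: lim_imp_Liminf)
  qed
  also have "\<dots> \<le> C"
    using Liminf_mono[of "\<lambda>n. mixed_norm a b (polar (f n))" "\<lambda>_. C" sequentially] bdd
    by (simp add: Liminf_const)
  finally show ?thesis .
qed

text \<open>Montel's theorem applies since norm bounds give bounds on compact sets. Fatou's lemma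
  keeps the limit in the same norm ball, so that the differences from it are bounded in the source
  norm as well.\<close>

lemma bounded_sequence_convergent_subsequence:
  assumes a: "0 \<le> a" "a \<le> 1" and b: "0 \<le> b" "b \<le> 1"
    and f: "\<And>n. f n \<in> vanishing_holomorphic" and bdd: "\<And>n. mixed_norm a b (polar (f n)) \<le> ennreal m"
  obtains g r where "g \<in> vanishing_holomorphic" "strict_mono (r :: nat \<Rightarrow> nat)" "mixed_norm a b (polar g) \<le> ennreal m"
    "\<And>R. R < 1 \<Longrightarrow> uniform_limit (cball 0 R) (\<lambda>n z. f (r n) z - g z) (\<lambda>z. 0) sequentially"
proof -
  have hol: "h holomorphic_on unit_disc" if "h \<in> range f" for h
    using that f vanishing_holomorphicD(1) by auto
  have loc_bdd: "\<exists>B. \<forall>h\<in>range f. \<forall>z\<in>K. cmod (h z) \<le> B" if K: "compact K" "K \<subseteq> unit_disc" for K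
  proof (cases "K = {}")
    case False
    obtain R where R: "R < 1" "\<And>z. z \<in> K \<Longrightarrow> cmod z \<le> R"
    proof -
      obtain w where "w \<in> K" "\<And>z. z \<in> K \<Longrightarrow> cmod z \<le> cmod w"
        using continuous_attains_sup[of K cmod] K False by (auto intro: continuous_intros)
      then show ?thesis using that[of "cmod w"] K by auto
    qed
    obtain C where C: "0 < C" "\<And>f z. f \<in> vanishing_holomorphic \<Longrightarrow> cmod z \<le> R \<Longrightarrow> ennreal (cmod (f z)) \<le> ennreal C * mixed_norm a b (polar f)"
      by (rule polar_ball_estimate[OF a b R(1)]) (rule that)
    show ?thesis
    proof (intro exI ballI)
      fix h z assume "h \<in> range f" and z: "z \<in> K"
      then obtain n where n: "h = f n" by auto
      have "ennreal (cmod (f n z)) \<le> ennreal C * mixed_norm a b (polar (f n))"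
        using R(2)[OF z] by (intro C f)
      \<comment> \<open>\<open>ennreal m\<close> is 0 for negative \<open>m\<close>; the real bound
        has to reflect this.\<close>
      also have "\<dots> \<le> ennreal C * ennreal (max m 0)"
        using bdd[of n] by (intro mult_left_mono) (auto simp: max_def ennreal_neg split: if_splits)
      finally have "ennreal (cmod (f n z)) \<le> ennreal (C * max m 0)"
        using C by (simp add: ennreal_mult)
      then show "cmod (h z) \<le> C * max m 0"
        using C n by (subst (asm) ennreal_le_iff) auto
    qed
  qed auto
  obtain g0 r where g0: "g0 holomorphic_on unit_disc" and r: "strict_mono (r :: nat \<Rightarrow> nat)"
    and pw: "\<And>x. x \<in> unit_disc \<Longrightarrow> (\<lambda>n. f (r n) x) \<longlonglongrightarrow> g0 x"
    and unif: "\<And>K. compact K \<Longrightarrow> K \<subseteq> unit_disc \<Longrightarrow> uniform_limit K (f \<circ> r) g0 sequentially"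
    by (rule Montel[OF open_ball _ _ order_refl], erule hol, erule (1) loc_bdd) (rule that)
  \<comment> \<open>Montel controls the limit on the disc only; outside it is reset to 0.\<close>
  define g where "g z = (if z \<in> unit_disc then g0 z else 0)" for z
  have g: "g \<in> vanishing_holomorphic"
    using g0 holomorphic_transform[of g0 unit_disc g] by (auto simp: vanishing_holomorphic_def g_def)
  show ?thesis
  proof (rule that[OF g r])
    show "mixed_norm a b (polar g) \<le> ennreal m"
      using pw by (intro mixed_norm_polar_Fatou[OF f[of "r _"] g _ bdd a(1) b(1)]) (simp add: g_def)
    fix R :: real assume "R < 1"
    then have sub: "cball 0 R \<subseteq> unit_disc" by auto
    then have "uniform_limit (cball 0 R) (f \<circ> r) g sequentially"
      using unif[of "cball 0 R"] by (subst uniform_limit_cong'[of _ _ "f \<circ> r" _ g0]) (auto simp: g_def)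
    then show "uniform_limit (cball 0 R) (\<lambda>n z. f (r n) z - g z) (\<lambda>z. 0) sequentially"
      by (simp add: uniform_limit_iff dist_norm)
  qed
qed

text \<open>The inclusion follows from the tail estimate with epsilon = 1 and boundedness of
  \<open>f\<close> on a closed disc. For compactness, the differences between a locally uniformly
  convergent subsequence and its limit are bounded by 2C in the source norm and tend to 0 locally
  uniformly, hence in the target norm.\<close>

lemma compact_embedding:
  fixes p\<^sub>0 q\<^sub>0 p q :: ennreal
  assumes p0: "1 \<le> p\<^sub>0" "1 \<le> q\<^sub>0" and p: "1 \<le> p" "1 \<le> q"
    and a: "enn2real (1 / p\<^sub>0) < enn2real (1 / p)"
    and ab: "enn2real (1 / p\<^sub>0) + enn2real (1 / q\<^sub>0) < enn2real (1 / p) + enn2real (1 / q)"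
  shows "RM p\<^sub>0 q\<^sub>0 \<subseteq> RM p q"
    and "compact_operator (RM p\<^sub>0 q\<^sub>0) (RM_norm p\<^sub>0 q\<^sub>0) (RM p q) (RM_norm p q) (\<lambda>f. f)"
proof -
  let ?N\<^sub>0 = "\<lambda>f. mixed_norm (enn2real (1 / p\<^sub>0)) (enn2real (1 / q\<^sub>0)) (polar f)"
  let ?N = "\<lambda>f. mixed_norm (enn2real (1 / p)) (enn2real (1 / q)) (polar f)"
  note bnds = enn2real_inverse_bounds[OF p0(1)] enn2real_inverse_bounds[OF p0(2)]
    enn2real_inverse_bounds[OF p(1)] enn2real_inverse_bounds[OF p(2)]
  show sub: "RM p\<^sub>0 q\<^sub>0 \<subseteq> RM p q"
  proof
    fix f assume f: "f \<in> RM p\<^sub>0 q\<^sub>0"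
    then have V: "f \<in> vanishing_holomorphic" "?N\<^sub>0 f < top" using p0 by (auto simp: in_RM_iff)
    obtain R where R: "1 / 2 \<le> R" "R < 1" and tail: "\<And>f. f \<in> vanishing_holomorphic \<Longrightarrow>
      mixed_norm (enn2real (1 / p)) (enn2real (1 / q)) (\<lambda>t r. polar f t r * indicator {R<..} r) \<le> ennreal 1 * ?N\<^sub>0 f"
      by (rule polar_tail_estimate[OF bnds(1) a bnds(8) bnds(10,11) bnds(4,5) ab zero_less_one]) (rule that)
    have "continuous_on (cball 0 R) f"
      using holomorphic_on_imp_continuous_on[OF vanishing_holomorphicD(1)[OF V(1)]] R
      by (auto intro: continuous_on_subset)
    then have "bounded (f ` cball 0 R)" by (intro compact_imp_bounded compact_continuous_image) auto
    then obtain B where "\<forall>z\<in>cball 0 R. cmod (f z) \<le> B" by (auto simp: bounded_iff)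
    then have "cmod (f z) \<le> B" if "cmod z \<le> R" for z using that by simp
    then have "?N f \<le> ennreal B + mixed_norm (enn2real (1 / p)) (enn2real (1 / q)) (\<lambda>t r. polar f t r * indicator {R<..} r)"
      using vanishing_holomorphicD[OF V(1)] bnds by (intro mixed_norm_split) auto
    also have "\<dots> \<le> ennreal B + ennreal 1 * ?N\<^sub>0 f"
      using V(1) by (intro add_left_mono tail)
    also have "\<dots> < top" using V by simp
    finally show "f \<in> RM p q" using V p by (simp add: in_RM_iff)
  qed
  interpret Metric_space "RM p q" "\<lambda>f g. RM_norm p q (\<lambda>z. f z - g z)"
    using p by (rule Metric_space_RM)
  show "compact_operator (RM p\<^sub>0 q\<^sub>0) (RM_norm p\<^sub>0 q\<^sub>0) (RM p q) (RM_norm p q) (\<lambda>f. f)"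
    unfolding compact_operator_def linear_operator_def norm_topology_def
  proof (intro conjI allI impI ballI)
    show "(\<lambda>f. f) \<in> RM p\<^sub>0 q\<^sub>0 \<rightarrow> RM p q" using sub by auto
    fix S assume S: "S \<subseteq> RM p\<^sub>0 q\<^sub>0 \<and> (\<exists>C. \<forall>f\<in>S. RM_norm p\<^sub>0 q\<^sub>0 f \<le> C)"
    then obtain C where C: "\<And>f. f \<in> S \<Longrightarrow> RM_norm p\<^sub>0 q\<^sub>0 f \<le> C" by auto
    show "compactin mtopology (mtopology closure_of (\<lambda>f. f) ` S)"
      unfolding image_ident
    proof (rule compactin_closure_ofI)
      show "S \<subseteq> RM p q" using S sub by auto
      fix \<sigma> :: "nat \<Rightarrow> complex \<Rightarrow> complex" assume \<sigma>: "range \<sigma> \<subseteq> S"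
      have "\<sigma> n \<in> RM p\<^sub>0 q\<^sub>0" for n using \<sigma> S by auto
      then have V: "\<sigma> n \<in> vanishing_holomorphic" for n using p0 by (simp add: in_RM_iff)
      have bdd: "?N\<^sub>0 (\<sigma> n) \<le> ennreal C" for n
      proof -
        have "\<sigma> n \<in> S" using \<sigma> by auto
        then have "enn2real (?N\<^sub>0 (\<sigma> n)) \<le> C" "?N\<^sub>0 (\<sigma> n) < top"
          using C[of "\<sigma> n"] RM_norm_eq[OF p0 V] S p0 by (auto simp: in_RM_iff)
        then show ?thesis by (metis ennreal_enn2real ennreal_leI)
      qed
      obtain g r where g: "g \<in> vanishing_holomorphic" "strict_mono (r :: nat \<Rightarrow> nat)" "?N\<^sub>0 g \<le> ennreal C"
        and unif: "\<And>R. R < 1 \<Longrightarrow> uniform_limit (cball 0 R) (\<lambda>n z. \<sigma> (r n) z - g z) (\<lambda>z. 0) sequentially"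
        by (rule bounded_sequence_convergent_subsequence[where f = \<sigma>, OF bnds(1,2) bnds(4,5) V bdd]) (rule that)
      have diffV: "(\<lambda>z. \<sigma> (r n) z - g z) \<in> vanishing_holomorphic" for n
        by (intro vanishing_holomorphic_diff V g)
      have "?N\<^sub>0 (\<lambda>z. \<sigma> (r n) z - g z) \<le> ennreal (C + C)" for n
      proof -
        have "?N\<^sub>0 (\<lambda>z. \<sigma> (r n) z - g z) \<le> ?N\<^sub>0 (\<sigma> (r n)) + ?N\<^sub>0 g"
          by (intro mixed_norm_polar_add_le V g diffV norm_triangle_ineq4 bnds)
        also have "\<dots> \<le> ennreal C + ennreal C" by (intro add_mono bdd g)
        also have "\<dots> \<le> ennreal (C + C)" by (cases "0 \<le> C") (auto simp: ennreal_neg simp flip: ennreal_plus)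
        finally show ?thesis .
      qed
      then have "(\<lambda>n. ?N (\<lambda>z. \<sigma> (r n) z - g z)) \<longlonglongrightarrow> 0"
        using diffV unif
        by (intro polar_uniform_limit_imp_mixed_norm[OF bnds(1) a bnds(8) bnds(10,11) bnds(4,5) ab, of _ "C + C"]) auto
      then have "(\<lambda>n. RM_norm p q (\<lambda>z. \<sigma> (r n) z - g z)) \<longlonglongrightarrow> 0"
        using tendsto_enn2real[of _ 0] RM_norm_eq[OF p diffV] by fastforce
      moreover have "g \<in> RM p\<^sub>0 q\<^sub>0" using g p0 le_less_trans[OF g(3)] by (simp add: in_RM_iff)
      ultimately show "\<exists>l r. l \<in> RM p q \<and> strict_mono r \<and> (\<lambda>n. RM_norm p q (\<lambda>z. \<sigma> (r n) z - l z)) \<longlonglongrightarrow> 0"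
        using g sub by blast
    qed
  qed auto
qed

section \<open>Test functions\<close>

text \<open>Compactness gives a subsequence converging in the target norm. Point evaluations are
  continuous there, so the limit agrees with the pointwise limit 0, and the norms along the
  subsequence tend to 0. A uniform positive lower bound on these norms is thereby excluded.\<close>

lemma compact_operator_null_sequence:
  fixes p\<^sub>0 q\<^sub>0 p q :: ennreal and f :: "nat \<Rightarrow> complex \<Rightarrow> complex"
  assumes p0: "1 \<le> p\<^sub>0" "1 \<le> q\<^sub>0" and p: "1 \<le> p" "1 \<le> q"
    and compact: "compact_operator (RM p\<^sub>0 q\<^sub>0) (RM_norm p\<^sub>0 q\<^sub>0) (RM p q) (RM_norm p q) (\<lambda>f. f)"
    and f: "\<And>n. f n \<in> vanishing_holomorphic"
    and bdd: "\<And>n. mixed_norm (enn2real (1 / p\<^sub>0)) (enn2real (1 / q\<^sub>0)) (polar (f n)) \<le> ennreal m"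
    and lim: "\<And>z. z \<in> unit_disc \<Longrightarrow> (\<lambda>n. f n z) \<longlonglongrightarrow> 0" and c: "0 < c"
  shows "\<exists>n. mixed_norm (enn2real (1 / p)) (enn2real (1 / q)) (polar (f n)) < ennreal c"
proof -
  let ?N = "\<lambda>f. mixed_norm (enn2real (1 / p)) (enn2real (1 / q)) (polar f)"
  interpret Metric_space "RM p q" "\<lambda>f g. RM_norm p q (\<lambda>z. f z - g z)"
    using p by (rule Metric_space_RM)
  have V: "f \<in> vanishing_holomorphic" if "f \<in> RM p q" for f using that p by (simp add: in_RM_iff)
  have RM0: "f n \<in> RM p\<^sub>0 q\<^sub>0" for n
    using f p0 le_less_trans[OF bdd] by (simp add: in_RM_iff)
  then have RM: "f n \<in> RM p q" for n
    using compact by (auto simp: compact_operator_def linear_operator_def)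
  have "RM_norm p\<^sub>0 q\<^sub>0 (f n) \<le> enn2real (ennreal m)" for n
    unfolding RM_norm_eq[OF p0 f] using bdd by (intro enn2real_mono) auto
  then have "range f \<subseteq> RM p\<^sub>0 q\<^sub>0 \<and> (\<exists>C. \<forall>g\<in>range f. RM_norm p\<^sub>0 q\<^sub>0 g \<le> C)"
    using RM0 by auto
  then have comp: "compactin mtopology (mtopology closure_of ((\<lambda>f. f) ` range f))"
    using compact unfolding compact_operator_def norm_topology_def by blast
  have "range f \<subseteq> mtopology closure_of ((\<lambda>f. f) ` range f)"
    unfolding image_ident using RM by (intro closure_of_subset) auto
  then obtain l r where r: "strict_mono (r :: nat \<Rightarrow> nat)" and "limitin mtopology (f \<circ> r) l sequentially"
    using comp unfolding compactin_sequentially by blast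
  then have l: "l \<in> RM p q" and l_lim: "(\<lambda>n. RM_norm p q (\<lambda>z. f (r n) z - l z)) \<longlonglongrightarrow> 0"
    by (auto simp: limitin_metric_dist_null)
  have diff: "(\<lambda>z. f (r n) z - l z) \<in> RM p q" for n by (rule RM_diff[OF p RM l])
  have "l z = 0" for z
  proof (cases "z \<in> unit_disc")
    case True
    then have z: "cmod z < 1" by simp
    obtain K where K: "0 < K" "\<And>f w. f \<in> vanishing_holomorphic \<Longrightarrow> cmod w \<le> cmod z \<Longrightarrow>
        ennreal (cmod (f w)) \<le> ennreal K * ?N f"
      by (rule polar_ball_estimate[OF enn2real_inverse_bounds(1,2)[OF p(1)] enn2real_inverse_bounds(1,2)[OF p(2)] z])
        (rule that)
    have bd: "cmod (f (r n) z - l z) \<le> K * RM_norm p q (\<lambda>z. f (r n) z - l z)" for n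
    proof -
      have "?N (\<lambda>z. f (r n) z - l z) = ennreal (RM_norm p q (\<lambda>z. f (r n) z - l z))"
        using RM_norm_eq[OF p V[OF diff]] diff[of n] p by (simp add: in_RM_iff)
      then have "ennreal (cmod (f (r n) z - l z)) \<le> ennreal (K * RM_norm p q (\<lambda>z. f (r n) z - l z))"
        using K(2)[OF V[OF diff] order_refl, of n] K(1) by (simp add: ennreal_mult RM_norm_def)
      then show ?thesis
        using K(1) by (subst (asm) ennreal_le_iff) (auto simp: RM_norm_def)
    qed
    have "(\<lambda>n. K * RM_norm p q (\<lambda>z. f (r n) z - l z)) \<longlonglongrightarrow> 0"
      using tendsto_mult_left[OF l_lim, of K] by simp
    then have "(\<lambda>n. f (r n) z - l z) \<longlonglongrightarrow> 0"
      by (rule Lim_null_comparison[rotated]) (use bd in auto)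
    moreover have "(\<lambda>n. f (r n) z - l z) \<longlonglongrightarrow> 0 - l z"
      using LIMSEQ_subseq_LIMSEQ[OF lim[OF True] r] by (intro tendsto_diff) (auto simp: o_def)
    ultimately show ?thesis using LIMSEQ_unique by fastforce
  qed (use V[OF l] vanishing_holomorphicD in auto)
  then have "(\<lambda>n. RM_norm p q (f (r n))) \<longlonglongrightarrow> 0" using l_lim by simp
  then have "\<forall>\<^sub>F n in sequentially. RM_norm p q (f (r n)) < c"
    using c by (simp add: order_tendsto_iff)
  then obtain n where n: "RM_norm p q (f (r n)) < c" by (auto dest: eventually_happens)
  have "?N (f (r n)) = ennreal (RM_norm p q (f (r n)))"
    using RM_norm_eq[OF p f] RM[of "r n"] p by (simp add: in_RM_iff)
  then have "?N (f (r n)) < ennreal c"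
    using n by (simp add: ennreal_less_iff RM_norm_def)
  then show ?thesis by blast
qed

section \<open>Monomials: necessity of the condition on the radial exponents\<close>

lemma powr_bounds_01:
  fixes x a :: real
  assumes "0 \<le> a" "a \<le> 1"
  shows "1 \<le> x \<Longrightarrow> x powr a \<le> x" "0 \<le> x \<Longrightarrow> x \<le> 1 \<Longrightarrow> x \<le> x powr a"
  using assms powr_mono[of a 1 x] powr_mono'[of a 1 x] by (auto simp: powr_le1)

text \<open>With N = n + 1, the modulus of z^N is of order 1 only where 1 - |z| is at most of order
  1/N, so N^a normalises it for radial exponent 1/a. The modulus does not depend on the
  angle.\<close>

definition monomial_test :: "real \<Rightarrow> nat \<Rightarrow> complex \<Rightarrow> complex" where
  "monomial_test a n z = (if z \<in> unit_disc then of_real (real (Suc n) powr a) * z ^ Suc n else 0)"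

lemma monomial_test_vanishing_holomorphic: "monomial_test a n \<in> vanishing_holomorphic"
proof -
  have "(\<lambda>z. of_real (real (Suc n) powr a) * z ^ Suc n) holomorphic_on unit_disc"
    by (intro holomorphic_intros)
  then have "monomial_test a n holomorphic_on unit_disc"
    by (rule holomorphic_transform) (simp add: monomial_test_def)
  then show ?thesis by (simp add: vanishing_holomorphic_def monomial_test_def)
qed

lemma polar_monomial_test:
  "0 \<le> r \<Longrightarrow> r < 1 \<Longrightarrow> polar (monomial_test a n) t r = ennreal (real (Suc n) powr a * r ^ Suc n)"
  using cmod_rcis_in[of r t] by (simp add: polar_def monomial_test_def norm_mult norm_power)

lemma monomial_test_upper:
  assumes a: "0 \<le> a" "a \<le> 1" and b: "0 \<le> b"
  shows "mixed_norm a b (polar (monomial_test a n)) \<le> 1"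
proof -
  define N where "N = real (Suc n)"
  have N: "1 \<le> N" by (simp add: N_def)
  \<comment> \<open>Cutting off outside [0,1) makes \<open>k\<close> at most 1 everywhere, as
    \<open>pnorm_le_integral\<close> requires.\<close>
  define k where "k r = ennreal (r ^ Suc n) * indicator {0..<1} r" for r :: real
  have [measurable]: "k \<in> borel_measurable borel" unfolding k_def by measurable
  have k: "pnorm radial_measure a k \<le> ennreal ((1 / N) powr a)"
  proof (rule pnorm_le_integral)
    have "(\<integral>\<^sup>+r. k r \<partial>radial_measure) = (\<integral>\<^sup>+r\<in>{0..<1}. k r \<partial>lborel)"
      by (intro nn_integral_radial_measure) measurable
    also have "\<dots> \<le> (\<integral>\<^sup>+r\<in>{0..1}. ennreal (r powr real (Suc n)) \<partial>lborel)"
      by (intro nn_integral_mono) (auto simp: k_def powr_realpow' split: split_indicator simp del: power_Suc of_nat_Suc)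
    also have "\<dots> = ennreal (1 / (real (Suc n) + 1))"
      using has_integral_powr_from_0[of "real (Suc n)" 1]
      by (intro nn_integral_has_integral_lebesgue') auto
    also have "\<dots> \<le> ennreal (1 / N)" by (intro ennreal_leI) (simp add: N_def divide_simps)
    finally show "(\<integral>\<^sup>+r. k r \<partial>radial_measure) \<le> ennreal (1 / N)" .
    show "k r \<le> 1" for r
      by (auto simp: k_def split: split_indicator simp del: power_Suc intro: power_le_one)
  qed (use a N in auto)
  have "mixed_norm a b (polar (monomial_test a n)) \<le> mixed_norm a b (\<lambda>t r. ennreal (N powr a) * (1 * k r))"
    using a b polar_measurable[OF vanishing_holomorphicD[OF monomial_test_vanishing_holomorphic]]
    by (intro mixed_norm_mono) (auto simp: polar_monomial_test k_def ennreal_mult N_def simp del: power_Suc of_nat_Suc)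
  also have "\<dots> = ennreal (N powr a) * mixed_norm a b (\<lambda>t r. 1 * k r)"
    using a b by (intro mixed_norm_cmult) auto
  also have "mixed_norm a b (\<lambda>t r. 1 * k r) = pnorm circle_measure b (\<lambda>t. 1) * pnorm radial_measure a k"
    using a b le_less_trans[OF k] by (intro mixed_norm_product) auto
  also have "ennreal (N powr a) * \<dots> \<le> ennreal (N powr a) * (1 * ennreal ((1 / N) powr a))"
    using b by (intro mult_left_mono mult_mono k) (auto simp: pnorm_circle_const)
  also have "\<dots> = 1"
    using N by (simp add: powr_divide flip: ennreal_mult)
  finally show ?thesis .
qed

text \<open>On the last stretch of length 1/(2N), Bernoulli's inequality gives r^N >= 1/2. This
  yields N^(a0-a) * (1/2)^a / 2, where a0 stands for \<open>a\<^sub>0\<close>; it is at least 1/4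
  because a <= a0 and a <= 1.\<close>

lemma monomial_test_lower:
  assumes a: "0 \<le> a" "a \<le> a\<^sub>0" "a\<^sub>0 \<le> 1" and b: "0 \<le> b"
  shows "ennreal (1 / 4) \<le> mixed_norm a b (polar (monomial_test a\<^sub>0 n))"
proof -
  define N where "N = real (Suc n)"
  have N: "1 \<le> N" by (simp add: N_def)
  define k :: "real \<Rightarrow> ennreal" where "k = indicator {1 - 1 / (2 * N)..}"
  have [measurable]: "k \<in> borel_measurable borel" unfolding k_def by measurable
  have ge: "ennreal (N powr a\<^sub>0 / 2) * k r \<le> polar (monomial_test a\<^sub>0 n) t r" if r: "0 \<le> r" "r < 1" for t r
  proof (cases "1 - 1 / (2 * N) \<le> r")
    case True
    have "1 / 2 = 1 + real (Suc n) * (- (1 / (2 * N)))" by (simp add: N_def field_simps)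
    also have "\<dots> \<le> (1 + - (1 / (2 * N))) ^ Suc n"
      using N by (intro Bernoulli_inequality) (simp add: field_simps)
    also have "\<dots> \<le> r ^ Suc n" using True N by (intro power_mono) (auto simp: field_simps)
    finally have "N powr a\<^sub>0 * (1 / 2) \<le> N powr a\<^sub>0 * r ^ Suc n" by (intro mult_left_mono) auto
    then show ?thesis using True r
      by (simp add: polar_monomial_test k_def N_def ennreal_leI del: power_Suc of_nat_Suc)
  qed (simp add: k_def)
  have int: "{0..<1} \<inter> {1 - 1 / (2 * N)..} = {1 - 1 / (2 * N)..<1}"
  proof -
    have "0 \<le> 1 - 1 / (2 * N)" using N by (simp add: field_simps)
    then show ?thesis by auto
  qed
  have k: "pnorm radial_measure a k = ennreal ((1 / (2 * N)) powr a)"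
    unfolding k_def using N a by (intro pnorm_indicator) (auto simp: emeasure_radial_measure int)
  have "1 / 4 \<le> N powr a\<^sub>0 / 2 * (1 / (2 * N)) powr a"
  proof -
    have "N powr a\<^sub>0 / 2 * (1 / (2 * N)) powr a = N powr (a\<^sub>0 - a) * (1 / 2) powr a / 2"
      using N by (simp add: powr_divide powr_mult powr_diff)
    moreover have "1 * (1 / 2) \<le> N powr (a\<^sub>0 - a) * (1 / 2) powr a"
      using N a powr_bounds_01(2)[of a "1 / 2"] by (intro mult_mono ge_one_powr_ge_zero) auto
    ultimately show ?thesis by simp
  qed
  then have "ennreal (1 / 4) \<le> ennreal (N powr a\<^sub>0 / 2) * (1 * pnorm radial_measure a k)"
    unfolding k using N by (simp add: ennreal_leI flip: ennreal_mult)
  also have "\<dots> = ennreal (N powr a\<^sub>0 / 2) * mixed_norm a b (\<lambda>t r. 1 * k r)"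
    using a b by (subst mixed_norm_product) (auto simp: k pnorm_circle_const)
  also have "\<dots> = mixed_norm a b (\<lambda>t r. ennreal (N powr a\<^sub>0 / 2) * (1 * k r))"
    using a b by (intro mixed_norm_cmult[symmetric]) auto
  also have "\<dots> \<le> mixed_norm a b (polar (monomial_test a\<^sub>0 n))"
    using a b ge by (intro mixed_norm_mono) auto
  finally show ?thesis .
qed

lemma monomial_test_tendsto_0:
  assumes a: "0 \<le> a" "a \<le> 1" and z: "z \<in> unit_disc"
  shows "(\<lambda>n. monomial_test a n z) \<longlonglongrightarrow> 0"
proof (rule Lim_null_comparison)
  have "(\<lambda>n. of_nat n * cmod z ^ n) \<longlonglongrightarrow> 0"
    using z by (intro powser_times_n_limit_0) auto
  then show "(\<lambda>n. of_nat (Suc n) * cmod z ^ Suc n) \<longlonglongrightarrow> 0"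
    by (rule LIMSEQ_Suc)
  show "\<forall>\<^sub>F n in sequentially. cmod (monomial_test a n z) \<le> of_nat (Suc n) * cmod z ^ Suc n"
    using z powr_bounds_01(1)[OF a]
    by (intro always_eventually allI)
       (auto simp: monomial_test_def norm_mult norm_power simp del: power_Suc of_nat_Suc intro!: mult_right_mono)
qed

section \<open>Kernel functions: necessity of the condition on the sums\<close>

lemma sin_ge_half:
  fixes x :: real
  assumes "0 \<le> x" "x \<le> pi / 2"
  shows "x / 2 \<le> sin x"
proof -
  have "\<bar>sin x - (\<Sum>m<3. sin_coeff m * x ^ m)\<bar> \<le> inverse (fact 3) * \<bar>x\<bar> ^ 3"
    by (rule Maclaurin_sin_bound)
  then have "\<bar>sin x - x\<bar> \<le> x ^ 3 / 6"
    using assms by (simp add: numeral_eq_Suc sin_coeff_def)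
  then have "x - x ^ 3 / 6 \<le> sin x" by linarith
  moreover have "x ^ 3 / 6 \<le> x / 2"
  proof -
    \<comment> \<open>The cubic Taylor remainder x^3/6 is at most x/2 as soon as x^2 <= 3, and
      (8/5)^2 = 2.56.\<close>
    have "x \<le> 8 / 5" using assms pi_less_4 pi_approx by simp
    then have "x * x \<le> 8 / 5 * (8 / 5)" using assms by (intro mult_mono) auto
    then have "x * (x * x) \<le> x * 3" using assms by (intro mult_left_mono) auto
    then show ?thesis by (simp add: power3_eq_cube)
  qed
  ultimately show ?thesis by simp
qed

text \<open>The slope 1/4 comes from |sin(t/2)| >= t/4 on [0, pi]. An antiderivative is -4d^2/(d +
  x/4).\<close>

lemma nn_integral_quadratic_decay:
  assumes d: "0 < d"
  shows "(\<integral>\<^sup>+x. ennreal ((d / (d + x / 4))\<^sup>2) * indicator {0..} x \<partial>lborel) = ennreal (4 * d)"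
proof -
  have "(\<integral>\<^sup>+x. ennreal ((d / (d + x / 4))\<^sup>2) * indicator {0..} x \<partial>lborel)
      = ennreal (0 - (- (4 * d\<^sup>2) / (d + 0 / 4)))"
  proof (rule nn_integral_FTC_atLeast)
    fix x :: real assume x: "0 \<le> x"
    then have "d + x / 4 \<noteq> 0" using d by auto
    then show "((\<lambda>x. - (4 * d\<^sup>2) / (d + x / 4)) has_real_derivative (d / (d + x / 4))\<^sup>2) (at x)"
      by (auto intro!: derivative_eq_intros simp: power2_eq_square field_simps)
  next
    have "filterlim (\<lambda>x::real. d + 1 / 4 * x) at_top at_top"
      by (intro filterlim_tendsto_add_at_top[OF tendsto_const]
          filterlim_tendsto_pos_mult_at_top[OF tendsto_const _ filterlim_ident]) auto
    then show "((\<lambda>x. - (4 * d\<^sup>2) / (d + x / 4)) \<longlongrightarrow> 0) at_top"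
      by (intro tendsto_divide_0[OF tendsto_const] filterlim_at_top_imp_at_infinity) simp
  qed auto
  then show ?thesis using d by (simp add: power2_eq_square)
qed

lemma norm_one_minus_cis: "cmod (1 - cis t) = 2 * \<bar>sin (t / 2)\<bar>"
proof -
  have "(cmod (1 - cis t))\<^sup>2 = (1 - cos t)\<^sup>2 + (sin t)\<^sup>2"
    by (simp add: cmod_power2)
  also have "\<dots> = 2 - 2 * cos t"
    using sin_cos_squared_add[of t] by (simp add: power2_eq_square algebra_simps)
  also have "\<dots> = (2 * \<bar>sin (t / 2)\<bar>)\<^sup>2"
    using cos_double_sin[of "t / 2"] by (simp add: power_mult_distrib)
  finally show ?thesis by (rule power2_eq_imp_eq) auto
qed

text \<open>The first bound is the real part. For the second, 1 - cis t differs from the denominator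
  by terms of total size d + (1-r), which the first bound absorbs, so 2|sin(t/2)| is at most twice
  the denominator.\<close>

lemma kernel_denominator_lower:
  assumes r: "0 \<le> r" "r < 1" and d: "0 < d"
  shows "d + (1 - r) \<le> cmod (1 + of_real d - rcis r t)"
    and "d + \<bar>sin (t / 2)\<bar> \<le> 2 * cmod (1 + of_real d - rcis r t)"
proof -
  have "r * cos t \<le> r * 1" using r by (intro mult_left_mono) auto
  then have "d + (1 - r) \<le> Re (1 + of_real d - rcis r t)" by (simp add: rcis_def)
  also have "\<dots> \<le> cmod (1 + of_real d - rcis r t)" by (rule complex_Re_le_cmod)
  finally show *: "d + (1 - r) \<le> cmod (1 + of_real d - rcis r t)" .
  have eq: "1 - cis t = (1 + of_real d - rcis r t) - of_real d - of_real (1 - r) * cis t"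
    by (simp add: rcis_def algebra_simps)
  have "cmod (A - B - C) \<le> cmod A + cmod B + cmod C" for A B C :: complex
    using norm_triangle_ineq4[of "A - B" C] norm_triangle_ineq4[of A B] by linarith
  then have "cmod (1 - cis t) \<le> cmod (1 + of_real d - rcis r t) + cmod (of_real d) + cmod (of_real (1 - r) * cis t)"
    unfolding eq .
  also have "\<dots> = cmod (1 + of_real d - rcis r t) + d + (1 - r)"
    using d r by (simp add: norm_mult del: of_real_diff)
  finally have "2 * \<bar>sin (t / 2)\<bar> \<le> 2 * cmod (1 + of_real d - rcis r t)"
    using * by (simp add: norm_one_minus_cis)
  moreover have "d \<le> cmod (1 + of_real d - rcis r t)" using * r by simp
  ultimately show "d + \<bar>sin (t / 2)\<bar> \<le> 2 * cmod (1 + of_real d - rcis r t)" by simp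
qed

text \<open>Splitting the denominator into d, 1 - r and r(1 - cis t), each of the three terms is at
  most d in modulus on this box.\<close>

lemma kernel_denominator_upper:
  assumes r: "0 \<le> r" "1 - d \<le> r" "r < 1" and d: "0 < d" and t: "0 \<le> t" "t \<le> d"
  shows "cmod (1 + of_real d - rcis r t) \<le> 3 * d"
proof -
  have "1 + of_real d - rcis r t = of_real d + of_real (1 - r) + of_real r * (1 - cis t)"
    by (simp add: rcis_def algebra_simps)
  then have "cmod (1 + of_real d - rcis r t) \<le> cmod (of_real d) + cmod (of_real (1 - r)) + cmod (of_real r * (1 - cis t))"
    by (metis norm_triangle_ineq norm_triangle_mono order_refl)
  also have "\<dots> = d + (1 - r) + r * (2 * \<bar>sin (t / 2)\<bar>)"
    using d r by (simp add: norm_mult norm_one_minus_cis del: of_real_diff)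
  also have "\<dots> \<le> d + d + 1 * (2 * (t / 2))"
    using r t abs_sin_x_le_abs_x[of "t / 2"] by (intro add_mono mult_mono) auto
  finally show ?thesis using t by simp
qed

text \<open>A bump of height \<open>d powr (- s)\<close> concentrated on a box of side
  \<open>d\<close> at the boundary point 1; the pole 1 + d lies outside the disc.\<close>

definition kernel_test :: "real \<Rightarrow> real \<Rightarrow> complex \<Rightarrow> complex" where
  "kernel_test s d z = (if z \<in> unit_disc then of_real (d powr (- s)) * (of_real d / (1 + of_real d - z)) ^ 4 else 0)"

lemma kernel_test_vanishing_holomorphic:
  assumes "0 < d" shows "kernel_test s d \<in> vanishing_holomorphic"
proof -
  have "1 + of_real d - z \<noteq> 0" if "z \<in> unit_disc" for z
  proof
    assume "1 + of_real d - z = 0"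
    then have "z = of_real (1 + d)" by simp
    then have "cmod z = \<bar>1 + d\<bar>" by (simp only: norm_of_real)
    then show False using that assms by simp
  qed
  then have "(\<lambda>z. of_real (d powr (- s)) * (of_real d / (1 + of_real d - z)) ^ 4) holomorphic_on unit_disc"
    by (intro holomorphic_intros) auto
  then have "kernel_test s d holomorphic_on unit_disc"
    by (rule holomorphic_transform) (simp add: kernel_test_def)
  then show ?thesis by (simp add: vanishing_holomorphic_def kernel_test_def)
qed

lemma polar_kernel_test:
  assumes "0 \<le> r" "r < 1" "0 < d"
  shows "polar (kernel_test s d) t r = ennreal (d powr (- s) * (d / cmod (1 + of_real d - rcis r t)) ^ 4)"
  using cmod_rcis_in[of r t] assms
  by (simp add: polar_def kernel_test_def norm_mult norm_power norm_divide)

text \<open>sin(t/2) vanishes at both ends of [0, 2*pi], so the integrand is dominated by one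
  decaying profile from each end. Their total 8d, divided by 2*pi, is at most 2d.\<close>

lemma nn_integral_circle_decay:
  assumes d: "0 < d"
  shows "(\<integral>\<^sup>+t. ennreal ((d / (d + \<bar>sin (t / 2)\<bar>))\<^sup>2) \<partial>circle_measure) \<le> ennreal (2 * d)"
proof -
  define J where "J x = ennreal ((d / (d + x / 4))\<^sup>2) * indicator {0..} x" for x :: real
  have [measurable]: "J \<in> borel_measurable borel" unfolding J_def by measurable
  have IJ: "(\<integral>\<^sup>+x. J x \<partial>lborel) = ennreal (4 * d)"
    unfolding J_def by (rule nn_integral_quadratic_decay[OF d])
  have IJ': "(\<integral>\<^sup>+x. J (2 * pi - x) \<partial>lborel) = ennreal (4 * d)"
    using IJ nn_integral_real_affine[of J "-1" "2 * pi"] by simp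
  have le: "ennreal ((d / (d + \<bar>sin (t / 2)\<bar>))\<^sup>2) \<le> J t + J (2 * pi - t)" if t: "t \<in> {0..2 * pi}" for t
  proof -
    have mono: "ennreal ((d / (d + \<bar>sin (t / 2)\<bar>))\<^sup>2) \<le> J x" if "0 \<le> x" "x / 4 \<le> \<bar>sin (t / 2)\<bar>" for x
      using that d unfolding J_def by (auto intro!: ennreal_leI power_mono divide_left_mono mult_pos_pos)
    show ?thesis
    proof (cases "t \<le> pi")
      case True
      then have "t / 4 \<le> \<bar>sin (t / 2)\<bar>" using sin_ge_half[of "t / 2"] t by auto
      then show ?thesis using mono[of t] t by (auto intro: order_trans add_increasing2)
    next
      case False
      have "sin (t / 2) = sin (pi - t / 2)" by simp
      then have "(2 * pi - t) / 4 \<le> \<bar>sin (t / 2)\<bar>" using sin_ge_half[of "pi - t / 2"] t False by (auto simp: field_simps)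
      then show ?thesis using mono[of "2 * pi - t"] t by (auto intro: order_trans add_increasing)
    qed
  qed
  have "(\<integral>\<^sup>+t. ennreal ((d / (d + \<bar>sin (t / 2)\<bar>))\<^sup>2) \<partial>circle_measure)
      = ennreal (1 / (2 * pi)) * (\<integral>\<^sup>+t\<in>{0..2*pi}. ennreal ((d / (d + \<bar>sin (t / 2)\<bar>))\<^sup>2) \<partial>lborel)"
    by (intro nn_integral_circle_measure) measurable
  also have "\<dots> \<le> ennreal (1 / (2 * pi)) * (\<integral>\<^sup>+t. J t + J (2 * pi - t) \<partial>lborel)"
    using le by (intro mult_left_mono nn_integral_mono) (auto split: split_indicator)
  also have "(\<integral>\<^sup>+t. J t + J (2 * pi - t) \<partial>lborel) = ennreal (8 * d)"
    using d by (subst nn_integral_add) (auto simp: IJ IJ' simp flip: ennreal_plus)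
  also have "ennreal (1 / (2 * pi)) * ennreal (8 * d) \<le> ennreal (2 * d)"
    using d pi_gt3 by (simp add: ennreal_leI divide_simps flip: ennreal_mult)
  finally show ?thesis .
qed

text \<open>Weakening 1 - r to (1-r)/4 in the denominator reuses the profile of the angular
  integral.\<close>

lemma nn_integral_radial_decay:
  assumes d: "0 < d"
  shows "(\<integral>\<^sup>+r. ennreal ((d / (d + (1 - r)))\<^sup>2) * indicator {0..<1} r \<partial>radial_measure) \<le> ennreal (4 * d)"
proof -
  define J where "J x = ennreal ((d / (d + x / 4))\<^sup>2) * indicator {0..} x" for x :: real
  have [measurable]: "J \<in> borel_measurable borel" unfolding J_def by measurable
  have IJ: "(\<integral>\<^sup>+x. J x \<partial>lborel) = ennreal (4 * d)"
    unfolding J_def by (rule nn_integral_quadratic_decay[OF d])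
  have "(\<integral>\<^sup>+r. ennreal ((d / (d + (1 - r)))\<^sup>2) * indicator {0..<1} r \<partial>radial_measure)
      = (\<integral>\<^sup>+r\<in>{0..<1}. ennreal ((d / (d + (1 - r)))\<^sup>2) * indicator {0..<1} r \<partial>lborel)"
    by (intro nn_integral_radial_measure) measurable
  also have "\<dots> \<le> (\<integral>\<^sup>+r. J (1 + (-1) * r) \<partial>lborel)"
    using d by (intro nn_integral_mono)
      (auto simp: J_def split: split_indicator intro!: ennreal_leI power_mono divide_left_mono mult_pos_pos add_pos_nonneg)
  also have "\<dots> = ennreal (4 * d)"
    using IJ nn_integral_real_affine[of J "-1" 1] by simp
  finally show ?thesis .
qed

text \<open>One square of the kernel is bounded through the radial and the other through the angular
  lower bound of the denominator, so the norm is at most a product of order d^a * d^b, cancelling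
  the height. The constant is 32 = 4 * 2 * 4.\<close>

lemma kernel_test_upper:
  assumes a: "0 \<le> a" "a \<le> 1" and b: "0 \<le> b" "b \<le> 1" and d: "0 < d" "d \<le> 1"
  shows "mixed_norm a b (polar (kernel_test (a + b) d)) \<le> ennreal 32"
proof -
  define k where "k r = ennreal ((d / (d + (1 - r)))\<^sup>2) * indicator {0..<1} r" for r :: real
  define w where "w t = ennreal ((d / (d + \<bar>sin (t / 2)\<bar>))\<^sup>2)" for t :: real
  have [measurable]: "k \<in> borel_measurable borel" "w \<in> borel_measurable borel"
    unfolding k_def w_def by measurable
  have sq: "(d / (d + x))\<^sup>2 \<le> 1" if "0 \<le> x" for x
    using that d by (intro power_le_one) auto
  have w1: "w t \<le> 1" for t using sq[of "\<bar>sin (t / 2)\<bar>"] by (simp add: w_def)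
  have k1: "k r \<le> 1" for r using sq[of "1 - r"] by (simp add: k_def split: split_indicator)
  have k: "pnorm radial_measure a k \<le> ennreal ((4 * d) powr a)"
    using a d k1 nn_integral_radial_decay[OF d(1)] unfolding k_def[symmetric] by (intro pnorm_le_integral) auto
  have w: "pnorm circle_measure b w \<le> ennreal ((2 * d) powr b)"
    using b d w1 nn_integral_circle_decay[OF d(1)] unfolding w_def[symmetric] by (intro pnorm_le_integral) auto
  have le: "polar (kernel_test (a + b) d) t r \<le> ennreal (4 * d powr (- (a + b))) * (w t * k r)"
    if r: "0 \<le> r" "r < 1" for t r
  proof -
    define D where "D = cmod (1 + of_real d - rcis r t)"
    have D: "d + (1 - r) \<le> D" "d + \<bar>sin (t / 2)\<bar> \<le> 2 * D" "0 < D"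
      using kernel_denominator_lower[OF r d(1), of t] r d by (auto simp: D_def)
    have "d / D \<le> d / (d + (1 - r))" using D d r by (intro divide_left_mono mult_pos_pos) auto
    then have 1: "(d / D)\<^sup>2 \<le> (d / (d + (1 - r)))\<^sup>2" using d D by (intro power_mono) auto
    have "d / (2 * D) \<le> d / (d + \<bar>sin (t / 2)\<bar>)" using D d by (intro divide_left_mono mult_pos_pos) auto
    then have "(d / (2 * D))\<^sup>2 \<le> (d / (d + \<bar>sin (t / 2)\<bar>))\<^sup>2" using d D by (intro power_mono) auto
    then have 2: "(d / D)\<^sup>2 \<le> 4 * (d / (d + \<bar>sin (t / 2)\<bar>))\<^sup>2" by (simp add: power_divide)
    have "(d / D) ^ 4 = (d / D)\<^sup>2 * (d / D)\<^sup>2" by (simp flip: power_add)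
    also have "\<dots> \<le> 4 * (d / (d + \<bar>sin (t / 2)\<bar>))\<^sup>2 * (d / (d + (1 - r)))\<^sup>2"
      by (intro mult_mono 1 2) auto
    finally have "d powr (- (a + b)) * (d / D) ^ 4 \<le>
        d powr (- (a + b)) * (4 * (d / (d + \<bar>sin (t / 2)\<bar>))\<^sup>2 * (d / (d + (1 - r)))\<^sup>2)"
      by (intro mult_left_mono) auto
    also have "\<dots> = (4 * d powr (- (a + b))) * ((d / (d + \<bar>sin (t / 2)\<bar>))\<^sup>2 * (d / (d + (1 - r)))\<^sup>2)"
      by simp
    finally show ?thesis
      using r d by (simp only: polar_kernel_test k_def w_def D_def[symmetric])
        (simp add: ennreal_leI flip: ennreal_mult)
  qed
  have "mixed_norm a b (polar (kernel_test (a + b) d)) \<le> mixed_norm a b (\<lambda>t r. ennreal (4 * d powr (- (a + b))) * (w t * k r))"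
    using a b le polar_measurable[OF vanishing_holomorphicD[OF kernel_test_vanishing_holomorphic[OF d(1)]]]
    by (intro mixed_norm_mono) auto
  also have "\<dots> = ennreal (4 * d powr (- (a + b))) * mixed_norm a b (\<lambda>t r. w t * k r)"
    using a b by (intro mixed_norm_cmult) auto
  also have "mixed_norm a b (\<lambda>t r. w t * k r) = pnorm circle_measure b w * pnorm radial_measure a k"
    using a b le_less_trans[OF w1] le_less_trans[OF k] by (intro mixed_norm_product) auto
  also have "ennreal (4 * d powr (- (a + b))) * \<dots> \<le> ennreal (4 * d powr (- (a + b))) * (ennreal ((2 * d) powr b) * ennreal ((4 * d) powr a))"
    by (intro mult_left_mono mult_mono k w) auto
  also have "\<dots> = ennreal (4 * d powr (- (a + b)) * ((2 * d) powr b * (4 * d) powr a))"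
    by (simp add: ennreal_mult)
  also have "\<dots> \<le> ennreal 32"
  proof (rule ennreal_leI)
    have "4 * d powr (- (a + b)) * ((2 * d) powr b * (4 * d) powr a)
        = 4 * (2 powr b * 4 powr a) * (d powr (- (a + b)) * (d powr b * d powr a))"
      using d by (simp add: powr_mult)
    also have "d powr (- (a + b)) * (d powr b * d powr a) = 1"
      using d by (simp flip: powr_add)
    also have "4 * (2 powr b * 4 powr a) * 1 \<le> 4 * (2 * 4) * (1::real)"
      using powr_bounds_01(1)[OF a, of 4] powr_bounds_01(1)[OF b, of 2]
      by (intro mult_mono) auto
    finally show "4 * d powr (- (a + b)) * ((2 * d) powr b * (4 * d) powr a) \<le> 32" by simp
  qed
  finally show ?thesis .
qed

text \<open>On the box 1 - d <= r, 0 <= t <= d the quotient is at least 1/3, so its fourth power is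
  at least 1/81. The indicator of the box has norm d^a * (d/(2*pi))^b, and d^(a+b-s) >= 1 since d <=
  1; hence 162*pi = 81 * 2*pi.\<close>

lemma kernel_test_lower:
  assumes a: "0 \<le> a" "a \<le> 1" and b: "0 \<le> b" "b \<le> 1" and d: "0 < d" "d \<le> 1" and s: "a + b \<le> s"
  shows "ennreal (1 / (162 * pi)) \<le> mixed_norm a b (polar (kernel_test s d))"
proof -
  define k w :: "real \<Rightarrow> ennreal" where "k = indicator {1 - d..}" and "w = indicator {0..d}"
  have [measurable]: "k \<in> borel_measurable borel" "w \<in> borel_measurable borel"
    unfolding k_def w_def by measurable
  have ge: "ennreal (d powr (- s) / 81) * (w t * k r) \<le> polar (kernel_test s d) t r" if r: "0 \<le> r" "r < 1" for t r
  proof (cases "1 - d \<le> r \<and> 0 \<le> t \<and> t \<le> d")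
    case True
    define D where "D = cmod (1 + of_real d - rcis r t)"
    have D: "D \<le> 3 * d" "0 < D"
      using kernel_denominator_upper[of r d t] kernel_denominator_lower(1)[OF r d(1), of t] True r d by (auto simp: D_def)
    have "1 / 3 \<le> d / D" using D d by (simp add: field_simps)
    then have "(1 / 3) ^ 4 \<le> (d / D) ^ 4" by (intro power_mono) auto
    then have "d powr (- s) * (1 / 81) \<le> d powr (- s) * (d / D) ^ 4"
      by (intro mult_left_mono) (auto simp: power_divide)
    then show ?thesis using True r d
      by (simp add: polar_kernel_test k_def w_def D_def[symmetric] ennreal_leI)
  qed (auto simp: k_def w_def)
  have int: "{0..<1} \<inter> {1 - d..} = {1 - d..<1}" "{0..2 * pi} \<inter> {0..d} = {0..d}"
    using d pi_gt3 by auto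
  have k: "pnorm radial_measure a k = ennreal (d powr a)"
    unfolding k_def using d a by (intro pnorm_indicator) (auto simp: emeasure_radial_measure int)
  have w: "pnorm circle_measure b w = ennreal ((d / (2 * pi)) powr b)"
    unfolding w_def using d b by (intro pnorm_indicator) (auto simp: emeasure_circle_measure int(2) simp flip: ennreal_mult simp del: Int_atLeastAtMost)
  have "1 / (162 * pi) \<le> d powr (- s) / 81 * ((d / (2 * pi)) powr b * d powr a)"
  proof -
    have "1 / (2 * pi) \<le> (1 / (2 * pi)) powr b"
      using powr_bounds_01(2)[OF b, of "1 / (2 * pi)"] pi_gt3 by simp
    moreover have "1 \<le> d powr (- (s - (a + b)))"
      using powr_mono'[of "- (s - (a + b))" 0 d] d s by simp
    ultimately have "1 / (2 * pi) * 1 \<le> (1 / (2 * pi)) powr b * d powr (- (s - (a + b)))"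
      by (intro mult_mono) auto
    also have "\<dots> = d powr (- s) * ((d / (2 * pi)) powr b * d powr a)"
      using d by (simp add: powr_divide flip: powr_add) (simp add: add.commute)
    finally show ?thesis by simp
  qed
  then have "ennreal (1 / (162 * pi)) \<le> ennreal (d powr (- s) / 81) * (pnorm circle_measure b w * pnorm radial_measure a k)"
    unfolding k w by (simp add: ennreal_leI flip: ennreal_mult)
  also have "\<dots> = ennreal (d powr (- s) / 81) * mixed_norm a b (\<lambda>t r. w t * k r)"
    using a b by (subst mixed_norm_product) (auto simp: k w_def split: split_indicator)
  also have "\<dots> = mixed_norm a b (\<lambda>t r. ennreal (d powr (- s) / 81) * (w t * k r))"
    using a b by (intro mixed_norm_cmult[symmetric]) auto
  also have "\<dots> \<le> mixed_norm a b (polar (kernel_test s d))"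
    using a b ge by (intro mixed_norm_mono) auto
  finally show ?thesis .
qed

text \<open>For fixed z the denominator is at least 1 - |z|, and d^(4-s) <= d^2 because s <= 2, a
  bound that a sum of two reciprocal exponents always satisfies.\<close>

lemma kernel_test_tendsto_0:
  assumes s: "s \<le> 2" and z: "z \<in> unit_disc"
  shows "(\<lambda>n. kernel_test s (inverse (real (Suc n))) z) \<longlonglongrightarrow> 0"
proof (rule Lim_null_comparison)
  define c where "c = 1 - cmod z"
  have c: "0 < c" using z by (simp add: c_def)
  have "(\<lambda>n. (inverse (real (Suc n)))\<^sup>2 / c ^ 4) \<longlonglongrightarrow> 0\<^sup>2 / c ^ 4"
    using c by (intro tendsto_intros LIMSEQ_inverse_real_of_nat) auto
  then show "(\<lambda>n. (inverse (real (Suc n)))\<^sup>2 / c ^ 4) \<longlonglongrightarrow> 0" by simp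
  show "\<forall>\<^sub>F n in sequentially. cmod (kernel_test s (inverse (real (Suc n))) z) \<le> (inverse (real (Suc n)))\<^sup>2 / c ^ 4"
  proof (intro always_eventually allI)
    fix n
    define d where "d = inverse (real (Suc n))"
    have d: "0 < d" "d \<le> 1" by (auto simp: d_def divide_simps)
    have "cmod (1 + of_real d) = 1 + d" using d by (metis norm_of_real of_real_1 of_real_add abs_of_pos add_pos_pos zero_less_one)
    then have D: "c \<le> cmod (1 + of_real d - z)"
      using norm_triangle_ineq2[of "1 + of_real d" z] d by (simp add: c_def)
    have "cmod (kernel_test s d z) = d powr (- s) * (d / cmod (1 + of_real d - z)) ^ 4"
      using z d by (simp add: kernel_test_def norm_mult norm_power norm_divide)
    also have "\<dots> \<le> d powr (- 2) * (d / c) ^ 4"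
      using s d D c by (intro mult_mono powr_mono' power_mono divide_left_mono mult_pos_pos) auto
    also have "\<dots> = d\<^sup>2 / c ^ 4"
      using d by (simp add: powr_minus power_divide power2_eq_square power4_eq_xxxx field_simps)
    finally show "cmod (kernel_test s (inverse (real (Suc n))) z) \<le> (inverse (real (Suc n)))\<^sup>2 / c ^ 4"
      by (simp add: d_def)
  qed
qed

section \<open>The equivalence\<close>

lemma enn2real_inverse_less_iff:
  fixes p p\<^sub>0 :: ennreal
  assumes "1 \<le> p" "1 \<le> p\<^sub>0"
  shows "enn2real (1 / p\<^sub>0) < enn2real (1 / p) \<longleftrightarrow> p < p\<^sub>0"
proof -
  have inv: "enn2real (1 / ennreal r) = 1 / r" if "1 \<le> r" for r
    using that divide_ennreal[of 1 r] by simp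
  show ?thesis
    using assms by (cases p; cases p\<^sub>0) (auto simp: inv ennreal_less_iff field_simps)
qed

theorem theorem3p8:
  fixes p\<^sub>0 q\<^sub>0 p q :: ennreal
  assumes "1 \<le> p\<^sub>0" "1 \<le> q\<^sub>0" "1 \<le> p" "1 \<le> q"
  shows "(RM p\<^sub>0 q\<^sub>0 \<subseteq> RM p q \<and>
          compact_operator (RM p\<^sub>0 q\<^sub>0) (RM_norm p\<^sub>0 q\<^sub>0) (RM p q) (RM_norm p q) (\<lambda>f. f))
         \<longleftrightarrow> (1 / p + 1 / q > 1 / p\<^sub>0 + 1 / q\<^sub>0 \<and> p < p\<^sub>0)"
proof -
  define a\<^sub>0 b\<^sub>0 a b where "a\<^sub>0 = enn2real (1 / p\<^sub>0)" and "b\<^sub>0 = enn2real (1 / q\<^sub>0)"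
    and "a = enn2real (1 / p)" and "b = enn2real (1 / q)"
  note ab_def = a\<^sub>0_def b\<^sub>0_def a_def b_def
  have bnds: "0 \<le> a\<^sub>0" "a\<^sub>0 \<le> 1" "0 \<le> b\<^sub>0" "b\<^sub>0 \<le> 1" "0 \<le> a" "a \<le> 1" "0 \<le> b" "b \<le> 1"
    using assms by (auto simp: ab_def enn2real_inverse_bounds)
  have sum: "1 / p + 1 / q > 1 / p\<^sub>0 + 1 / q\<^sub>0 \<longleftrightarrow> a\<^sub>0 + b\<^sub>0 < a + b"
  proof -
    have "1 / p\<^sub>0 + 1 / q\<^sub>0 = ennreal (a\<^sub>0 + b\<^sub>0)" "1 / p + 1 / q = ennreal (a + b)"
      using bnds assms by (simp_all add: ab_def enn2real_inverse_bounds)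
    then show ?thesis using bnds by (simp add: ennreal_less_iff del: ennreal_plus)
  qed
  have less: "p < p\<^sub>0 \<longleftrightarrow> a\<^sub>0 < a"
    using enn2real_inverse_less_iff[OF assms(3,1)] by (simp add: ab_def)
  show ?thesis
  proof
    assume "1 / p + 1 / q > 1 / p\<^sub>0 + 1 / q\<^sub>0 \<and> p < p\<^sub>0"
    then show "RM p\<^sub>0 q\<^sub>0 \<subseteq> RM p q \<and>
        compact_operator (RM p\<^sub>0 q\<^sub>0) (RM_norm p\<^sub>0 q\<^sub>0) (RM p q) (RM_norm p q) (\<lambda>f. f)"
      using compact_embedding[OF assms] sum less by (simp add: ab_def)
  next
    assume "RM p\<^sub>0 q\<^sub>0 \<subseteq> RM p q \<and>
        compact_operator (RM p\<^sub>0 q\<^sub>0) (RM_norm p\<^sub>0 q\<^sub>0) (RM p q) (RM_norm p q) (\<lambda>f. f)"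
    then have compact: "compact_operator (RM p\<^sub>0 q\<^sub>0) (RM_norm p\<^sub>0 q\<^sub>0) (RM p q) (RM_norm p q) (\<lambda>f. f)" by simp
    note null = compact_operator_null_sequence[OF assms compact, folded ab_def]
    \<comment> \<open>In both contradictions the constant passed to \<open>null\<close> is the
      uniform lower bound of the test functions in the target norm, and \<open>m\<close> is their
      upper bound in the source norm.\<close>
    have "a\<^sub>0 < a"
    proof (rule ccontr)
      assume "\<not> a\<^sub>0 < a"
      then have le: "a \<le> a\<^sub>0" by simp
      have "\<exists>n. mixed_norm a b (polar (monomial_test a\<^sub>0 n)) < ennreal (1 / 4)"
        using bnds monomial_test_upper[of a\<^sub>0 b\<^sub>0]
        by (intro null[where m = 1] monomial_test_vanishing_holomorphic monomial_test_tendsto_0) auto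
      then show False
        using monomial_test_lower[of a a\<^sub>0 b] bnds le by (meson not_less)
    qed
    moreover have "a\<^sub>0 + b\<^sub>0 < a + b"
    proof (rule ccontr)
      assume "\<not> a\<^sub>0 + b\<^sub>0 < a + b"
      then have le: "a + b \<le> a\<^sub>0 + b\<^sub>0" by simp
      have d: "0 < inverse (real (Suc n))" "inverse (real (Suc n)) \<le> 1" for n
        by (auto simp: divide_simps)
      have "\<exists>n. mixed_norm a b (polar (kernel_test (a\<^sub>0 + b\<^sub>0) (inverse (real (Suc n))))) < ennreal (1 / (162 * pi))"
        using bnds d
        by (intro null[where m = 32] kernel_test_vanishing_holomorphic kernel_test_tendsto_0 kernel_test_upper) auto
      then show False
        using kernel_test_lower[OF bnds(5-8) d le] by (meson not_less)
    qed
    ultimately show "1 / p + 1 / q > 1 / p\<^sub>0 + 1 / q\<^sub>0 \<and> p < p\<^sub>0"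
      using sum less by simp
  qed
qed

end
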